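(* Let $T_a:[0,1]\to[0,1]$, $a\in[0,1]$, be a one-parameter family of piecewise expanding maps satisfying properties (i)-(iii) of the context, and let $x_0:[0,1]\to[0,1]$ be a $C^{1+\alpha}$ map with $x_0(a)\in K(a)\setminus\{b_0(a),\dots,b_{p_0}(a)\}$ for all $a\in(0,1)$. If conditions (I), (II), (III) of the context are satisfied and if there exist $\epsilon>0$ and a constant $C$ such that $$\operatorname*{ess\,inf}_{x\in K(a)}h_a(x)\ge C^{-1}\qquad\text{for all }a\in[0,\epsilon],$$ then there exists $0<\epsilon'\le\epsilon$ such that $x_0(a)$ is typical for $\mu_a$ for almost every $a\in[0,\epsilon']$, i.e. $$\lim_{n\to\infty}\frac1n\sum_{i=1}^n\varphi(T_a^i(x_0(a)))=\int_0^1\varphi\,d\mu_a\qquad\text{for all }\varphi\in C^0([0,1]).$$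
   Context: Family. Fix $0<\alpha\le1$. For each $a\in[0,1]$ there is a partition $0=b_0(a)<b_1(a)<\dots<b_{p_0}(a)=1$ such that $T_a$ restricted to each $(b_{k-1}(a),b_k(a))$ is $C^{1+\alpha}$; there is $C$ with $|T_a'(x)-T_a'(y)|\le C|x-y|^\alpha$ for all $x,y\in(b_{k-1}(a),b_k(a))$, all $k$ and $a$; and there are $1<\lambda\le\Lambda<\infty$ with $\|1/T_a'\|_\infty\le\lambda^{-1}$, $\|T_a'\|_\infty\le\Lambda$ for all $a$. Here $T_a'=\partial_xT_a$. Each $T_a$ is assumed to have a unique absolutely continuous invariant probability measure $\mu_a$, with density $h_a$ with respect to Lebesgue measure; $K(a)=\mathrm{supp}(\mu_a)$ is a finite union of intervals. $T_a$ is mixing if it is topologically mixing on $K(a)$. Let $D_1(a),\dots,D_{p_1(a)}(a)$ be the connected components of $K(a)\setminus\{b_0(a),\dots,b_{p_0}(a)\}$. Properties: (i) $p_0$ does not depend on $a$ and the $b_k(a)$ are Lipschitz continuous in $a\in[0,1]$. (ii) If $x\in[0,1]$ and $J\subset[0,1]$ is an interval with $b_k(a)\ne x$ for all $a\in J$, $0\le k\le p_0$, then $a\mapsto T_a(x)$ is $C^{1+\alpha}$ on $J$ and $a\mapsto\partial_xT_a(x)$ is $\alpha$-Hölder on $J$, with Hölder constants independent of $x$; the maps $x\mapsto\partial_aT_a(x)$, $x\in(b_{k-1}(a),b_k(a))$, are $\alpha$-Hölder with constants uniform in $a$. (iii) $p_1(a)\equiv p_1$ is constant and the boundary points of $D_k(a)$,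 $1\le k\le p_1$, are $\alpha$-Hölder continuous in $a$. Orbit and parameter partitions. $x_j(a):=T_a^j(x_0(a))$, $x_j'(a)=\partial_ax_j(a)$. For an interval $J\subset[0,1]$ and $j\ge1$, $\mathcal P_j|J$ is the set of maximal open intervals $\omega\subset J$ such that $x_i(a)\in K(a)\setminus\{b_0(a),\dots,b_{p_0}(a)\}$ for all $a\in\omega$ and $0\le i<j$. Space $V_\alpha$. For $\varphi\in L^1([0,1])$ let $\mathrm{osc}(\varphi,\delta,x)$ be the essential supremum minus the essential infimum of $\varphi$ on $(x-\delta,x+\delta)$. For a fixed $A>0$ put $|\varphi|_\alpha=\sup_{0<\delta\le A}\delta^{-\alpha}\int_0^1\mathrm{osc}(\varphi,\delta,x)dx$, $\|\varphi\|_\alpha=|\varphi|_\alpha+\|\varphi\|_{L^1}$, and $V_\alpha=\{\varphi:|\varphi|_\alpha<\infty\}$. The transfer operator is $\mathcal L_a\varphi(x)=\sum_{T_a(y)=x}\varphi(y)/|T_a'(y)|$. Condition (I): the right-derivatives $x_j'(0+)$ at $0$ exist for $j\ge1$ and there is $C\ge1$ with $C^{-1}\le|x_j'(0+)/(T_0^j)'(x_0(0+))|\le C$ for all $j\ge1$ (where $(T_0^j)'(x_0(0+))$ is the one-sided limit as $a\to0+$ of $(T_0^j)'(x_0(a))$); further, for each $j\ge1$ there is a neighbourhood $V\subset[0,1]$ of $0$ such that $x_i(a)\notin\{b_0(a),\dots,b_{p_0}(a)\}$ for all $a\in V\setminus\{0\}$ and $0\le i<j$. Condition (II): $T_0$ is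 mixing and there are $\epsilon>0$, $C\ge1$, $0<\tilde\rho<1$ with $\|\mathcal L_a^n\varphi\|_\alpha\le C\tilde\rho^n\|\varphi\|_\alpha+C\|\varphi\|_{L^1}$ for all $\varphi\in V_\alpha$, $a\in[0,\epsilon]$, $n\ge1$. Condition (III): there is $\epsilon>0$ such that for all $\delta_0>0$ there is $C$ with $\sum_{\omega\in\mathcal P_n|[0,\epsilon]}\|x_n'|_\omega\|_\infty^{-1}\le Ce^{n^{\delta_0}}$ for all $n\ge1$. *)

theory Defs
  imports "HOL-Probability.Probability" "HOL-Probability.Essential_Supremum"
begin

section \<open>Hoelder regularity\<close>

definition holder_with :: "real \<Rightarrow> real \<Rightarrow> real set \<Rightarrow> (real \<Rightarrow> real) \<Rightarrow> bool" where
  "holder_with \<alpha> C S f \<longleftrightarrow> (\<forall>x\<in>S. \<forall>y\<in>S. \<bar>f x - f y\<bar> \<le> C * \<bar>x - y\<bar> powr \<alpha>)"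

definition holder_on :: "real \<Rightarrow> real set \<Rightarrow> (real \<Rightarrow> real) \<Rightarrow> bool" where
  "holder_on \<alpha> S f \<longleftrightarrow> (\<exists>C. holder_with \<alpha> C S f)"

text \<open>The class \<open>C\<close> to the power \<open>1 + \<alpha>\<close> on \<open>S\<close>, with Hoelder constant \<open>C\<close> for the derivative.
  Derivatives are taken within \<open>S\<close>, hence one-sided at end points belonging to \<open>S\<close>.\<close>

definition C1_holder_with :: "real \<Rightarrow> real \<Rightarrow> real set \<Rightarrow> (real \<Rightarrow> real) \<Rightarrow> bool" where
  "C1_holder_with \<alpha> C S f \<longleftrightarrow>
     (\<exists>f'. (\<forall>x\<in>S. (f has_real_derivative f' x) (at x within S)) \<and> holder_with \<alpha> C S f')"

definition C1_holder_on :: "real \<Rightarrow> real set \<Rightarrow> (real \<Rightarrow> real) \<Rightarrow> bool" where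
  "C1_holder_on \<alpha> S f \<longleftrightarrow> (\<exists>C. C1_holder_with \<alpha> C S f)"


section \<open>Measures on the unit interval\<close>

abbreviation unit_leb :: "real measure" where
  "unit_leb \<equiv> restrict_space lborel {0..1}"

definition measure_support :: "real measure \<Rightarrow> real set" where
  "measure_support M =
     {x \<in> space M. \<forall>U. open U \<longrightarrow> x \<in> U \<longrightarrow> 0 < emeasure M (U \<inter> space M)}"

definition acip :: "(real \<Rightarrow> real) \<Rightarrow> real measure \<Rightarrow> bool" where
  "acip f M \<longleftrightarrow> sets M = sets unit_leb \<and> prob_space M \<and> absolutely_continuous unit_leb M \<and>
     f \<in> measurable M M \<and> distr M M f = M"

definition essinf :: "'a measure \<Rightarrow> ('a \<Rightarrow> ereal) \<Rightarrow> ereal" where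
  "essinf M f = - esssup M (\<lambda>x. - f x)"


section \<open>One-parameter families of piecewise expanding maps\<close>

text \<open>The number \<open>p0\<close> of branches is a constant, so its independence of the parameter, which is
  part of property (i), is built into the types. Values of \<open>T a\<close> at partition points are
  arbitrary in the unit interval; \<open>deriv (T a)\<close> is only used inside the branches.\<close>

definition part_pts :: "nat \<Rightarrow> (nat \<Rightarrow> real \<Rightarrow> real) \<Rightarrow> real \<Rightarrow> real set" where
  "part_pts p0 b a = (\<lambda>k. b k a) ` {0..p0}"

definition branch :: "(nat \<Rightarrow> real \<Rightarrow> real) \<Rightarrow> nat \<Rightarrow> real \<Rightarrow> real set" where
  "branch b k a = {b (k - 1) a <..< b k a}"

text \<open>The bound on the supremum norm of \<open>1 / T a'\<close> is stated as \<open>lam \<le> \<bar>T a'\<bar>\<close>, since in HOL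
  \<open>1 / 0 = 0\<close>; \<open>T a'\<close> is continuous on branches, so supremum and essential supremum agree.\<close>

definition expanding_family ::
    "real \<Rightarrow> nat \<Rightarrow> (nat \<Rightarrow> real \<Rightarrow> real) \<Rightarrow> (real \<Rightarrow> real \<Rightarrow> real) \<Rightarrow> bool" where
  "expanding_family \<alpha> p0 b T \<longleftrightarrow>
     (\<forall>a\<in>{0..1}. T a ` {0..1} \<subseteq> {0..1}) \<and>
     (\<forall>a\<in>{0..1}. b 0 a = 0 \<and> b p0 a = 1 \<and> (\<forall>k\<in>{1..p0}. b (k - 1) a < b k a)) \<and>
     (\<forall>a\<in>{0..1}. \<forall>k\<in>{1..p0}. C1_holder_on \<alpha> (branch b k a) (T a)) \<and>
     (\<exists>C. \<forall>a\<in>{0..1}. \<forall>k\<in>{1..p0}. holder_with \<alpha> C (branch b k a) (deriv (T a))) \<and>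
     (\<exists>lam Lam. 1 < lam \<and> lam \<le> Lam \<and>
        (\<forall>a\<in>{0..1}. \<forall>k\<in>{1..p0}. \<forall>x\<in>branch b k a.
           lam \<le> \<bar>deriv (T a) x\<bar> \<and> \<bar>deriv (T a) x\<bar> \<le> Lam))"

definition acip_family ::
    "(real \<Rightarrow> real \<Rightarrow> real) \<Rightarrow> (real \<Rightarrow> real measure) \<Rightarrow> (real \<Rightarrow> real \<Rightarrow> real) \<Rightarrow> bool" where
  "acip_family T \<mu> h \<longleftrightarrow>
     (\<forall>a\<in>{0..1}.
        acip (T a) (\<mu> a) \<and> (\<forall>\<nu>. acip (T a) \<nu> \<longrightarrow> \<nu> = \<mu> a) \<and>
        h a \<in> borel_measurable unit_leb \<and> (\<forall>x\<in>{0..1}. 0 \<le> h a x) \<and>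
        \<mu> a = density unit_leb (\<lambda>x. ennreal (h a x)) \<and>
        (\<exists>\<I>. finite \<I> \<and> (\<forall>I\<in>\<I>. is_interval I) \<and> measure_support (\<mu> a) = \<Union>\<I>))"

definition property_i :: "nat \<Rightarrow> (nat \<Rightarrow> real \<Rightarrow> real) \<Rightarrow> bool" where
  "property_i p0 b \<longleftrightarrow> (\<forall>k\<le>p0. \<exists>L. L-lipschitz_on {0..1} (b k))"

text \<open>Parameter derivative, one-sided at the parameters 0 and 1.\<close>

definition param_deriv :: "(real \<Rightarrow> real \<Rightarrow> real) \<Rightarrow> real \<Rightarrow> real \<Rightarrow> real" where
  "param_deriv T a x = vector_derivative (\<lambda>s. T s x) (at a within {0..1})"

definition property_ii ::
    "real \<Rightarrow> nat \<Rightarrow> (nat \<Rightarrow> real \<Rightarrow> real) \<Rightarrow> (real \<Rightarrow> real \<Rightarrow> real) \<Rightarrow> bool" where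
  "property_ii \<alpha> p0 b T \<longleftrightarrow>
     (\<exists>C. \<forall>x\<in>{0..1}. \<forall>J. is_interval J \<and> J \<subseteq> {0..1} \<and> (\<forall>a\<in>J. \<forall>k\<le>p0. b k a \<noteq> x) \<longrightarrow>
        C1_holder_with \<alpha> C J (\<lambda>a. T a x) \<and> holder_with \<alpha> C J (\<lambda>a. deriv (T a) x)) \<and>
     (\<exists>C. \<forall>a\<in>{0..1}. \<forall>k\<in>{1..p0}. holder_with \<alpha> C (branch b k a) (param_deriv T a))"

text \<open>\<open>D k a\<close> runs through the connected components without repetition. Any labelling with
  Hoelder continuous end points is, up to a permutation independent of the parameter, the one
  from left to right.\<close>

definition property_iii ::
    "real \<Rightarrow> nat \<Rightarrow> (nat \<Rightarrow> real \<Rightarrow> real) \<Rightarrow> (real \<Rightarrow> real set) \<Rightarrow> bool" where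
  "property_iii \<alpha> p0 b K \<longleftrightarrow>
     (\<exists>(p1::nat) D.
        (\<forall>a\<in>{0..1}. bij_betw (\<lambda>k. D k a) {1..p1} (components (K a - part_pts p0 b a))) \<and>
        (\<forall>k\<in>{1..p1}. holder_on \<alpha> {0..1} (\<lambda>a. Inf (D k a)) \<and>
                      holder_on \<alpha> {0..1} (\<lambda>a. Sup (D k a))))"


section \<open>Orbits and parameter partitions\<close>

definition orb :: "(real \<Rightarrow> real \<Rightarrow> real) \<Rightarrow> (real \<Rightarrow> real) \<Rightarrow> nat \<Rightarrow> real \<Rightarrow> real" where
  "orb T x0 j a = (T a ^^ j) (x0 a)"

definition admissible_interval ::
    "(nat \<Rightarrow> real \<Rightarrow> real) \<Rightarrow> (real \<Rightarrow> real set) \<Rightarrow> (real \<Rightarrow> real set) \<Rightarrow> nat \<Rightarrow> real set \<Rightarrow>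
     real set \<Rightarrow> bool" where
  "admissible_interval x K B j J \<omega> \<longleftrightarrow>
     \<omega> \<noteq> {} \<and> open \<omega> \<and> is_interval \<omega> \<and> \<omega> \<subseteq> J \<and> (\<forall>a\<in>\<omega>. \<forall>i<j. x i a \<in> K a - B a)"

definition param_partition ::
    "(nat \<Rightarrow> real \<Rightarrow> real) \<Rightarrow> (real \<Rightarrow> real set) \<Rightarrow> (real \<Rightarrow> real set) \<Rightarrow> nat \<Rightarrow> real set \<Rightarrow>
     real set set" where
  "param_partition x K B j J =
     {\<omega>. admissible_interval x K B j J \<omega> \<and>
          (\<forall>\<omega>'. admissible_interval x K B j J \<omega>' \<and> \<omega> \<subseteq> \<omega>' \<longrightarrow> \<omega>' = \<omega>)}"


section \<open>Function space and transfer operator\<close>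

text \<open>Functions live on the unit interval, so the oscillation is over the part of the
  neighbourhood inside it. The seminorm and norms are extended nonnegative.\<close>

definition osc :: "(real \<Rightarrow> real) \<Rightarrow> real \<Rightarrow> real \<Rightarrow> ereal" where
  "osc \<phi> \<delta> x =
     (let M = restrict_space lborel ({x - \<delta> <..< x + \<delta>} \<inter> {0..1})
      in esssup M (\<lambda>y. ereal (\<phi> y)) - essinf M (\<lambda>y. ereal (\<phi> y)))"

definition alpha_seminorm :: "real \<Rightarrow> real \<Rightarrow> (real \<Rightarrow> real) \<Rightarrow> ennreal" where
  "alpha_seminorm A \<alpha> \<phi> =
     (SUP \<delta>\<in>{0<..A}. ennreal (\<delta> powr (- \<alpha>)) * (\<integral>\<^sup>+x. e2ennreal (osc \<phi> \<delta> x) \<partial>unit_leb))"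

definition L1_norm :: "(real \<Rightarrow> real) \<Rightarrow> ennreal" where
  "L1_norm \<phi> = (\<integral>\<^sup>+x. ennreal \<bar>\<phi> x\<bar> \<partial>unit_leb)"

definition alpha_norm :: "real \<Rightarrow> real \<Rightarrow> (real \<Rightarrow> real) \<Rightarrow> ennreal" where
  "alpha_norm A \<alpha> \<phi> = alpha_seminorm A \<alpha> \<phi> + L1_norm \<phi>"

definition V_space :: "real \<Rightarrow> real \<Rightarrow> (real \<Rightarrow> real) set" where
  "V_space A \<alpha> = {\<phi>. integrable unit_leb \<phi> \<and> alpha_seminorm A \<alpha> \<phi> < \<infinity>}"

text \<open>Preimages that are partition points, where the derivative need not exist, are left out;
  this changes the image function at finitely many points only.\<close>

definition transfer_op ::
    "(real \<Rightarrow> real) \<Rightarrow> real set \<Rightarrow> (real \<Rightarrow> real) \<Rightarrow> real \<Rightarrow> real" where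
  "transfer_op f B \<phi> x = (\<Sum>y\<in>{y \<in> {0..1} - B. f y = x}. \<phi> y / \<bar>deriv f y\<bar>)"

definition topologically_mixing_on :: "(real \<Rightarrow> real) \<Rightarrow> real set \<Rightarrow> bool" where
  "topologically_mixing_on f K \<longleftrightarrow>
     (\<forall>U V. openin (top_of_set K) U \<and> openin (top_of_set K) V \<and> U \<noteq> {} \<and> V \<noteq> {} \<longrightarrow>
        (\<exists>N. \<forall>n\<ge>N. (f ^^ n) ` U \<inter> V \<noteq> {}))"


section \<open>The conditions and typicality\<close>

text \<open>In \<open>condition_I\<close>, \<open>d\<close> is the right-derivative of the \<open>j\<close>-th orbit map at 0, and \<open>m\<close> is the
  one-sided limit of the space derivative of the \<open>j\<close>-th iterate of the map at parameter 0.
  The lower bound forces \<open>m \<noteq> 0\<close>, as \<open>d / 0 = 0\<close>. In the other two conditions the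
  interval from 0 to \<open>\<epsilon>\<close> lies in the parameter space, whence \<open>\<epsilon> \<le> 1\<close>.\<close>

definition condition_I ::
    "nat \<Rightarrow> (nat \<Rightarrow> real \<Rightarrow> real) \<Rightarrow> (real \<Rightarrow> real \<Rightarrow> real) \<Rightarrow> (real \<Rightarrow> real) \<Rightarrow> bool" where
  "condition_I p0 b T x0 \<longleftrightarrow>
     (\<exists>C\<ge>1. \<forall>j\<ge>1. \<exists>d m.
        (orb T x0 j has_real_derivative d) (at_right 0) \<and>
        (\<forall>\<^sub>F a in at_right 0. (T 0 ^^ j) differentiable (at (x0 a))) \<and>
        ((\<lambda>a. deriv (T 0 ^^ j) (x0 a)) \<longlongrightarrow> m) (at_right 0) \<and>
        1 / C \<le> \<bar>d / m\<bar> \<and> \<bar>d / m\<bar> \<le> C) \<and>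
     (\<forall>j\<ge>1. \<exists>V. openin (top_of_set {0..1}) V \<and> 0 \<in> V \<and>
        (\<forall>a\<in>V - {0}. \<forall>i<j. orb T x0 i a \<notin> part_pts p0 b a))"

definition condition_II ::
    "real \<Rightarrow> real \<Rightarrow> nat \<Rightarrow> (nat \<Rightarrow> real \<Rightarrow> real) \<Rightarrow> (real \<Rightarrow> real \<Rightarrow> real) \<Rightarrow> (real \<Rightarrow> real set) \<Rightarrow> bool"
  where
  "condition_II A \<alpha> p0 b T K \<longleftrightarrow>
     topologically_mixing_on (T 0) (K 0) \<and>
     (\<exists>\<epsilon> C \<rho>. 0 < \<epsilon> \<and> \<epsilon> \<le> 1 \<and> 1 \<le> C \<and> 0 < \<rho> \<and> \<rho> < 1 \<and>
        (\<forall>\<phi>\<in>V_space A \<alpha>. \<forall>a\<in>{0..\<epsilon>}. \<forall>n\<ge>1.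
           alpha_norm A \<alpha> ((transfer_op (T a) (part_pts p0 b a) ^^ n) \<phi>)
             \<le> ennreal (C * \<rho> ^ n) * alpha_norm A \<alpha> \<phi> + ennreal C * L1_norm \<phi>))"

text \<open>The sum in \<open>condition_III\<close> is extended nonnegative; in particular a vanishing supremum
  norm contributes infinity.\<close>

definition condition_III ::
    "nat \<Rightarrow> (nat \<Rightarrow> real \<Rightarrow> real) \<Rightarrow> (real \<Rightarrow> real \<Rightarrow> real) \<Rightarrow> (real \<Rightarrow> real set) \<Rightarrow> (real \<Rightarrow> real) \<Rightarrow> bool"
  where
  "condition_III p0 b T K x0 \<longleftrightarrow>
     (\<exists>\<epsilon>>0. \<epsilon> \<le> 1 \<and> (\<forall>\<delta>\<^sub>0>0. \<exists>C. \<forall>n\<ge>1.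
        (\<Sum>\<^sub>\<infinity>\<omega>\<in>param_partition (orb T x0) K (part_pts p0 b) n {0..\<epsilon>}.
            inverse (SUP a\<in>\<omega>. ennreal \<bar>deriv (orb T x0 n) a\<bar>))
          \<le> ennreal (C * exp (real n powr \<delta>\<^sub>0))))"

definition typical_point :: "(real \<Rightarrow> real) \<Rightarrow> real measure \<Rightarrow> real \<Rightarrow> bool" where
  "typical_point f M x \<longleftrightarrow>
     (\<forall>\<phi>. continuous_on {0..1} \<phi> \<longrightarrow>
        (\<lambda>n. (1 / real n) * (\<Sum>i=1..n. \<phi> ((f ^^ i) x))) \<longlonglongrightarrow> (\<integral>x. \<phi> x \<partial>M))"

end

theory Submission
  imports Defs "HOL-Real_Asymp.Real_Asymp"
begin

text \<open>
  Write \<open>x j a\<close> for the \<open>j\<close>-th point of the orbit of \<open>x0 a\<close> under \<open>T a\<close>. The plan is to bound, for almost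
  every parameter \<open>a\<close> near 0 and every interval, the frequency of visits of the orbit to this interval by
  a constant times its length. Every weak limit \<open>\<nu>\<close> of the empirical measures of such an orbit then has a bounded
  density. In particular \<open>\<nu>\<close> gives no mass to the discontinuities of \<open>T a\<close>, hence is invariant; as \<open>\<mu> a\<close> is the
  only absolutely continuous invariant probability, \<open>\<nu>\<close> is \<open>\<mu> a\<close>. By compactness the empirical measures converge
  to \<open>\<mu> a\<close>, which is typicality (\<open>typical_point_if_frequency_bound\<close>).

  The parameter plays the role of the random variable. The orbit maps obey
  \<open>x' (j + 1) a = deriv (T a) (x j a) * x' j a + param_deriv T a (x j a)\<close>. Expansion makes the first term win
  as soon as \<open>\<bar>x' N a\<bar>\<close> is large at a single time \<open>N\<close>, and condition (I) supplies such an \<open>N\<close> for all small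
  \<open>a\<close>. From time \<open>N\<close> on, \<open>x j\<close> expands exponentially, and with bounded distortion, on each interval of parameters
  whose orbits have met no partition point (\<open>growth\<close>, \<open>distortion\<close>). The orbits of such an interval
  \<open>U\<close> at time \<open>q\<close> fill an interval \<open>W\<close> of phase space, and Lebesgue measure on \<open>U\<close> is carried to a measure
  comparable with Lebesgue measure on \<open>W\<close>.

  Let the orbits run for \<open>m\<close> further steps. Since \<open>U\<close> is exponentially short in \<open>q\<close>, all maps \<open>T a\<close> with \<open>a\<close> in \<open>U\<close> may be
  replaced by a single \<open>T a0\<close>, with a small error away from the partition points (\<open>shadowing\<close>).
  For a single map the Lasota-Yorke inequality of condition (II), applied to the indicator of \<open>W\<close>, bounds the transferred
  density in the oscillation norm, hence in the supremum norm: the measure of the points of \<open>W\<close> which reach a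
  set \<open>E\<close> after \<open>m\<close> steps is at most a constant times \<open>\<rho> ^ m + \<bar>W\<bar>\<close> times \<open>\<bar>E\<bar>\<close> (\<open>preimage_measure_bound\<close>).
  So if \<open>\<bar>W\<bar>\<close> is at least \<open>\<rho> ^ m\<close>, the proportion of \<open>U\<close> that visits an interval at time \<open>q + m\<close> is at most a
  constant times its length, up to a small error (\<open>visit_bound\<close>).

  For time \<open>j\<close> one takes \<open>m\<close> about \<open>sqrt j\<close> and \<open>q = j - m\<close>. The intervals with \<open>\<bar>W\<bar> < \<rho> ^ m\<close> have total length at most
  about \<open>\<rho> ^ m\<close> times the sum in condition (III), which is of the order of \<open>exp (j powr (1/4))\<close>; these
  lengths are summable, so by Borel-Cantelli almost every parameter is in such an interval for finitely many \<open>j\<close>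
  only (\<open>Short_measure\<close>). It remains to pass from conditional averages over the
  intervals to individual orbits. The deviations of the visit functions from their averages have mean zero on the intervals of time \<open>q\<close>,
  on which the earlier ones are nearly constant, so they are almost uncorrelated and a second
  moment estimate along a sparse sequence of times gives a strong law (\<open>frequency_bound_from_component_averages\<close>).
\<close>

section \<open>Measures and components of open subsets of the line\<close>

lemma components_open_real:
  fixes G :: "real set"
  assumes "open G" "W \<in> components G"
  shows "open W" "is_interval W" "W \<noteq> {}" "W \<subseteq> G" "W \<in> sets borel"
  using assms by (auto simp: open_components is_interval_connected_1 in_components_connected
      in_components_nonempty in_components_subset intro: borel_open open_components)

lemma countable_components_open:
  fixes G :: "real set"
  assumes "open G" shows "countable (components G)"
  by (rule countable_disjoint_open_subsets)
    (use assms pairwise_disjoint_components[of G] in \<open>auto simp: open_components pairwise_def disjnt_def\<close>)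

lemma emeasure_open_eq_components:
  fixes G :: "real set"
  assumes "open G" "sets M = sets borel"
  shows "emeasure M G = (\<integral>\<^sup>+W. emeasure M W \<partial>count_space (components G))"
proof -
  have "disjoint_family_on (\<lambda>W. W) (components G)"
    using pairwise_disjoint_components[of G]
    by (auto simp: disjoint_family_on_def pairwise_def disjnt_def)
  then have "emeasure M (\<Union>((\<lambda>W. W) ` components G)) = (\<integral>\<^sup>+W. emeasure M W \<partial>count_space (components G))"
    using assms countable_components_open components_open_real(5)
    by (intro emeasure_UN_countable) auto
  then show ?thesis using Union_components[of G] by simp
qed

text \<open>An open set is the disjoint union of its countably many components, so a bound for each of them adds up.\<close>

lemma emeasure_le_if_components_le:
  fixes G :: "real set"
  assumes "open G" and M: "sets M = sets borel"
    and le: "\<And>W. W \<in> components G \<Longrightarrow> emeasure M W \<le> ennreal c * emeasure lborel W"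
  shows "emeasure M G \<le> ennreal c * emeasure lborel G"
proof -
  have "emeasure M G = (\<integral>\<^sup>+W. emeasure M W \<partial>count_space (components G))"
    by (rule emeasure_open_eq_components) (use assms in auto)
  also have "\<dots> \<le> (\<integral>\<^sup>+W. ennreal c * emeasure lborel W \<partial>count_space (components G))"
    by (rule nn_integral_mono) (use le in auto)
  also have "\<dots> = ennreal c * (\<integral>\<^sup>+W. emeasure lborel W \<partial>count_space (components G))"
    by (rule nn_integral_cmult) auto
  also have "\<dots> = ennreal c * emeasure lborel G"
    using emeasure_open_eq_components[OF \<open>open G\<close>, of lborel] by simp
  finally show ?thesis .
qed

lemma emeasure_lborel_finite:
  fixes W :: "real set"
  assumes "W \<subseteq> {l..r}" shows "emeasure lborel W < \<infinity>"
  by (rule emeasure_bounded_finite) (rule bounded_subset[OF bounded_closed_interval assms])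

lemma borel_interval_measure_bound:
  fixes W :: "real set"
  assumes "is_interval W" "W \<subseteq> {l..r}" and 2: "W \<in> sets borel" and ac: "a \<in> W" "c \<in> W"
  shows "\<bar>a - c\<bar> \<le> measure lborel W"
proof -
  have *: "r - l \<le> measure lborel W" if "l \<in> W" "r \<in> W" "l \<le> r" for l r
  proof -
    have 1: "{l..r} \<subseteq> W"
      using assms(1) that unfolding is_interval_1 by (meson atLeastAtMost_iff subsetI)
    have 3: "emeasure lborel W \<noteq> \<infinity>"
      using emeasure_mono[OF assms(2), of lborel] by (auto simp: top_unique emeasure_lborel_Icc_eq split: if_splits)
    have "measure lborel {l..r} \<le> measure lborel W"
      using 1 2 3 by (intro measure_mono_fmeasurable) (auto simp: fmeasurable_def less_top)
    with that show ?thesis by simp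
  qed
  show ?thesis using *[of a c] *[of c a] assms by linarith
qed

lemma measure_le_diameter:
  fixes W :: "real set"
  assumes W: "W \<in> sets borel" "W \<subseteq> {l..r}" and R: "0 \<le> R"
    and d: "\<And>a a'. a \<in> W \<Longrightarrow> a' \<in> W \<Longrightarrow> \<bar>a - a'\<bar> \<le> R"
  shows "measure lborel W \<le> R"
proof (cases "W = {}")
  case False
  have bb: "bdd_below W" by (rule bdd_belowI[of _ l]) (use W in auto)
  have "W \<subseteq> {Inf W..Inf W + R}"
  proof
    fix a assume a: "a \<in> W"
    have "a - R \<le> Inf W"
    proof (rule cInf_greatest[OF False])
      fix a' assume "a' \<in> W" then show "a - R \<le> a'" using d[OF a, of a'] by linarith
    qed
    then show "a \<in> {Inf W..Inf W + R}" using cInf_lower[OF a bb] by auto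
  qed
  then have "measure lborel W \<le> measure lborel {Inf W..Inf W + R}"
    using W R by (intro measure_mono_fmeasurable) (auto simp: fmeasurable_def)
  then show ?thesis using R by simp
qed (use R in simp)

lemma connected_component_in_components:
  fixes G :: "real set"
  assumes "a \<in> G"
  shows "connected_component_set G a \<in> components G" "a \<in> connected_component_set G a"
  using assms by (auto simp: components_def)

lemma component_eq_connected_component:
  fixes G :: "real set"
  assumes "W \<in> components G" "a \<in> W"
  shows "connected_component_set G a = W"
  using assms by (metis components_iff connected_component_eq)

lemma measure_component_pos:
  fixes G :: "real set"
  assumes "open G" "W \<in> components G" "W \<subseteq> {l..r}"
  shows "measure lborel W > 0"
proof -
  note Wp = components_open_real[OF assms(1,2)]
  obtain x where x: "x \<in> W" using Wp(3) by blast
  obtain e where e: "e > 0" "ball x e \<subseteq> W" using Wp(1) x openE by blast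
  have "x + e/2 \<in> W" using e by (auto simp: dist_real_def subset_iff)
  then have "\<bar>x - (x + e/2)\<bar> \<le> measure lborel W"
    using borel_interval_measure_bound[OF Wp(2) assms(3) Wp(5) x] by blast
  then show ?thesis using e by simp
qed

text \<open>The bound passes from intervals to open sets by summing over components, and from open sets to Borel sets by outer regularity of Lebesgue measure.\<close>

lemma emeasure_le_if_interval_bound:
  fixes \<nu> :: "real measure"
  assumes sets: "sets \<nu> = sets borel" and C: "C \<ge> 0"
    and bd: "\<And>u v. u < v \<Longrightarrow> emeasure \<nu> {u..v} \<le> ennreal (C * (v - u))"
    and E: "E \<in> sets borel" "E \<subseteq> {0..1}"
  shows "emeasure \<nu> E \<le> ennreal C * emeasure lborel E"
proof -
  have open_bd: "emeasure \<nu> U \<le> ennreal C * emeasure lborel U" if U: "open U" "U \<subseteq> {-1<..<2}" for U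
  proof -
    show ?thesis
    proof (rule emeasure_le_if_components_le[OF U(1)])
      fix W assume W: "W \<in> components U"
      note Wp = components_open_real[OF U(1) W]
      have sub: "W \<subseteq> {-1..2}" using Wp(4) U(2) by force
      define l r where "l = Inf W" and "r = Sup W"
      have bb: "bdd_below W" "bdd_above W" using sub by (auto intro: bdd_below_mono bdd_above_mono)
      have lr: "W \<subseteq> {l..r}" using bb by (auto simp: l_def r_def intro: cInf_lower cSup_upper)
      have inn: "{l<..<r} \<subseteq> W"
      proof
        fix x assume x: "x \<in> {l<..<r}"
        then obtain y z where "y \<in> W" "y < x" "z \<in> W" "x < z"
          unfolding l_def r_def using bb Wp(3) by (auto simp: cInf_less_iff less_cSup_iff)
        then show "x \<in> W" using Wp(2) unfolding is_interval_1 by (meson less_imp_le)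
      qed
      obtain x e where x: "x \<in> W" "e > 0" "ball x e \<subseteq> W"
        using Wp(1,3) openE by blast
      have "x - e/2 \<in> ball x e" "x + e/2 \<in> ball x e" using x(2) by (auto simp: dist_real_def)
      then have "x - e/2 \<in> {l..r}" "x + e/2 \<in> {l..r}" using x(3) lr by blast+
      then have "l < r" using x(2) by simp
      have "emeasure \<nu> W \<le> emeasure \<nu> {l..r}" by (intro emeasure_mono lr) (auto simp: sets)
      also have "\<dots> \<le> ennreal (C * (r - l))" 
        using bd[OF \<open>l < r\<close>] .
      also have "\<dots> = ennreal C * emeasure lborel {l<..<r}" using \<open>l < r\<close> C by (simp add: ennreal_mult)
      also have "\<dots> \<le> ennreal C * emeasure lborel W"
        using Wp(5) inn by (intro mult_left_mono emeasure_mono) auto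
      finally show "emeasure \<nu> W \<le> ennreal C * emeasure lborel W" .
    qed (simp add: sets)
  qed
  show ?thesis
  proof (rule ennreal_le_epsilon)
    fix e :: real assume e: "e > 0"
    define e' where "e' = e / (C + 1)"
    have e': "e' > 0" "C * e' \<le> e" using e C by (auto simp: e'_def field_simps)
    obtain T where T: "open T" "E \<subseteq> T" "(T - E) \<in> lmeasurable" "emeasure lebesgue (T - E) < ennreal e'"
      using sets_lebesgue_outer_open[of E e'] E e' by auto
    define U where "U = T \<inter> {-1<..<2}"
    have U: "open U" "U \<subseteq> {-1<..<2}" "E \<subseteq> U" using T E by (auto simp: U_def)
    have "emeasure lborel (U - E) = emeasure lebesgue (U - E)" using U E by simp
    also have "\<dots> \<le> emeasure lebesgue (T - E)" using T(3) by (intro emeasure_mono) (auto simp: U_def)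
    also have "\<dots> \<le> ennreal e'" using T by simp
    finally have 1: "emeasure lborel (U - E) \<le> ennreal e'" .
    have "emeasure lborel U \<le> emeasure lborel E + emeasure lborel (U - E)"
      using U E emeasure_subadditive[of E lborel "U - E"] by (simp add: Un_absorb1)
    then have 2: "emeasure lborel U \<le> emeasure lborel E + ennreal e'"
      using 1 by (meson add_left_mono order_trans)
    have "emeasure \<nu> E \<le> emeasure \<nu> U" using U by (intro emeasure_mono) (auto simp: sets)
    also have "\<dots> \<le> ennreal C * emeasure lborel U" by (rule open_bd[OF U(1,2)])
    also have "\<dots> \<le> ennreal C * (emeasure lborel E + ennreal e')" by (intro mult_left_mono 2) simp
    also have "\<dots> = ennreal C * emeasure lborel E + ennreal (C * e')"
      using C e' by (simp add: distrib_left ennreal_mult)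
    also have "\<dots> \<le> ennreal C * emeasure lborel E + ennreal e" using e' by (intro add_left_mono ennreal_leI)
    finally show "emeasure \<nu> E \<le> ennreal C * emeasure lborel E + ennreal e" .
  qed
qed

text \<open>The preimage of an interval of length \<open>l\<close> has diameter at most \<open>l / m\<close>. Thus the image of Lebesgue measure on \<open>W\<close> under \<open>g\<close> satisfies an interval bound with constant \<open>1 / m\<close>, which then holds for all Borel sets.\<close>

lemma measure_preimage_expanding:
  fixes g :: "real \<Rightarrow> real"
  assumes W: "W \<in> sets borel" "W \<subseteq> {0..1}" and g: "continuous_on W g" and m: "m > 0"
    and ex: "\<And>a a'. a \<in> W \<Longrightarrow> a' \<in> W \<Longrightarrow> m * \<bar>a - a'\<bar> \<le> \<bar>g a - g a'\<bar>"
    and E: "E \<in> sets borel" "E \<subseteq> {0..1}"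
  shows "{a\<in>W. g a \<in> E} \<in> sets borel" "measure lborel {a\<in>W. g a \<in> E} \<le> measure lborel E / m"
proof -
  define M where "M = restrict_space lborel W"
  have gm: "g \<in> borel_measurable M"
    using borel_measurable_continuous_on_restrict[OF g] W
    by (simp add: M_def cong: measurable_cong_sets)
  define \<nu> where "\<nu> = distr M borel g"
  have pre: "{a\<in>W. g a \<in> S} \<in> sets borel \<and> emeasure \<nu> S = emeasure lborel {a\<in>W. g a \<in> S}" if S: "S \<in> sets borel" for S
  proof -
    have eq: "g -` S \<inter> space M = {a\<in>W. g a \<in> S}" by (auto simp: M_def space_restrict_space)
    have "{a\<in>W. g a \<in> S} \<in> sets M" using measurable_sets[OF gm S] unfolding eq .
    then have s: "{a\<in>W. g a \<in> S} \<in> sets borel" using W by (auto simp: M_def sets_restrict_space)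
    have "emeasure \<nu> S = emeasure M {a\<in>W. g a \<in> S}" unfolding \<nu>_def using gm S eq by (subst emeasure_distr) auto
    also have "\<dots> = emeasure lborel {a\<in>W. g a \<in> S}" unfolding M_def using W by (subst emeasure_restrict_space) auto
    finally show ?thesis using s by simp
  qed
  have "emeasure \<nu> E \<le> ennreal (1/m) * emeasure lborel E"
  proof (rule emeasure_le_if_interval_bound[OF _ _ _ E])
    fix u v :: real assume uv: "u < v"
    let ?S = "{a\<in>W. g a \<in> {u..v}}"
    have "emeasure lborel ?S \<le> ennreal (1 / m * (v - u))"
    proof (cases "?S = {}")
      case False
      have bb: "bdd_below ?S" by (rule bdd_belowI[of _ 0]) (use W(2) in force)
      define l where "l = Inf ?S"
      have "?S \<subseteq> {l..l + (v - u) / m}"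
      proof
        fix a assume a: "a \<in> ?S"
        have "a - (v - u) / m \<le> l" unfolding l_def
        proof (rule cInf_greatest[OF False])
          fix a' assume a': "a' \<in> ?S"
          have "\<bar>g a - g a'\<bar> \<le> v - u" using a a' by auto
          then have "m * \<bar>a - a'\<bar> \<le> v - u" using ex[of a a'] a a' by auto
          then have "\<bar>a - a'\<bar> \<le> (v - u) / m" using m by (simp add: pos_le_divide_eq mult.commute)
          then show "a - (v - u) / m \<le> a'" by linarith
        qed
        moreover have "l \<le> a" unfolding l_def using a bb by (rule cInf_lower)
        ultimately show "a \<in> {l..l + (v - u) / m}" by auto
      qed
      then have "emeasure lborel ?S \<le> emeasure lborel {l..l + (v - u) / m}" by (intro emeasure_mono) auto
      also have "\<dots> = ennreal (1 / m * (v - u))" using uv m by simp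
      finally show ?thesis .
    next
      case True
      show ?thesis unfolding True by simp
    qed
    then show "emeasure \<nu> {u..v} \<le> ennreal (1 / m * (v - u))" using pre[of "{u..v}"] by simp
  qed (use m in \<open>auto simp: \<nu>_def\<close>)
  then have le: "emeasure lborel {a\<in>W. g a \<in> E} \<le> ennreal (1/m) * emeasure lborel E" using pre[OF E(1)] by simp
  show "{a\<in>W. g a \<in> E} \<in> sets borel" using pre[OF E(1)] by blast
  have f1: "emeasure lborel E = ennreal (measure lborel E)"
    using emeasure_lborel_finite[OF E(2)] by (simp add: emeasure_eq_ennreal_measure)
  have f2: "emeasure lborel {a\<in>W. g a \<in> E} = ennreal (measure lborel {a\<in>W. g a \<in> E})"
  proof (rule emeasure_eq_ennreal_measure)
    have "{a\<in>W. g a \<in> E} \<subseteq> {0..1}" using W(2) by blast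
    then have "emeasure lborel {a\<in>W. g a \<in> E} < \<infinity>" by (rule emeasure_lborel_finite)
    then show "emeasure lborel {a\<in>W. g a \<in> E} \<noteq> top" by (metis infinity_ennreal_def less_irrefl)
  qed
  have "ennreal (measure lborel {a\<in>W. g a \<in> E}) \<le> ennreal (1 / m * measure lborel E)"
    using le m unfolding f1 f2 by (subst ennreal_mult) auto
  then show "measure lborel {a\<in>W. g a \<in> E} \<le> measure lborel E / m"
    using m by (subst (asm) ennreal_le_iff) auto
qed

lemma emeasure_Union_le_if_finite_sums_le:
  fixes \<C> :: "real set set"
  assumes c: "countable \<C>" and m: "\<And>U. U \<in> \<C> \<Longrightarrow> U \<in> sets lborel"
    and le: "\<And>F. finite F \<Longrightarrow> F \<subseteq> \<C> \<Longrightarrow> (\<Sum>U\<in>F. emeasure lborel U) \<le> c"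
  shows "emeasure lborel (\<Union>\<C>) \<le> c"
proof (cases "\<C> = {}")
  case False
  define f where "f = from_nat_into \<C>"
  have f: "range f = \<C>" unfolding f_def by (rule range_from_nat_into[OF False c])
  define A where "A n = (\<Union>U\<in>f ` {..<n}. U)" for n
  have fin: "f ` {..<n} \<subseteq> \<C>" for n using f by blast
  have Am: "A n \<in> sets lborel" for n unfolding A_def using m fin by (intro sets.finite_UN) auto
  have "(SUP n. emeasure lborel (A n)) = emeasure lborel (\<Union>n. A n)"
  proof (rule SUP_emeasure_incseq)
    show "incseq A" unfolding A_def by (rule incseq_SucI) (intro UN_mono image_mono, auto)
  qed (use Am in auto)
  also have "(\<Union>n. A n) = \<Union>\<C>"
    unfolding A_def f[symmetric] by (auto intro: exI[of _ "Suc _"])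
  finally have "emeasure lborel (\<Union>\<C>) = (SUP n. emeasure lborel (A n))" ..
  also have "\<dots> \<le> c"
  proof (rule SUP_least)
    fix n
    have "emeasure lborel (A n) \<le> (\<Sum>U\<in>f ` {..<n}. emeasure lborel U)"
      unfolding A_def by (rule emeasure_subadditive_finite) (use m fin in auto)
    also have "\<dots> \<le> c" by (rule le) (use fin in auto)
    finally show "emeasure lborel (A n) \<le> c" .
  qed
  finally show ?thesis .
qed simp

lemma set_integral_le_if_components_le:
  fixes h :: "real \<Rightarrow> real"
  assumes G: "open G" "G \<subseteq> {l..r}" and h[measurable]: "h \<in> borel_measurable borel"
    and b: "\<And>x. \<bar>h x\<bar> \<le> b" and c: "c \<ge> 0"
    and le: "\<And>W. W \<in> components G \<Longrightarrow> (LINT x:W|lborel. h x) \<le> c * measure lborel W"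
  shows "(LINT x:G|lborel. h x) \<le> c * measure lborel G"
proof -
  have b0: "b \<ge> 0" using b[of 0] by linarith
  \<comment> \<open>Adding the bound \<open>b\<close> makes the integrand a density, so that additivity over the components is additivity of a measure.\<close>
  define M where "M = density lborel (\<lambda>x. ennreal (h x + b))"
  have fin: "emeasure lborel W < \<infinity>" if "W \<subseteq> {l..r}" for W
    using that by (rule emeasure_lborel_finite)
  have val: "emeasure M W = ennreal ((LINT x:W|lborel. h x) + b * measure lborel W)
     \<and> (LINT x:W|lborel. h x) + b * measure lborel W \<ge> 0"
    if W: "W \<in> sets borel" "W \<subseteq> {l..r}" for W
  proof -
    have [measurable]: "W \<in> sets borel" by fact
    have ih: "set_integrable lborel W h"
      unfolding set_integrable_def
      by (rule integrableI_bounded_set[where A=W and B=b])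
         (use W fin b in \<open>auto simp: indicator_def\<close>)
    have ib: "set_integrable lborel W (\<lambda>_. b)"
      unfolding set_integrable_def
      by (rule integrableI_bounded_set[where A=W and B=b])
         (use W fin b0 in \<open>auto simp: indicator_def\<close>)
    have nn: "0 \<le> indicator W x * (h x + b)" for x using b[of x] by (auto simp: indicator_def)
    have "emeasure M W = (\<integral>\<^sup>+x. ennreal (indicator W x * (h x + b)) \<partial>lborel)"
      unfolding M_def by (subst emeasure_density) (auto intro!: nn_integral_cong simp: indicator_def)
    also have "\<dots> = ennreal (\<integral>x. indicator W x * (h x + b) \<partial>lborel)"
      by (rule nn_integral_eq_integral)
         (use set_integral_add(1)[OF ih ib] nn in \<open>auto simp: set_integrable_def\<close>)
    also have "(\<integral>x. indicator W x * (h x + b) \<partial>lborel) = (LINT x:W|lborel. h x) + b * measure lborel W"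
      using set_integral_add(2)[OF ih ib] W fin[OF W(2)]
      by (simp add: set_lebesgue_integral_def)
    finally show ?thesis
      using nn by (metis (no_types, lifting) Bochner_Integration.integral_nonneg \<open>(\<integral>x. indicator W x * (h x + b) \<partial>lborel) = (LINT x:W|lborel. h x) + b * measure lborel W\<close>)
  qed
  have em: "emeasure lborel W = ennreal (measure lborel W)" if "W \<subseteq> {l..r}" for W
    using fin[OF that] by (simp add: emeasure_eq_ennreal_measure less_top)
  have "emeasure M G \<le> ennreal (c + b) * emeasure lborel G"
  proof (rule emeasure_le_if_components_le[OF G(1)])
    fix W assume W: "W \<in> components G"
    note Wp = components_open_real[OF G(1) W]
    have sub: "W \<subseteq> {l..r}" using Wp(4) G(2) by auto
    have "emeasure M W \<le> ennreal ((c + b) * measure lborel W)"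
      using val[OF Wp(5) sub] le[OF W] by (auto intro!: ennreal_leI simp: algebra_simps)
    then show "emeasure M W \<le> ennreal (c + b) * emeasure lborel W"
      using b0 c by (simp add: em[OF sub] ennreal_mult)
  qed (simp add: M_def)
  then have "ennreal ((LINT x:G|lborel. h x) + b * measure lborel G) \<le> ennreal ((c + b) * measure lborel G)"
    using val[of G] G b0 c by (simp add: em[OF G(2)] ennreal_mult)
  then have "(LINT x:G|lborel. h x) + b * measure lborel G \<le> (c + b) * measure lborel G"
    using b0 c by (subst (asm) ennreal_le_iff) auto
  then show ?thesis by (simp add: algebra_simps)
qed

lemma abs_set_integral_le_if_components_le:
  fixes h :: "real \<Rightarrow> real"
  assumes G: "open G" "G \<subseteq> {l..r}" and h: "h \<in> borel_measurable borel"
    and b: "\<And>x. \<bar>h x\<bar> \<le> b" and c: "c \<ge> 0"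
    and le: "\<And>W. W \<in> components G \<Longrightarrow> \<bar>LINT x:W|lborel. h x\<bar> \<le> c * measure lborel W"
  shows "\<bar>LINT x:G|lborel. h x\<bar> \<le> c * measure lborel G"
proof -
  have "(LINT x:G|lborel. - h x) \<le> c * measure lborel G"
    by (rule set_integral_le_if_components_le[OF G _ _ c])
       (use h b le in \<open>auto simp: set_lebesgue_integral_def abs_le_iff\<close>)
  moreover have "(LINT x:G|lborel. h x) \<le> c * measure lborel G"
    by (rule set_integral_le_if_components_le[OF G h b c]) (use le in \<open>auto simp: abs_le_iff\<close>)
  ultimately show ?thesis by (simp add: set_lebesgue_integral_def)
qed

section \<open>Strong law for functions that decorrelate along nested partitions\<close>

text \<open>The conditional expectation of \<open>f\<close> given the partition of \<open>G\<close> into components. Off \<open>G\<close> the component of \<open>a\<close> is empty and the value is \<open>0 / 0 = 0\<close>.\<close>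

definition comp_avg :: "real set \<Rightarrow> (real \<Rightarrow> real) \<Rightarrow> real \<Rightarrow> real" where
  "comp_avg G f a = (LINT x:connected_component_set G a|lborel. f x) / measure lborel (connected_component_set G a)"

lemma comp_avg_component:
  fixes G :: "real set"
  assumes "W \<in> components G" "a \<in> W"
  shows "comp_avg G f a = (LINT x:W|lborel. f x) / measure lborel W"
  unfolding comp_avg_def component_eq_connected_component[OF assms] ..

text \<open>The average is locally constant on \<open>G\<close> and vanishes elsewhere.\<close>

lemma comp_avg_measurable:
  fixes G :: "real set"
  assumes G: "open G"
  shows "comp_avg G f \<in> borel_measurable borel"
proof -
  have "continuous_on G (comp_avg G f)"
  proof (rule continuous_at_imp_continuous_on, rule ballI)
    fix a assume a: "a \<in> G"
    let ?W = "connected_component_set G a"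
    have W: "?W \<in> components G" "a \<in> ?W" "open ?W"
      using connected_component_in_components[OF a] components_open_real(1)[OF G] by auto
    then have "\<forall>\<^sub>F z in nhds a. z \<in> ?W" by (intro eventually_nhds_in_open) auto
    then have "\<forall>\<^sub>F z in nhds a. comp_avg G f z = comp_avg G f a"
      by eventually_elim (use W comp_avg_component[OF W(1)] in metis)
    then show "isCont (comp_avg G f) a" using isCont_cong[of "comp_avg G f" "\<lambda>_. comp_avg G f a" a] by simp
  qed
  then have "(\<lambda>x. indicator G x *\<^sub>R comp_avg G f x) \<in> borel_measurable borel"
    using G by (intro borel_measurable_continuous_on_indicator) auto
  moreover have "(\<lambda>x. indicator G x *\<^sub>R comp_avg G f x) = comp_avg G f"
  proof
    fix x show "indicator G x *\<^sub>R comp_avg G f x = comp_avg G f x"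
    proof (cases "x \<in> G")
      case False
      then have e: "connected_component_set G x = {}" using connected_component_in by fastforce
      show ?thesis unfolding comp_avg_def e using False by simp
    qed simp
  qed
  ultimately show ?thesis by simp
qed

lemma set_integrable_bounded:
  fixes f :: "real \<Rightarrow> real"
  assumes "f \<in> borel_measurable borel" "\<And>x. \<bar>f x\<bar> \<le> b" "W \<in> sets borel" "W \<subseteq> {l..r}"
  shows "set_integrable lborel W f"
proof -
  have "emeasure lborel W < \<infinity>"
    using assms(4) by (rule emeasure_lborel_finite)
  then show ?thesis unfolding set_integrable_def
    by (intro integrableI_bounded_set[where A=W and B=b]) (use assms in \<open>auto simp: indicator_def\<close>)
qed

lemma set_integral_abs_bound:
  fixes f :: "real \<Rightarrow> real"
  assumes "f \<in> borel_measurable borel" "\<And>x. \<bar>f x\<bar> \<le> b'" "\<And>x. x \<in> W \<Longrightarrow> \<bar>f x\<bar> \<le> b" "W \<in> sets borel" "W \<subseteq> {l..r}"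
  shows "\<bar>LINT x:W|lborel. f x\<bar> \<le> b * measure lborel W"
proof -
  have fin: "emeasure lborel W < \<infinity>"
    using assms(5) by (rule emeasure_lborel_finite)
  have "\<bar>LINT x:W|lborel. f x\<bar> \<le> (\<integral>x. \<bar>indicator W x *\<^sub>R f x\<bar> \<partial>lborel)"
    unfolding set_lebesgue_integral_def by (rule integral_abs_bound)
  also have "\<dots> \<le> (\<integral>x. b * indicator W x \<partial>lborel)"
  proof (rule integral_mono)
    show "integrable lborel (\<lambda>x. \<bar>indicator W x *\<^sub>R f x\<bar>)"
      using set_integrable_bounded[OF assms(1,2,4,5)] unfolding set_integrable_def by (rule integrable_abs)
    show "integrable lborel (\<lambda>x. b * indicator W x)"
      using fin assms(4) by (intro integrable_mult_right integrable_real_indicator) auto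
  qed (use assms(3) in \<open>auto simp: indicator_def\<close>)
  also have "\<dots> = b * measure lborel W" by simp
  finally show ?thesis .
qed

lemma comp_avg_bounds:
  fixes G :: "real set"
  assumes G: "open G" "G \<subseteq> {l..r}" and f: "f \<in> borel_measurable borel" "\<And>x. 0 \<le> f x" "\<And>x. f x \<le> 1"
  shows "0 \<le> comp_avg G f a \<and> comp_avg G f a \<le> 1"
proof (cases "a \<in> G")
  case True
  let ?W = "connected_component_set G a"
  have W: "?W \<in> components G" using connected_component_in_components[OF True] by auto
  note Wp = components_open_real[OF G(1) W]
  have sub: "?W \<subseteq> {l..r}" using Wp(4) G(2) by auto
  have pos: "measure lborel ?W > 0" by (rule measure_component_pos[OF G(1) W sub])
  have "\<bar>LINT x:?W|lborel. f x\<bar> \<le> 1 * measure lborel ?W"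
    by (rule set_integral_abs_bound[OF f(1) _ _ Wp(5) sub, where b'=1]) (use f in auto)
  moreover have "(LINT x:?W|lborel. f x) \<ge> 0"
    unfolding set_lebesgue_integral_def by (rule Bochner_Integration.integral_nonneg) (use f in auto)
  ultimately show ?thesis using pos by (simp add: comp_avg_def)
next
  case False
  then have e: "connected_component_set G a = {}" using connected_component_in by fastforce
  show ?thesis unfolding comp_avg_def e by simp
qed

lemma geometric_partial_sum:
  fixes r :: real assumes "0 < r" "r < 1" shows "(\<Sum>i<n. r ^ i) \<le> 1 / (1 - r)"
proof -
  have "(\<Sum>i<n. r ^ i) \<le> (\<Sum>i. r ^ i)" by (rule sum_le_suminf) (use assms in \<open>auto intro: summable_geometric\<close>)
  also have "\<dots> = 1 / (1 - r)" using assms by (intro suminf_geometric) auto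
  finally show ?thesis .
qed

text \<open>The covariance bound makes the second moment of the \<open>n\<close>-th partial sum of order \<open>n * sqrt n\<close>. Along \<open>n = k ^ 4\<close>
  the second moments of the averages are therefore of order \<open>1 / k\<^sup>2\<close>, which is summable, so that these averages tend to
  0 almost surely. Consecutive fourth powers have quotients tending to 1, and the terms are bounded, so the averages at the
  times in between follow.\<close>

lemma averages_tendsto_zero:
  fixes D :: "nat \<Rightarrow> 'a \<Rightarrow> real"
  assumes fm: "finite_measure M" and D[measurable]: "\<And>j. D j \<in> borel_measurable M"
    and D1: "\<And>j x. \<bar>D j x\<bar> \<le> 1"
    and cov: "\<And>j. (\<Sum>i\<le>j. \<bar>\<integral>x. D i x * D j x \<partial>M\<bar>) \<le> c * sqrt (real (Suc j))"
  shows "AE x in M. (\<lambda>n. (\<Sum>j<n. D j x) / real n) \<longlonglongrightarrow> 0"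
proof -
  interpret finite_measure M by fact
  define S where "S n x = (\<Sum>j<n. D j x)" for n x
  have Sm[measurable]: "S n \<in> borel_measurable M" for n unfolding S_def by measurable
  have Sb: "\<bar>S n x\<bar> \<le> real n" for n x
    unfolding S_def using sum_norm_bound[of "{..<n}" "\<lambda>j. D j x" 1] D1 by simp
  have c0: "c \<ge> 0"
  proof -
    have "0 \<le> (\<Sum>i\<le>0. \<bar>\<integral>x. D i x * D 0 x \<partial>M\<bar>)" by (intro sum_nonneg) auto
    also have "\<dots> \<le> c" using cov[of 0] by simp
    finally show ?thesis .
  qed
  have iD: "integrable M (\<lambda>x. D i x * D j x)" for i j
    by (rule integrable_const_bound[where B=1])
       (use D1 mult_mono[OF D1 D1] in \<open>auto simp: abs_mult\<close>)
  have iS: "integrable M (\<lambda>x. S n x * D j x)" for n j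
    unfolding S_def sum_distrib_right by (intro Bochner_Integration.integrable_sum iD)
  have iSS: "integrable M (\<lambda>x. (S n x)\<^sup>2)" for n
    unfolding power2_eq_square
    by (subst (2) S_def) (auto simp: sum_distrib_left intro!: Bochner_Integration.integrable_sum iS)
  have var: "(\<integral>x. (S n x)\<^sup>2 \<partial>M) \<le> 2 * c * (real n * sqrt (real n))" for n
  proof (induction n)
    case 0 then show ?case by (simp add: S_def)
  next
    case (Suc n)
    have "(\<integral>x. (S (Suc n) x)\<^sup>2 \<partial>M) = (\<integral>x. (S n x)\<^sup>2 + 2 * (S n x * D n x) + D n x * D n x \<partial>M)"
      by (intro Bochner_Integration.integral_cong) (auto simp: S_def power2_eq_square algebra_simps)
    also have "\<dots> = (\<integral>x. (S n x)\<^sup>2 \<partial>M) + 2 * (\<integral>x. S n x * D n x \<partial>M) + (\<integral>x. D n x * D n x \<partial>M)"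
      using iSS iS iD by simp
    finally have e1: "(\<integral>x. (S (Suc n) x)\<^sup>2 \<partial>M) = (\<integral>x. (S n x)\<^sup>2 \<partial>M) + 2 * (\<integral>x. S n x * D n x \<partial>M) + (\<integral>x. D n x * D n x \<partial>M)" .
    have e2: "(\<integral>x. S n x * D n x \<partial>M) = (\<Sum>i<n. \<integral>x. D i x * D n x \<partial>M)"
      unfolding S_def sum_distrib_right by (subst Bochner_Integration.integral_sum) (auto intro: iD)
    have e3: "(\<Sum>i<n. \<integral>x. D i x * D n x \<partial>M) \<le> (\<Sum>i<n. \<bar>\<integral>x. D i x * D n x \<partial>M\<bar>)"
      by (intro sum_mono abs_ge_self)
    have e4: "(\<Sum>i<n. \<bar>\<integral>x. D i x * D n x \<partial>M\<bar>) + \<bar>\<integral>x. D n x * D n x \<partial>M\<bar> = (\<Sum>i\<le>n. \<bar>\<integral>x. D i x * D n x \<partial>M\<bar>)"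
      by (simp add: lessThan_Suc_atMost[symmetric])
    have "(\<integral>x. (S (Suc n) x)\<^sup>2 \<partial>M) \<le> 2 * c * (real n * sqrt (real n)) + 2 * (c * sqrt (real (Suc n)))"
      using e1 e2 e3 e4 cov[of n] Suc by linarith
    also have "\<dots> \<le> 2 * c * (real n * sqrt (real (Suc n))) + 2 * (c * sqrt (real (Suc n)))"
      using c0 by (intro add_right_mono mult_left_mono) auto
    also have "\<dots> = 2 * c * (real (Suc n) * sqrt (real (Suc n)))" by (simp add: algebra_simps)
    finally show ?case .
  qed
  define Y where "Y k x = (S ((Suc k)^4) x / real ((Suc k)^4))\<^sup>2" for k x
  have Ym[measurable]: "Y k \<in> borel_measurable M" for k unfolding Y_def by measurable
  have EY: "(\<integral>\<^sup>+x. ennreal (Y k x) \<partial>M) \<le> ennreal (2 * c * (1 / real (Suc k) ^ 2))" for k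
  proof -
    let ?n = "(Suc k)^4"
    have iY: "integrable M (Y k)" unfolding Y_def power_divide by (intro integrable_divide iSS)
    have sq: "sqrt (real ?n) = real (Suc k) ^ 2"
      using real_sqrt_unique[of "real (Suc k) ^ 2" "real ?n"] by (simp flip: power_mult)
    have "(\<integral>\<^sup>+x. ennreal (Y k x) \<partial>M) = ennreal (\<integral>x. Y k x \<partial>M)"
      by (rule nn_integral_eq_integral[OF iY]) (auto simp: Y_def)
    also have "(\<integral>x. Y k x \<partial>M) = (\<integral>x. (S ?n x)\<^sup>2 \<partial>M) / (real ?n)\<^sup>2"
      unfolding Y_def power_divide by simp
    also have "\<dots> \<le> 2 * c * (real ?n * sqrt (real ?n)) / (real ?n)\<^sup>2"
      by (intro divide_right_mono var) auto
    also have "\<dots> = 2 * c * (1 / real (Suc k) ^ 2)"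
    proof -
      define t where "t = real (Suc k)"
      have t: "t > 0" "real ?n = t ^ 4" by (simp_all add: t_def)
      show ?thesis unfolding sq unfolding t(2) unfolding t_def[symmetric]
        using t(1) by (simp add: field_simps power2_eq_square power4_eq_xxxx)
    qed
    finally show ?thesis by (simp add: ennreal_leI)
  qed
  have "(\<integral>\<^sup>+x. (\<Sum>k. ennreal (Y k x)) \<partial>M) = (\<Sum>k. \<integral>\<^sup>+x. ennreal (Y k x) \<partial>M)"
    by (rule nn_integral_suminf) auto
  also have "\<dots> \<le> (\<Sum>k. ennreal (2 * c * (1 / real (Suc k) ^ 2)))"
    by (intro suminf_le EY) auto
  also have "\<dots> = ennreal (\<Sum>k. 2 * c * (1 / real (Suc k) ^ 2))"
  proof (rule suminf_ennreal2)
    show "summable (\<lambda>k. 2 * c * (1 / real (Suc k) ^ 2))"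
    proof (rule summable_mult)
      have "summable (\<lambda>k. inverse ((real (Suc k))\<^sup>2))"
        using inverse_power_summable[of 2, where 'a=real] by (subst summable_Suc_iff) simp
      then show "summable (\<lambda>k. 1 / real (Suc k) ^ 2)" by (simp add: divide_inverse del: of_nat_Suc)
    qed
  qed (use c0 in auto)
  finally have "(\<integral>\<^sup>+x. (\<Sum>k. ennreal (Y k x)) \<partial>M) \<noteq> \<infinity>" by (auto simp: top_unique)
  then have "AE x in M. (\<Sum>k. ennreal (Y k x)) \<noteq> \<infinity>"
    by (intro nn_integral_PInf_AE) auto
  then show ?thesis
  proof eventually_elim
    fix x assume "(\<Sum>k. ennreal (Y k x)) \<noteq> \<infinity>"
    then have "summable (\<lambda>k. Y k x)" by (intro summable_suminf_not_top) (auto simp: Y_def)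
    then have "(\<lambda>k. Y k x) \<longlonglongrightarrow> 0" by (rule summable_LIMSEQ_zero)
    then have "(\<lambda>k. sqrt (Y k x)) \<longlonglongrightarrow> sqrt 0" by (rule tendsto_real_sqrt)
    then have lim1: "(\<lambda>k. \<bar>S ((Suc k)^4) x\<bar> / real ((Suc k)^4)) \<longlonglongrightarrow> 0" by (simp add: Y_def)
    \<comment> \<open>The average at the last fourth power, plus the most that the terms up to the next one can add.\<close>
    define R where "R k = \<bar>S ((Suc k)^4) x\<bar> / real ((Suc k)^4) + (real ((Suc (Suc k))^4) - real ((Suc k)^4)) / real ((Suc k)^4)" for k
    have lim2: "(\<lambda>k. (real ((Suc (Suc k))^4) - real ((Suc k)^4)) / real ((Suc k)^4)) \<longlonglongrightarrow> 0"
    proof -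
      have "(\<lambda>k. (1 + 1 / real (Suc k)) ^ 4 - 1) \<longlonglongrightarrow> (1 + 0) ^ 4 - 1"
        by (intro tendsto_intros LIMSEQ_Suc[OF lim_1_over_n])
      moreover have "(1 + 1 / real (Suc k)) ^ 4 - 1 = (real ((Suc (Suc k))^4) - real ((Suc k)^4)) / real ((Suc k)^4)" for k
      proof -
        have "1 + 1 / real (Suc k) = real (Suc (Suc k)) / real (Suc k)" by (simp add: field_simps)
        then show ?thesis by (simp add: power_divide diff_divide_distrib del: of_nat_Suc)
      qed
      ultimately show ?thesis by (simp del: of_nat_Suc of_nat_power)
    qed
    have limR: "R \<longlonglongrightarrow> 0" unfolding R_def using tendsto_add[OF lim1 lim2] by simp
    \<comment> \<open>The index of the largest fourth power up to \<open>n\<close>; the powers are indexed by \<open>Suc k\<close>.\<close>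
    define k where "k n = nat \<lfloor>root 4 (real n)\<rfloor> - 1" for n
    have kk: "(Suc (k n))^4 \<le> n \<and> n < (Suc (Suc (k n)))^4" if n: "n \<ge> 1" for n
    proof -
      let ?r = "root 4 (real n)"
      have r1: "?r \<ge> 1" using n by (simp add: real_root_ge_1_iff)
      have Sk: "Suc (k n) = nat \<lfloor>?r\<rfloor>" using r1 by (simp add: k_def le_nat_iff Suc_diff_1)
      have fl: "?r < real_of_int \<lfloor>?r\<rfloor> + 1" by linarith
      have "real (Suc (k n)) = real_of_int \<lfloor>?r\<rfloor>" unfolding Sk using r1 by simp
      then have a: "real (Suc (k n)) \<le> ?r" "?r < real (Suc (Suc (k n)))" using fl by linarith+
      have r4: "?r ^ 4 = real n" by simp
      have "real (Suc (k n)) ^ 4 \<le> real n" using power_mono[OF a(1), of 4] r4 by simp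
      moreover have "real n < real (Suc (Suc (k n))) ^ 4"
        using power_strict_mono[OF a(2), of 4] r4 r1 by simp
      ultimately show ?thesis by (metis of_nat_le_iff of_nat_less_iff of_nat_power)
    qed
    have ktop: "filterlim k sequentially sequentially"
    proof -
      have "filterlim (\<lambda>n. root 4 (real n)) at_top sequentially"
        unfolding filterlim_at_top
      proof
        fix Z :: real
        show "\<forall>\<^sub>F n in sequentially. Z \<le> root 4 (real n)"
          using eventually_ge_at_top[of "nat \<lceil>\<bar>Z\<bar> ^ 4\<rceil>"]
        proof eventually_elim
          case (elim n)
          then have "\<bar>Z\<bar> ^ 4 \<le> real n" by linarith
          then have "root 4 (\<bar>Z\<bar> ^ 4) \<le> root 4 (real n)" by simp
          moreover have "root 4 (\<bar>Z\<bar> ^ 4) = \<bar>Z\<bar>" by (rule real_root_power_cancel) auto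
          ultimately show ?case by linarith
        qed
      qed
      then have "filterlim (\<lambda>n. nat \<lfloor>root 4 (real n)\<rfloor>) sequentially sequentially"
        by (intro filterlim_compose[OF filterlim_nat_sequentially] filterlim_compose[OF filterlim_floor_sequentially])
      then have "\<forall>\<^sub>F n in sequentially. Suc Z \<le> nat \<lfloor>root 4 (real n)\<rfloor>" for Z
        unfolding filterlim_at_top by blast
      then show ?thesis
        unfolding k_def filterlim_at_top
      proof (intro allI)
        fix Z
        show "\<forall>\<^sub>F n in sequentially. Z \<le> nat \<lfloor>root 4 (real n)\<rfloor> - 1"
          using \<open>\<And>Z. \<forall>\<^sub>F n in sequentially. Suc Z \<le> nat \<lfloor>root 4 (real n)\<rfloor>\<close>[of Z]
          by eventually_elim linarith
      qed
    qed
    have bound: "\<bar>S n x / real n\<bar> \<le> R (k n)" if n: "n \<ge> 1" for n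
    proof -
      let ?k = "(Suc (k n))^4"
      note K = kk[OF n]
      have kp: "real ?k > 0" by simp
      have split: "S n x = S ?k x + (\<Sum>j=?k..<n. D j x)"
        unfolding S_def using K by (simp add: lessThan_atLeast0 sum.atLeastLessThan_concat)
      have "\<bar>\<Sum>j=?k..<n. D j x\<bar> \<le> real n - real ?k"
        using sum_norm_bound[of "{?k..<n}" "\<lambda>j. D j x" 1] D1 K by simp
      then have "\<bar>S n x\<bar> \<le> \<bar>S ?k x\<bar> + (real ((Suc (Suc (k n)))^4) - real ?k)"
        unfolding split using K by (smt (verit) of_nat_less_iff)
      then have "\<bar>S n x / real n\<bar> \<le> (\<bar>S ?k x\<bar> + (real ((Suc (Suc (k n)))^4) - real ?k)) / real n"
        by (simp add: abs_divide divide_right_mono)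
      also have "\<dots> \<le> (\<bar>S ?k x\<bar> + (real ((Suc (Suc (k n)))^4) - real ?k)) / real ?k"
        using K kp n by (intro divide_left_mono) (auto simp: power_mono simp del: of_nat_power)
      also have "\<dots> = R (k n)" by (simp add: R_def add_divide_distrib)
      finally show ?thesis .
    qed
    show "(\<lambda>n. (\<Sum>j<n. D j x) / real n) \<longlonglongrightarrow> 0"
      unfolding S_def[symmetric]
    proof (rule tendsto_rabs_zero_cancel, rule tendsto_sandwich[of "\<lambda>_. 0" _ _ "\<lambda>n. R (k n)"])
      show "\<forall>\<^sub>F n in sequentially. \<bar>S n x / real n\<bar> \<le> R (k n)"
        using eventually_ge_at_top[of 1] by eventually_elim (rule bound)
      show "(\<lambda>n. R (k n)) \<longlonglongrightarrow> 0" by (rule filterlim_compose[OF limR ktop])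
    qed auto
  qed
qed

text \<open>The deviation of \<open>Z j\<close> from its average over the components of \<open>G (q j)\<close> has integral 0 over each of these
  components. For \<open>i \<le> q j\<close> the deviation of \<open>Z i\<close> varies by at most \<open>c * \<theta> ^ (q j - i)\<close> on them: the average is constant
  there, because it is taken over components of the larger set \<open>G (q i)\<close>. Hence such a pair has an exponentially small
  covariance, and the other indices \<open>i \<le> j\<close>, of which there are at most \<open>sqrt j\<close>, contribute at most \<open>e\<close> each. This is the
  covariance bound of the strong law. The averages themselves are bounded by \<open>\<beta> + err j\<close> off the sets \<open>Bad j\<close>, which
  almost every point leaves eventually by Borel-Cantelli.\<close>

theorem frequency_bound_from_component_averages:
  fixes G :: "nat \<Rightarrow> real set" and Z :: "nat \<Rightarrow> real \<Rightarrow> real" and q :: "nat \<Rightarrow> nat"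
  defines "q \<equiv> \<lambda>j. j - nat \<lfloor>sqrt (real j)\<rfloor>"
  assumes e: "0 \<le> e"
    and G: "\<And>n. open (G n)" "\<And>n. G n \<subseteq> {0<..<e}" "\<And>m n. m \<le> n \<Longrightarrow> G n \<subseteq> G m"
    and full: "\<And>n. countable ({0<..<e} - G n)"
    and Z: "\<And>j. Z j \<in> borel_measurable borel" "\<And>j a. 0 \<le> Z j a" "\<And>j a. Z j a \<le> 1"
    and th: "0 < \<theta>" "\<theta> < 1" and c: "c \<ge> 0"
    and osc: "\<And>j n W a a'. j \<le> n \<Longrightarrow> W \<in> components (G n) \<Longrightarrow> a \<in> W \<Longrightarrow> a' \<in> W \<Longrightarrow>
       \<bar>Z j a - Z j a'\<bar> \<le> c * \<theta> ^ (n - j)"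
    and Bad: "\<And>j. Bad j \<in> sets borel" "\<And>j. Bad j \<subseteq> {0<..<e}" "summable (\<lambda>j. measure lborel (Bad j))"
    and avg: "\<And>j a. a \<in> G (q j) - Bad j \<Longrightarrow> comp_avg (G (q j)) (Z j) a \<le> \<beta> + err j"
    and err: "err \<longlonglongrightarrow> 0" and \<beta>: "0 \<le> \<beta>"
  shows "AE a in lborel. a \<in> {0<..<e} \<longrightarrow>
    (\<forall>\<eta>>0. \<forall>\<^sub>F n in sequentially. (\<Sum>j=1..n. Z j a) \<le> (\<beta> + \<eta>) * real n)"
proof -
  let ?I = "{0<..<e}"
  define M where "M = restrict_space lborel ?I"
  have sub: "G n \<subseteq> {0..e}" for n using G(2)[of n] by auto
  have Gm: "G n \<in> sets borel" for n using G(1) by auto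
  interpret M: finite_measure M
    by (rule finite_measureI) (use e in \<open>auto simp: M_def emeasure_restrict_space space_restrict_space\<close>)
  have qle: "q j \<le> j" for j by (simp add: q_def)
  have qdiff: "real (j - q j) \<le> sqrt (real j)" for j
  proof -
    have "j - q j \<le> nat \<lfloor>sqrt (real j)\<rfloor>" by (simp add: q_def)
    also have "real (nat \<lfloor>sqrt (real j)\<rfloor>) \<le> sqrt (real j)" by simp
    finally show ?thesis by simp
  qed
  have qmono: "q i \<le> q j" if "i \<le> j" for i j
  proof -
    have "q j \<le> q (Suc j)" for j
    proof -
      have "sqrt (real (Suc j)) \<le> sqrt (real j) + 1"
        by (rule real_le_lsqrt) (auto simp: power2_eq_square algebra_simps)
      then have "\<lfloor>sqrt (real (Suc j))\<rfloor> \<le> \<lfloor>sqrt (real j)\<rfloor> + 1" by linarith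
      then have "nat \<lfloor>sqrt (real (Suc j))\<rfloor> \<le> nat \<lfloor>sqrt (real j)\<rfloor> + 1"
        by (simp add: nat_le_iff)
      then show ?thesis unfolding q_def by linarith
    qed
    then show ?thesis using that by (rule lift_Suc_mono_le)
  qed
  define W where "W j = comp_avg (G (q j)) (Z j)" for j
  have Wm[measurable]: "W j \<in> borel_measurable borel" for j unfolding W_def by (rule comp_avg_measurable[OF G(1)])
  have Wb: "0 \<le> W j a" "W j a \<le> 1" for j a
    unfolding W_def using comp_avg_bounds[OF G(1) sub Z] by auto
  define D where "D j a = Z j a - W j a" for j a
  have Dm[measurable]: "D j \<in> borel_measurable borel" for j
    unfolding D_def using Z(1) Wm by measurable
  have Db: "\<bar>D j a\<bar> \<le> 1" for j a
    unfolding D_def using Wb[of j a] Z(2,3)[of j a] by linarith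
  have DDb: "\<bar>D i a * D j a\<bar> \<le> 1" for i j a
    using mult_mono[OF Db[of i a] Db[of j a]] by (simp add: abs_mult)
  have DDb': "\<bar>D i a * D j a'\<bar> \<le> 1" for i j a a'
    using mult_mono[OF Db[of i a] Db[of j a']] by (simp add: abs_mult)
  have toG: "(\<integral>x. f x \<partial>M) = (LINT x:G n|lborel. f x)" if "f \<in> borel_measurable borel" for f :: "real \<Rightarrow> real" and n
  proof -
    have "?I - G n \<in> null_sets lborel" using full by (rule countable_imp_null_set_lborel)
    then have ae: "AE x in lborel. x \<notin> ?I - G n" by (rule AE_not_in)
    have "(\<integral>x. f x \<partial>M) = (LINT x:?I|lborel. f x)"
      unfolding M_def by (subst integral_restrict_space) (auto simp: set_lebesgue_integral_def)
    also have "\<dots> = (LINT x:G n|lborel. f x)"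
      unfolding set_lebesgue_integral_def
    proof (rule integral_cong_AE)
      show "AE x in lborel. indicator ?I x *\<^sub>R f x = indicator (G n) x *\<^sub>R f x"
        using ae by eventually_elim (use G(2)[of n] in \<open>auto simp: indicator_def\<close>)
    qed (use that Gm in measurable)
    finally show ?thesis .
  qed
  have cov1: "\<bar>\<integral>x. D i x * D j x \<partial>M\<bar> \<le> c * \<theta> ^ (q j - i) * e" if ij: "i \<le> q j" for i j
  proof -
    let ?H = "G (q j)"
    have ij': "i \<le> j" using ij qle le_trans by blast
    have "\<bar>LINT x:?H|lborel. D i x * D j x\<bar> \<le> c * \<theta> ^ (q j - i) * measure lborel ?H"
    proof (rule abs_set_integral_le_if_components_le[OF G(1) sub])
      show "(\<lambda>x. D i x * D j x) \<in> borel_measurable borel" by measurable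
      show "\<bar>D i x * D j x\<bar> \<le> 1" for x by (rule DDb)
      show "c * \<theta> ^ (q j - i) \<ge> 0" using c th by simp
      fix U assume U: "U \<in> components ?H"
      note Up = components_open_real[OF G(1) U]
      have Us: "U \<subseteq> {0..e}" using Up(4) sub by blast
      have pos: "measure lborel U > 0" by (rule measure_component_pos[OF G(1) U Us])
      obtain a0 where a0: "a0 \<in> U" using Up(3) by blast
      have a0G: "a0 \<in> G (q i)" using a0 Up(4) G(3)[OF qmono[OF ij']] by blast
      define V where "V = connected_component_set (G (q i)) a0"
      have V: "V \<in> components (G (q i))" using connected_component_in_components[OF a0G] by (simp add: V_def)
      have "connected U" using Up(2) by (simp add: is_interval_connected_1)
      then have UV: "U \<subseteq> V"
        unfolding V_def using connected_component_maximal[OF a0] Up(4) G(3)[OF qmono[OF ij']] by blast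
      have Wc: "W i a = W i a0" if "a \<in> U" for a
        unfolding W_def using comp_avg_component[OF V] that a0 UV by (metis subsetD)
      have Wj: "W j a = (LINT x:U|lborel. Z j x) / measure lborel U" if "a \<in> U" for a
        unfolding W_def by (rule comp_avg_component[OF U that])
      have iZ: "set_integrable lborel U (Z j)"
        by (rule set_integrable_bounded[where b=1, OF _ _ Up(5) Us]) (use Z in auto)
      have iD: "set_integrable lborel U (D j)"
        by (rule set_integrable_bounded[where b=1, OF _ _ Up(5) Us]) (use Db in auto)
      have iDD: "set_integrable lborel U (\<lambda>x. D i x * D j x)"
        by (rule set_integrable_bounded[where b=1, OF _ _ Up(5) Us]) (use DDb in auto)
      have fin: "emeasure lborel U < \<infinity>" using Us by (rule emeasure_lborel_finite)
      \<comment> \<open>\<open>U\<close> is a component of \<open>G (q j)\<close>, and \<open>W j\<close> is the average of \<open>Z j\<close> over it.\<close>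
      have zero: "(LINT x:U|lborel. D j x) = 0"
      proof -
        have "(LINT x:U|lborel. D j x) = (LINT x:U|lborel. Z j x - W j a0)"
          by (rule set_lebesgue_integral_cong) (use Up(5) Wj a0 in \<open>auto simp: D_def\<close>)
        also have "\<dots> = (LINT x:U|lborel. Z j x) - (LINT x:U|lborel. W j a0)"
          by (rule set_integral_diff(2)[OF iZ]) 
             (rule set_integrable_bounded[where b=1, OF _ _ Up(5) Us], use Wb[of j a0] in auto)
        also have "(LINT x:U|lborel. W j a0) = measure lborel U * W j a0"
          using Up(5) fin by (simp add: set_lebesgue_integral_def)
        finally show ?thesis using pos Wj[OF a0] by simp
      qed
      \<comment> \<open>As \<open>D j\<close> has mean 0 on \<open>U\<close>, only the variation of \<open>D i\<close> on \<open>U\<close> contributes.\<close>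
      have "(LINT x:U|lborel. D i x * D j x) = (LINT x:U|lborel. D i x * D j x) - D i a0 * (LINT x:U|lborel. D j x)"
        by (simp add: zero)
      also have "\<dots> = (LINT x:U|lborel. D i x * D j x) - (LINT x:U|lborel. D i a0 * D j x)" by simp
      also have "\<dots> = (LINT x:U|lborel. D i x * D j x - D i a0 * D j x)"
        by (rule set_integral_diff(2)[symmetric, OF iDD]) (use iD in auto)
      also have "\<bar>\<dots>\<bar> \<le> c * \<theta> ^ (q j - i) * measure lborel U"
      proof (rule set_integral_abs_bound[where b'=2, OF _ _ _ Up(5) Us])
        show "\<bar>D i x * D j x - D i a0 * D j x\<bar> \<le> 2" for x
          using DDb'[of i x j x] DDb'[of i a0 j x] by linarith
        fix x assume x: "x \<in> U"
        have "\<bar>D i x * D j x - D i a0 * D j x\<bar> = \<bar>D i x - D i a0\<bar> * \<bar>D j x\<bar>"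
          by (simp add: abs_mult flip: left_diff_distrib)
        also have "\<dots> \<le> \<bar>D i x - D i a0\<bar>" using Db by (simp add: mult_left_le)
        also have "\<dots> = \<bar>Z i x - Z i a0\<bar>" using Wc[OF x] by (simp add: D_def)
        also have "\<dots> \<le> c * \<theta> ^ (q j - i)" by (rule osc[OF ij U x a0])
        finally show "\<bar>D i x * D j x - D i a0 * D j x\<bar> \<le> c * \<theta> ^ (q j - i)" .
      qed measurable
      finally show "\<bar>LINT x:U|lborel. D i x * D j x\<bar> \<le> c * \<theta> ^ (q j - i) * measure lborel U" .
    qed
    also have "\<dots> \<le> c * \<theta> ^ (q j - i) * e"
    proof (rule mult_left_mono)
      have "measure lborel ?H \<le> measure lborel {0<..<e}"
        using G(2) Gm e by (intro measure_mono_fmeasurable) (auto simp: fmeasurable_def)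
      then show "measure lborel ?H \<le> e" using e by simp
    qed (use c th in auto)
    finally show ?thesis by (subst toG[of _ "q j"]) auto
  qed
  have cov2: "\<bar>\<integral>x. D i x * D j x \<partial>M\<bar> \<le> e" for i j
  proof -
    have "\<bar>LINT x:?I|lborel. D i x * D j x\<bar> \<le> 1 * measure lborel ?I"
      by (rule set_integral_abs_bound[where b'=1 and l=0 and r=e]) (use DDb in auto)
    moreover have "(\<integral>x. D i x * D j x \<partial>M) = (LINT x:?I|lborel. D i x * D j x)"
      unfolding M_def by (subst integral_restrict_space) (auto simp: set_lebesgue_integral_def)
    ultimately show ?thesis using e by simp
  qed
  have cov: "(\<Sum>i\<le>j. \<bar>\<integral>x. D i x * D j x \<partial>M\<bar>) \<le> (c * e / (1 - \<theta>) + e) * sqrt (real (Suc j))" for j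
  proof -
    have un: "{..j} = {..q j} \<union> {q j<..j}" using qle[of j] by auto
    have "(\<Sum>i\<le>j. \<bar>\<integral>x. D i x * D j x \<partial>M\<bar>)
        = (\<Sum>i\<le>q j. \<bar>\<integral>x. D i x * D j x \<partial>M\<bar>) + (\<Sum>i\<in>{q j<..j}. \<bar>\<integral>x. D i x * D j x \<partial>M\<bar>)"
      unfolding un by (rule sum.union_disjoint) auto
    also have "\<dots> \<le> (\<Sum>i\<le>q j. c * \<theta> ^ (q j - i) * e) + (\<Sum>i\<in>{q j<..j}. e)"
      by (intro add_mono sum_mono cov1 cov2) auto
    also have "(\<Sum>i\<le>q j. c * \<theta> ^ (q j - i) * e) = c * e * (\<Sum>i\<le>q j. \<theta> ^ (q j - i))"
      by (simp add: sum_distrib_left mult_ac)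
    also have "(\<Sum>i\<le>q j. \<theta> ^ (q j - i)) = (\<Sum>i\<le>q j. \<theta> ^ i)"
      using sum.nat_diff_reindex[of "\<lambda>i. \<theta> ^ i" "Suc (q j)"] by (simp add: lessThan_Suc_atMost)
    also have "\<dots> \<le> 1 / (1 - \<theta>)"
      using geometric_partial_sum[OF th, of "Suc (q j)"] by (simp add: lessThan_Suc_atMost)
    also have "(\<Sum>i\<in>{q j<..j}. e) = real (j - q j) * e" by simp
    also have "\<dots> \<le> sqrt (real (Suc j)) * e"
      using qdiff[of j] e by (intro mult_right_mono order_trans[OF qdiff[of j]]) auto
    finally have "(\<Sum>i\<le>j. \<bar>\<integral>x. D i x * D j x \<partial>M\<bar>) \<le> c * e * (1 / (1 - \<theta>)) + sqrt (real (Suc j)) * e"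
      using c e by (simp add: mult_left_mono)
    also have "c * e * (1 / (1 - \<theta>)) \<le> c * e / (1 - \<theta>) * sqrt (real (Suc j))"
      using c e th mult_left_mono[of 1 "sqrt (real (Suc j))" "c * e / (1 - \<theta>)"] by simp
    finally show ?thesis by (simp add: algebra_simps)
  qed
  have ae1: "AE x in M. (\<lambda>n. (\<Sum>j<n. D j x) / real n) \<longlonglongrightarrow> 0"
  proof (rule averages_tendsto_zero[OF M.finite_measure_axioms _ Db cov])
    show "D j \<in> borel_measurable M" for j
      unfolding M_def by (rule measurable_restrict_space1) simp
  qed
  have BadM: "Bad j \<in> sets M" for j
    using Bad(1,2) by (auto simp: M_def sets_restrict_space)
  have mBad: "measure M (Bad j) = measure lborel (Bad j)" for j
    unfolding M_def using Bad(1,2) by (subst measure_restrict_space) auto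
  have ae2: "AE x in M. \<forall>\<^sub>F j in sequentially. x \<in> space M - Bad j"
    by (rule borel_cantelli_AE1) (use BadM Bad(3) mBad in \<open>auto simp: less_top[symmetric] M.emeasure_finite\<close>)
  have ae3: "AE x in lborel. \<forall>n. x \<notin> ?I - G n"
    unfolding AE_all_countable
    by (intro allI AE_not_in countable_imp_null_set_lborel full)
  have "AE x in M. (\<forall>n. x \<notin> ?I - G n)"
    unfolding M_def by (subst AE_restrict_space_iff) (use ae3 in auto)
  with ae1 ae2 have "AE a in M. (\<forall>\<eta>>0. \<forall>\<^sub>F n in sequentially. (\<Sum>j=1..n. Z j a) \<le> (\<beta> + \<eta>) * real n)"
  proof eventually_elim
    fix a assume lim: "(\<lambda>n. (\<Sum>j<n. D j a) / real n) \<longlonglongrightarrow> 0"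
      and nb: "\<forall>\<^sub>F j in sequentially. a \<in> space M - Bad j" and aG: "\<forall>n. a \<notin> ?I - G n"
    show "\<forall>\<eta>>0. \<forall>\<^sub>F n in sequentially. (\<Sum>j=1..n. Z j a) \<le> (\<beta> + \<eta>) * real n"
    proof (intro allI impI)
      fix \<eta> :: real assume \<eta>: "\<eta> > 0"
      have "\<forall>\<^sub>F j in sequentially. W j a \<le> \<beta> + \<eta> / 4"
        using nb order_tendstoD(2)[OF err, of "\<eta>/4", simplified, OF \<eta>]
      proof (eventually_elim, goal_cases)
        case (1 j)
        then have "a \<in> G (q j) - Bad j" using aG by (auto simp: M_def space_restrict_space)
        then show ?case using avg[of a j] 1 by (auto simp: W_def)
      qed
      then obtain J where J: "\<And>j. j \<ge> J \<Longrightarrow> W j a \<le> \<beta> + \<eta> / 4" by (auto simp: eventually_sequentially)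
      \<comment> \<open>The first \<open>J\<close> averages are bounded by 1 each.\<close>
      have sumW: "(\<Sum>j<n. W j a) \<le> real J + (\<beta> + \<eta> / 4) * real n" for n
      proof (induction n)
        case (Suc n)
        show ?case
        proof (cases "n \<ge> J")
          case True then show ?thesis using Suc J[OF True] by (simp add: algebra_simps add_divide_distrib)
        next
          case False
          have "(\<Sum>j<Suc n. W j a) \<le> (\<Sum>j<Suc n. 1)" by (intro sum_mono Wb)
          also have "\<dots> \<le> real J" using False by simp
          also have "\<dots> \<le> real J + (\<beta> + \<eta> / 4) * real (Suc n)" using \<beta> \<eta> by simp
          finally show ?thesis .
        qed
      qed simp
      have "\<forall>\<^sub>F n in sequentially. (\<Sum>j<n. D j a) / real n < \<eta> / 4"
        using order_tendstoD(2)[OF lim, of "\<eta>/4"] \<eta> by auto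
      moreover have "\<forall>\<^sub>F n in sequentially. real J + 1 \<le> \<eta> / 4 * real n"
        using \<eta> filterlim_real_sequentially unfolding filterlim_at_top
        by (auto elim!: allE[of _ "(real J + 1) / (\<eta> / 4)"] eventually_mono simp: field_simps)
      ultimately show "\<forall>\<^sub>F n in sequentially. (\<Sum>j=1..n. Z j a) \<le> (\<beta> + \<eta>) * real n"
        using eventually_gt_at_top[of 0]
      proof eventually_elim
        fix n :: nat assume n: "(\<Sum>j<n. D j a) / real n < \<eta> / 4" "real J + 1 \<le> \<eta> / 4 * real n" "0 < n"
        have "(\<Sum>j=1..n. Z j a) \<le> (\<Sum>j<Suc n. Z j a)"
          by (rule sum_mono2) (use Z in auto)
        also have "\<dots> \<le> (\<Sum>j<n. Z j a) + 1" using Z(3)[of n a] by simp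
        also have "(\<Sum>j<n. Z j a) = (\<Sum>j<n. D j a) + (\<Sum>j<n. W j a)"
          by (simp add: D_def sum.distrib[symmetric])
        also have "(\<Sum>j<n. D j a) \<le> \<eta> / 4 * real n" using n by (simp add: pos_divide_less_eq)
        finally have "(\<Sum>j=1..n. Z j a) \<le> \<eta> / 4 * real n + (real J + (\<beta> + \<eta> / 4) * real n) + 1"
          using sumW[of n] by linarith
        also have "\<dots> \<le> (\<beta> + \<eta>) * real n" using n(2) \<eta> by (simp add: algebra_simps)
        finally show "(\<Sum>j=1..n. Z j a) \<le> (\<beta> + \<eta>) * real n" .
      qed
    qed
  qed
  then show ?thesis unfolding M_def by (subst (asm) AE_restrict_space_iff) auto
qed

section \<open>Visit frequencies and typical points\<close>

text \<open>The trapezoid that is 1 on \<open>{u..v}\<close> and decreases to 0 with slope \<open>1 / d\<close> on both sides.\<close>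

definition plateau :: "real \<Rightarrow> real \<Rightarrow> real \<Rightarrow> real \<Rightarrow> real" where
  "plateau u v d x = max 0 (1 - max 0 (max (u - x) (x - v)) / d)"

lemma plateau_bounds: "d > 0 \<Longrightarrow> 0 \<le> plateau u v d x \<and> plateau u v d x \<le> 1"
  by (auto simp: plateau_def)

lemma plateau_lipschitz: "d > 0 \<Longrightarrow> \<bar>plateau u v d x - plateau u v d y\<bar> \<le> \<bar>x - y\<bar> / d"
proof -
  assume d: "d > 0"
  let ?m = "\<lambda>x. max 0 (max (u - x) (x - v))"
  have "\<bar>plateau u v d x - plateau u v d y\<bar> \<le> \<bar>?m x / d - ?m y / d\<bar>" 
    unfolding plateau_def by linarith
  also have "\<dots> = \<bar>?m x - ?m y\<bar> / d" using d by (simp flip: diff_divide_distrib)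
  also have "\<dots> \<le> \<bar>x - y\<bar> / d" using d by (intro divide_right_mono) linarith+
  finally show ?thesis .
qed

lemma plateau_inside: "x \<in> {u..v} \<Longrightarrow> plateau u v d x = 1"
  by (auto simp: plateau_def max_def)

lemma plateau_outside: "d > 0 \<Longrightarrow> x \<notin> {u-d..v+d} \<Longrightarrow> plateau u v d x = 0"
  by (auto simp: plateau_def max_def divide_simps)

lemma isCont_plateau: "d > 0 \<Longrightarrow> isCont (plateau u v d) x"
  unfolding plateau_def by (intro continuous_intros) auto

lemma plateau_measurable [measurable]: "plateau u v d \<in> borel_measurable borel"
  unfolding plateau_def by measurable

text \<open>The empirical measure of \<open>y 1, \<dots>, y (Suc n)\<close>. The shift by one makes it a probability measure for every \<open>n\<close>.\<close>

definition empirical :: "(nat \<Rightarrow> real) \<Rightarrow> nat \<Rightarrow> real measure" where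
  "empirical y n = distr (measure_pmf (pmf_of_set {1..Suc n})) borel y"

lemma real_distribution_empirical: "real_distribution (empirical y n)"
  unfolding empirical_def by (rule prob_space.real_distribution_distr[OF prob_space_measure_pmf]) simp

lemma integral_empirical:
  fixes g :: "real \<Rightarrow> real"
  assumes "g \<in> borel_measurable borel"
  shows "integral\<^sup>L (empirical y n) g = (\<Sum>i=1..Suc n. g (y i)) / real (Suc n)"
proof -
  have "integral\<^sup>L (empirical y n) g = (\<integral>i. g (y i) \<partial>measure_pmf (pmf_of_set {1..Suc n}))"
    unfolding empirical_def using assms by (subst integral_distr) auto
  also have "\<dots> = (\<Sum>i=1..Suc n. g (y i)) / real (Suc n)"
    by (subst integral_pmf_of_set) auto
  finally show ?thesis .
qed

lemma tight_empirical:
  assumes y: "\<And>i. y i \<in> {0..1}"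
  shows "tight (empirical y)"
  unfolding tight_def
proof (intro conjI allI impI real_distribution_empirical)
  fix e :: real assume "e > 0"
  have "measure (empirical y n) {-1<..1} = 1" for n
  proof -
    have *: "y -` {-1<..1} = UNIV" using y by (force intro: order.strict_trans2[of "-1" 0])
    have "measure (empirical y n) {-1<..1} = measure (measure_pmf (pmf_of_set {1..Suc n})) (y -` {-1<..1})"
      unfolding empirical_def by (subst measure_distr) auto
    then show ?thesis unfolding * using measure_pmf.prob_space by simp
  qed
  then show "\<exists>a b. a < b \<and> (\<forall>n. 1 - e < measure (empirical y n) {a<..b})"
    using \<open>e > 0\<close> by (intro exI[of _ "-1"] exI[of _ 1]) auto
qed

text \<open>Equality of characteristic functions is thereby an equality of integrals of bounded continuous real functions, to which weak convergence applies.\<close>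

lemma integral_iexp_parts:
  fixes \<nu> :: "real measure" and g :: "real \<Rightarrow> real"
  assumes "prob_space \<nu>" "g \<in> borel_measurable \<nu>"
  shows "(CLINT x|\<nu>. iexp (g x)) = Complex (\<integral>x. cos (g x) \<partial>\<nu>) (\<integral>x. sin (g x) \<partial>\<nu>)"
proof -
  interpret prob_space \<nu> by fact
  have i: "integrable \<nu> (\<lambda>x. iexp (g x))"
    by (rule integrable_const_bound[where B=1]) (use assms in auto)
  have "Re (CLINT x|\<nu>. iexp (g x)) = (\<integral>x. cos (g x) \<partial>\<nu>)"
    using integral_Re[OF i] by (simp add: Re_exp)
  moreover have "Im (CLINT x|\<nu>. iexp (g x)) = (\<integral>x. sin (g x) \<partial>\<nu>)"
    using integral_Im[OF i] by (simp add: Im_exp)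
  ultimately show ?thesis by (simp add: complex_eq_iff)
qed

text \<open>Let \<open>\<nu>\<close> be a weak limit of the empirical measures of the orbit of \<open>x\<close>. Testing with plateaus gives
  \<open>\<nu> {u..v} \<le> C * (v - u)\<close>, so \<open>\<nu>\<close> is absolutely continuous and has no atoms. The map \<open>f\<close> is then continuous \<open>\<nu>\<close>-almost
  everywhere, weak convergence may be applied to \<open>g \<circ> f\<close> as well as to \<open>g\<close>, and their integrals against an
  empirical measure differ only by boundary terms: \<open>\<nu>\<close> is invariant, hence equal to \<open>M\<close>. All orbits stay
  in a compact interval, so uniqueness of the limit implies convergence. Rational \<open>u\<close>, \<open>v\<close>, \<open>d\<close> suffice by density,
  so that bounds holding for almost every parameter can be used for all of them at once.\<close>

theorem typical_point_if_frequency_bound: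
  fixes f :: "real \<Rightarrow> real" and M :: "real measure" and C x :: real
  assumes B: "finite B" "0 \<in> B" "1 \<in> B"
    and cont: "\<And>z. z \<in> {0..1} - B \<Longrightarrow> isCont f z"
    and into: "\<And>z. z \<in> {0..1} \<Longrightarrow> f z \<in> {0..1}"
    and acip: "acip f M" and uniq: "\<And>\<nu>. acip f \<nu> \<Longrightarrow> \<nu> = M"
    and x: "x \<in> {0..1}" and C: "C \<ge> 0"
    and freq: "\<And>u v d e. u \<in> \<rat> \<Longrightarrow> v \<in> \<rat> \<Longrightarrow> d \<in> \<rat> \<Longrightarrow> u < v \<Longrightarrow> 0 < d \<Longrightarrow> 0 < e \<Longrightarrow>
       \<forall>\<^sub>F n in sequentially. (\<Sum>i=1..n. plateau u v d ((f ^^ i) x)) \<le> (C * (v - u + 2 * d) + e) * real n"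
  shows "typical_point f M x"
proof -
  define y where "y i = (f ^^ i) x" for i
  have y: "y i \<in> {0..1}" for i unfolding y_def using x into by (induction i) auto
  have setsM: "sets M = sets unit_leb" and pM: "prob_space M" and fM: "f \<in> measurable M M"
    using acip by (auto simp: acip_def)
  have spM: "space M = {0..1}" using sets_eq_imp_space_eq[OF setsM] by (simp add: space_restrict_space)
  have funit: "f \<in> measurable unit_leb unit_leb" using fM measurable_cong_sets[OF setsM setsM] by simp
  have idM: "(\<lambda>z. z) \<in> measurable M borel"
    using measurable_cong_sets[OF setsM refl, of borel] measurable_restrict_space1[of "\<lambda>z. z" lborel borel "{0..1}"] by auto
  interpret PM: prob_space M by fact
  define M' where "M' = distr M borel (\<lambda>z. z)"
  have rM': "real_distribution M'" unfolding M'_def using idM by (intro PM.real_distribution_distr)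
  \<comment> \<open>Weak convergence takes place on the whole line, so \<open>f\<close> is extended; new discontinuities arise at most at 0 and 1, which lie in \<open>B\<close>.\<close>
  define f' where "f' z = (if z \<in> {0..1} then f z else 0)" for z
  have f'm: "f' \<in> borel_measurable borel"
  proof -
    have "f \<in> borel_measurable (restrict_space borel {0..1})"
      using measurable_compose[OF funit, of "\<lambda>z. z" borel]
        measurable_restrict_space1[of "\<lambda>z. z" lborel borel "{0..1}"]
        measurable_cong_sets[of unit_leb "restrict_space borel {0..1::real}" borel borel]
      by (auto simp: sets_restrict_space)
    then have "(\<lambda>z. if z \<in> {0..1} then f z else 0) \<in> borel_measurable borel"
      by (subst measurable_If_restrict_space_iff) (auto simp: atLeastAtMost_def atLeast_def atMost_def Int_def)
    then show ?thesis by (simp add: f'_def[abs_def])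
  qed
  have f'cont: "isCont f' z" if "z \<notin> B" for z
  proof (cases "z \<in> {0..1}")
    case True
    then have z: "0 < z" "z < 1" using that B by (auto simp: order.strict_iff_order)
    then have "\<forall>\<^sub>F w in nhds z. w \<in> {0<..<1}" by (intro eventually_nhds_in_open) auto
    then have "\<forall>\<^sub>F w in nhds z. f' w = f w" by eventually_elim (auto simp: f'_def)
    then show ?thesis using cont[of z] that True isCont_cong by blast
  next
    case False
    then have "\<forall>\<^sub>F w in nhds z. w \<in> - {0..1}" by (intro eventually_nhds_in_open) (auto simp: open_Compl)
    then have "\<forall>\<^sub>F w in nhds z. f' w = 0" by eventually_elim (auto simp: f'_def)
    then show ?thesis using isCont_cong[of f' "\<lambda>_. 0" z] by auto
  qed
  have limit: "\<nu> = M'" if s: "strict_mono s" and r\<nu>: "real_distribution \<nu>" and wc: "weak_conv_m (empirical y \<circ> s) \<nu>" for s \<nu>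
  proof -
    interpret real_distribution \<nu> by fact
    have rd: "real_distribution ((empirical y \<circ> s) n)" for n by (simp add: real_distribution_empirical)
    have s_top: "filterlim s sequentially sequentially" using s by (rule filterlim_subseq)
    note conv = weak_conv_imp_integral_bdd_continuous_conv[OF rd r\<nu> wc]
    note aeconv = weak_conv_imp_bdd_ae_continuous_conv[OF rd r\<nu> wc]
    have bd: "measure \<nu> {u..v} \<le> C * (v - u)" if uv: "u < v" for u v
    proof -
      have "measure \<nu> {u..v} \<le> C * (v - u) + (4 * C + 1) * e" if e: "e > 0" for e
      proof -
        obtain u' where u': "u' \<in> \<rat>" "u - e < u'" "u' < u" using Rats_dense_in_real[of "u-e" u] e by auto
        obtain v' where v': "v' \<in> \<rat>" "v < v'" "v' < v + e" using Rats_dense_in_real[of v "v+e"] e by auto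
        obtain d where d: "d \<in> \<rat>" "0 < d" "d < e" using Rats_dense_in_real[of 0 e] e by auto
        have u'v': "u' < v'" using u' v' uv by simp
        have fr: "\<forall>\<^sub>F n in sequentially. (\<Sum>i=1..n. plateau u' v' d (y i)) \<le> (C * (v' - u' + 2 * d) + e) * real n"
          unfolding y_def by (rule freq) (use u' v' d e u'v' in auto)
        have fr2: "\<forall>\<^sub>F n in sequentially. integral\<^sup>L (empirical y n) (plateau u' v' d) \<le> C * (v' - u' + 2 * d) + e"
          using eventually_compose_filterlim[OF fr filterlim_Suc]
          by eventually_elim (subst integral_empirical, auto simp: pos_divide_le_eq simp del: of_nat_Suc sum.cl_ivl_Suc)
        have lim: "(\<lambda>n. integral\<^sup>L ((empirical y \<circ> s) n) (plateau u' v' d)) \<longlonglongrightarrow> integral\<^sup>L \<nu> (plateau u' v' d)"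
          by (rule conv[where B=1]) (use isCont_plateau plateau_bounds d in auto)
        have "integral\<^sup>L \<nu> (plateau u' v' d) \<le> C * (v' - u' + 2 * d) + e"
          using eventually_compose_filterlim[OF fr2 s_top]
          by (intro tendsto_upperbound[OF lim]) auto
        moreover have "measure \<nu> {u..v} \<le> integral\<^sup>L \<nu> (plateau u' v' d)"
        proof -
          have "measure \<nu> {u..v} = (\<integral>x. indicator {u..v} x \<partial>\<nu>)" by simp
          also have "\<dots> \<le> integral\<^sup>L \<nu> (plateau u' v' d)"
          proof (rule integral_mono)
            show "integrable \<nu> (plateau u' v' d)"
              by (rule integrable_const_bound[where B=1]) (use plateau_bounds d in auto)
            show "indicator {u..v} x \<le> plateau u' v' d x" for x
              using plateau_inside[of x u' v' d] plateau_bounds[of d u' v' x] d u' v' by (auto simp: indicator_def)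
          qed (auto intro!: integrable_const_bound[where B=1] simp: indicator_def)
          finally show ?thesis .
        qed
        moreover have "C * (v' - u' + 2 * d) \<le> C * (v - u + 4 * e)"
          using u' v' d C by (intro mult_left_mono) auto
        ultimately show ?thesis by (simp add: algebra_simps)
      qed note * = this
      show ?thesis
      proof (rule field_le_epsilon)
        fix e :: real assume "e > 0"
        then have "e / (4 * C + 1) > 0" using C by (intro divide_pos_pos) auto
        have "(4 * C + 1) * (e / (4 * C + 1)) = e" using C by simp
        then show "measure \<nu> {u..v} \<le> C * (v - u) + e"
          using \<open>e / (4 * C + 1) > 0\<close> *[of "e / (4 * C + 1)"] by metis
      qed
    qed
    have ac: "emeasure \<nu> E = 0" if "E \<in> sets borel" "emeasure lborel E = 0" "E \<subseteq> {0..1}" for E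
    proof -
      have "emeasure \<nu> E \<le> ennreal C * emeasure lborel E"
        by (rule emeasure_le_if_interval_bound[OF _ C])
           (use that bd in \<open>auto simp: emeasure_eq_measure intro!: ennreal_leI\<close>)
      then show ?thesis using that by simp
    qed
    have point: "emeasure \<nu> {c} = 0" for c
    proof -
      have small: "measure \<nu> {c} \<le> C * e" if "e > 0" for e
      proof -
        have "measure \<nu> {c} \<le> measure \<nu> {c..c+e}" using that by (intro finite_measure_mono) auto
        then show ?thesis using bd[of c "c+e"] that by simp
      qed
      have "measure \<nu> {c} \<le> 0"
      proof (rule field_le_epsilon)
        fix e :: real assume e: "e > 0"
        have "C * (e / (C + 1)) \<le> e" using C e by (simp add: field_simps)
        then show "measure \<nu> {c} \<le> 0 + e" using small[of "e / (C + 1)"] C e by (simp add: order_trans)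
      qed
      then show ?thesis by (simp add: emeasure_eq_measure measure_le_0_iff)
    qed
    \<comment> \<open>The truncated distance to the unit interval has integral 0 along the sequence.\<close>
    have unit: "AE z in \<nu>. z \<in> {0..1}"
    proof -
      define g where "g z = min 1 (max 0 (max (0 - z) (z - 1)))" for z :: real
      have gm: "g \<in> borel_measurable borel" unfolding g_def by measurable
      have "(\<lambda>n. integral\<^sup>L ((empirical y \<circ> s) n) g) \<longlonglongrightarrow> integral\<^sup>L \<nu> g"
      proof (rule conv[where B=1])
        show "isCont g z" for z unfolding g_def[abs_def] by (intro continuous_intros)
      qed (auto simp: g_def)
      moreover have "integral\<^sup>L ((empirical y \<circ> s) n) g = 0" for n
      proof -
        have "g (y i) = 0" for i using y[of i] by (auto simp: g_def)
        then show ?thesis by (simp add: integral_empirical[OF gm] del: sum.cl_ivl_Suc)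
      qed
      ultimately have "integral\<^sup>L \<nu> g = 0" by (simp add: LIMSEQ_const_iff)
      moreover have "integrable \<nu> g"
        by (rule integrable_const_bound[where B=1]) (use gm in \<open>auto simp: g_def\<close>)
      ultimately have "AE z in \<nu>. g z = 0"
        by (subst (asm) integral_nonneg_eq_0_iff_AE) (auto simp: g_def)
      then show ?thesis by eventually_elim (auto simp: g_def split: if_splits simp: min_def max_def)
    qed
    have inv: "distr \<nu> borel f' = \<nu>"
    proof (rule Levy_uniqueness)
      show "real_distribution (distr \<nu> borel f')" using f'm by (intro real_distribution_distr) simp
      show "real_distribution \<nu>" by fact
      have nullB: "emeasure \<nu> {z. \<not> isCont g z} = 0" if "\<And>z. z \<notin> B \<Longrightarrow> isCont g z" for g :: "real \<Rightarrow> real"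
      proof -
        have fin: "finite {z. \<not> isCont g z}" by (rule finite_subset[OF _ B(1)]) (use that in auto)
        have "emeasure \<nu> {z. \<not> isCont g z} \<le> (\<Sum>z\<in>{z. \<not> isCont g z}. emeasure \<nu> {z})"
          using emeasure_subadditive_finite[OF fin, of "\<lambda>z. {z}" \<nu>] by (simp add: image_subset_iff)
        then show ?thesis using point by simp
      qed
      have eq: "(\<integral>z. g (f' z) \<partial>\<nu>) = (\<integral>z. g z \<partial>\<nu>)" if gc: "\<And>z. isCont g z" and g1: "\<And>z. \<bar>g z\<bar> \<le> 1" for g :: "real \<Rightarrow> real"
      proof -
        have gm: "g \<in> borel_measurable borel" using gc by (intro borel_measurable_continuous_onI continuous_at_imp_continuous_on) auto
        have gfm: "(\<lambda>z. g (f' z)) \<in> borel_measurable borel" using gm f'm by measurable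
        have "(\<lambda>n. integral\<^sup>L ((empirical y \<circ> s) n) g) \<longlonglongrightarrow> integral\<^sup>L \<nu> g"
          by (rule conv[where B=1]) (use gc g1 in auto)
        moreover have "(\<lambda>n. integral\<^sup>L ((empirical y \<circ> s) n) (\<lambda>z. g (f' z))) \<longlonglongrightarrow> (\<integral>z. g (f' z) \<partial>\<nu>)"
        proof (rule aeconv[where B=1])
          show "emeasure \<nu> {z. \<not> isCont (\<lambda>z. g (f' z)) z} = 0"
            by (rule nullB, rule isCont_o2[OF f'cont gc])
        qed (use gfm g1 in auto)
        ultimately have "(\<lambda>n. integral\<^sup>L ((empirical y \<circ> s) n) (\<lambda>z. g (f' z)) - integral\<^sup>L ((empirical y \<circ> s) n) g) \<longlonglongrightarrow> (\<integral>z. g (f' z) \<partial>\<nu>) - integral\<^sup>L \<nu> g"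
          by (intro tendsto_diff)
        moreover have "(\<lambda>n. integral\<^sup>L (empirical y n) (\<lambda>z. g (f' z)) - integral\<^sup>L (empirical y n) g) \<longlonglongrightarrow> 0"
        proof (rule tendsto_rabs_zero_cancel, rule tendsto_sandwich[of "\<lambda>_. 0" _ _ "\<lambda>n. 2 / real (Suc n)"])
          have "\<bar>integral\<^sup>L (empirical y n) (\<lambda>z. g (f' z)) - integral\<^sup>L (empirical y n) g\<bar> \<le> 2 / real (Suc n)" for n
          proof -
            have "f' (y i) = y (Suc i)" for i using y[of i] by (simp add: f'_def y_def)
            then have "integral\<^sup>L (empirical y n) (\<lambda>z. g (f' z)) - integral\<^sup>L (empirical y n) g
              = ((\<Sum>i=1..Suc n. g (y (Suc i))) - (\<Sum>i=1..Suc n. g (y i))) / real (Suc n)"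
              by (simp add: integral_empirical[OF gm] integral_empirical[OF gfm] diff_divide_distrib del: sum.cl_ivl_Suc of_nat_Suc)
            also have "(\<Sum>i=1..Suc n. g (y (Suc i))) - (\<Sum>i=1..Suc n. g (y i)) = g (y (Suc (Suc n))) - g (y 1)"
              by (simp only: sum_subtractf[symmetric]) (subst sum_Suc_diff, auto)
            finally show ?thesis using g1[of "y (Suc (Suc n))"] g1[of "y 1"]
              by (simp add: divide_right_mono del: of_nat_Suc)
          qed
          then show "\<forall>\<^sub>F n in sequentially. \<bar>integral\<^sup>L (empirical y n) (\<lambda>z. g (f' z)) - integral\<^sup>L (empirical y n) g\<bar> \<le> 2 / real (Suc n)" by simp
          show "(\<lambda>n. 2 / real (Suc n)) \<longlonglongrightarrow> 0"
            by (rule LIMSEQ_Suc) (rule lim_const_over_n)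
        qed auto
        then have "(\<lambda>n. integral\<^sup>L ((empirical y \<circ> s) n) (\<lambda>z. g (f' z)) - integral\<^sup>L ((empirical y \<circ> s) n) g) \<longlonglongrightarrow> 0"
          unfolding o_def by (rule filterlim_compose[OF _ s_top])
        ultimately have "(\<integral>z. g (f' z) \<partial>\<nu>) - integral\<^sup>L \<nu> g = 0" by (rule LIMSEQ_unique)
        then show ?thesis by simp
      qed
      show "char (distr \<nu> borel f') = char \<nu>"
      proof
        fix t
        have "char (distr \<nu> borel f') t = (CLINT z|\<nu>. iexp (t * f' z))"
          unfolding char_def using f'm by (subst integral_distr) auto
        also have "\<dots> = Complex (\<integral>z. cos (t * f' z) \<partial>\<nu>) (\<integral>z. sin (t * f' z) \<partial>\<nu>)"
          by (rule integral_iexp_parts) (use f'm in \<open>auto intro: prob_space_axioms\<close>)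
        also have "\<dots> = Complex (\<integral>z. cos (t * z) \<partial>\<nu>) (\<integral>z. sin (t * z) \<partial>\<nu>)"
          using eq[of "\<lambda>z. cos (t * z)"] eq[of "\<lambda>z. sin (t * z)"] by simp
        also have "\<dots> = char \<nu> t"
          unfolding char_def by (rule integral_iexp_parts[symmetric]) (auto intro: prob_space_axioms)
        finally show "char (distr \<nu> borel f') t = char \<nu> t" .
      qed
    qed
    define N where "N = restrict_space \<nu> {0..1}"
    have u1: "{0..1} \<in> sets \<nu>" by simp
    have setsN: "sets N = sets unit_leb" by (simp add: N_def sets_restrict_space)
    have pN: "prob_space N"
      unfolding N_def
    proof (rule prob_spaceI)
      have "emeasure \<nu> {0..1} = 1" using unit by (subst emeasure_eq_1_AE) auto
      then show "emeasure (restrict_space \<nu> {0..1}) (space (restrict_space \<nu> {0..1})) = 1"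
        by (simp add: emeasure_restrict_space space_restrict_space)
    qed
    have fN: "f \<in> measurable N N" using funit measurable_cong_sets[OF setsN setsN] by simp
    have "acip f N" unfolding acip_def
    proof (intro conjI setsN pN fN)
      show "absolutely_continuous unit_leb N"
        unfolding absolutely_continuous_def
        by (auto simp: null_sets_restrict_space N_def null_sets_def emeasure_restrict_space sets_restrict_space intro!: ac)
      show "distr N N f = N"
      proof (rule measure_eqI)
        fix E assume "E \<in> sets (distr N N f)"
        then have E: "E \<in> sets borel" "E \<subseteq> {0..1}" by (auto simp: N_def sets_restrict_space)
        have EN: "E \<in> sets N" using E by (auto simp: N_def sets_restrict_space)
        have "emeasure (distr N N f) E = emeasure N (f -` E \<inter> space N)" using EN fN by (rule emeasure_distr[rotated])
        also have "\<dots> = emeasure \<nu> (f -` E \<inter> {0..1})"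
          using measurable_sets[OF fN EN] by (simp add: N_def emeasure_restrict_space space_restrict_space sets_restrict_space)
        also have "\<dots> = emeasure \<nu> (f' -` E)"
        proof (rule emeasure_eq_AE)
          show "AE z in \<nu>. (z \<in> f -` E \<inter> {0..1}) = (z \<in> f' -` E)"
            using unit by eventually_elim (auto simp: f'_def)
          show "f' -` E \<in> sets \<nu>" using measurable_sets[OF f'm E(1)] by simp
          show "f -` E \<inter> {0..1} \<in> sets \<nu>" using measurable_sets[OF fN EN] by (auto simp: N_def space_restrict_space sets_restrict_space)
        qed
        also have "\<dots> = emeasure (distr \<nu> borel f') E"
          using f'm E by (subst emeasure_distr) auto
        also have "\<dots> = emeasure N E" using E unfolding inv by (simp add: N_def emeasure_restrict_space)
        finally show "emeasure (distr N N f) E = emeasure N E" .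
      qed simp
    qed
    then have NM: "N = M" by (rule uniq)
    show "\<nu> = M'"
    proof (rule measure_eqI)
      show "sets \<nu> = sets M'" by (simp add: M'_def)
      fix E assume E: "E \<in> sets \<nu>"
      have "emeasure M' E = emeasure M (E \<inter> {0..1})"
        unfolding M'_def using E idM by (subst emeasure_distr) (auto simp: spM)
      also have "\<dots> = emeasure \<nu> (E \<inter> {0..1})"
        using E by (simp add: NM[symmetric] N_def emeasure_restrict_space)
      also have "\<dots> = emeasure \<nu> E"
        by (rule emeasure_eq_AE) (use unit E in auto)
      finally show "emeasure \<nu> E = emeasure M' E" by simp
    qed
  qed
  \<comment> \<open>A tight sequence all of whose convergent subsequences have the same limit converges.\<close>
  have wc: "weak_conv_m (empirical y) M'"
    by (rule tight_subseq_weak_converge[OF real_distribution_empirical rM' tight_empirical[OF y]]) (use limit in blast)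
  show ?thesis
    unfolding typical_point_def
  proof (intro allI impI)
    fix \<phi> :: "real \<Rightarrow> real" assume \<phi>: "continuous_on {0..1} \<phi>"
    \<comment> \<open>Continuous extension of the test function to the line.\<close>
    define \<psi> where "\<psi> z = \<phi> (max 0 (min 1 z))" for z
    have \<psi>c: "isCont \<psi> z" for z
    proof -
      have "continuous_on UNIV \<psi>" unfolding \<psi>_def
        by (rule continuous_on_compose2[OF \<phi>]) (auto intro!: continuous_intros)
      then show ?thesis by (simp add: continuous_on_eq_continuous_at)
    qed
    have \<psi>m: "\<psi> \<in> borel_measurable borel" using \<psi>c by (intro borel_measurable_continuous_onI continuous_at_imp_continuous_on) auto
    have "bounded (\<phi> ` {0..1})" using compact_imp_bounded[OF compact_continuous_image[OF \<phi>]] by simp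
    then obtain Bd where Bd: "\<And>z. z \<in> {0..1} \<Longrightarrow> norm (\<phi> z) \<le> Bd"
      unfolding bounded_iff by blast
    have \<psi>b: "norm (\<psi> z) \<le> Bd" for z unfolding \<psi>_def by (rule Bd) auto
    have "(\<lambda>n. integral\<^sup>L (empirical y n) \<psi>) \<longlonglongrightarrow> integral\<^sup>L M' \<psi>"
      by (rule weak_conv_imp_integral_bdd_continuous_conv[OF real_distribution_empirical rM' wc \<psi>c \<psi>b])
    moreover have "integral\<^sup>L M' \<psi> = integral\<^sup>L M \<psi>"
      unfolding M'_def using idM \<psi>m by (subst integral_distr) auto
    moreover have "integral\<^sup>L M \<psi> = integral\<^sup>L M \<phi>"
      by (rule Bochner_Integration.integral_cong) (auto simp: spM \<psi>_def max_def min_def)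
    moreover have "integral\<^sup>L (empirical y n) \<psi> = 1 / real (Suc n) * (\<Sum>i=1..Suc n. \<phi> ((f ^^ i) x))" for n
    proof -
      have "\<psi> (y i) = \<phi> ((f ^^ i) x)" for i using y[of i] by (auto simp: \<psi>_def y_def max_def min_def)
      then show ?thesis by (simp add: integral_empirical[OF \<psi>m] del: sum.cl_ivl_Suc)
    qed
    ultimately have "(\<lambda>n. 1 / real (Suc n) * (\<Sum>i=1..Suc n. \<phi> ((f ^^ i) x))) \<longlonglongrightarrow> integral\<^sup>L M \<phi>" by simp
    then show "(\<lambda>n. 1 / real n * (\<Sum>i=1..n. \<phi> ((f ^^ i) x))) \<longlonglongrightarrow> integral\<^sup>L M \<phi>"
      by (rule LIMSEQ_imp_Suc)
  qed
qed

section \<open>The oscillation norm controls the essential supremum\<close>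

lemma osc_le:
  assumes "\<phi> \<in> borel_measurable borel"
    and "\<And>y. y \<in> {x - \<delta> <..< x + \<delta>} \<inter> {0..1} \<Longrightarrow> c \<le> \<phi> y \<and> \<phi> y \<le> d"
  shows "osc \<phi> \<delta> x \<le> ereal (d - c)"
proof -
  define S where "S = {x - \<delta> <..< x + \<delta>} \<inter> {0..1::real}"
  define M where "M = restrict_space lborel S"
  have m: "(\<lambda>y. ereal (\<phi> y)) \<in> borel_measurable M" "(\<lambda>y. - ereal (\<phi> y)) \<in> borel_measurable M"
    unfolding M_def using assms(1) by (auto intro!: measurable_restrict_space1)
  have sp: "space M = S" by (simp add: M_def space_restrict_space)
  have 1: "esssup M (\<lambda>y. ereal (\<phi> y)) \<le> ereal d"
    by (rule esssup_I[OF m(1)]) (use assms(2) in \<open>auto simp: sp S_def intro!: AE_I2\<close>)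
  have "esssup M (\<lambda>y. - ereal (\<phi> y)) \<le> ereal (- c)"
    by (rule esssup_I[OF m(2)]) (use assms(2) in \<open>auto simp: sp S_def intro!: AE_I2\<close>)
  then have 2: "- essinf M (\<lambda>y. ereal (\<phi> y)) \<le> ereal (- c)" unfolding essinf_def by simp
  have "osc \<phi> \<delta> x = esssup M (\<lambda>y. ereal (\<phi> y)) + (- essinf M (\<lambda>y. ereal (\<phi> y)))"
    unfolding osc_def Let_def M_def S_def minus_ereal_def ..
  also have "\<dots> \<le> ereal d + ereal (- c)" by (rule add_mono[OF 1 2])
  finally show ?thesis by simp
qed

text \<open>On a window around \<open>x\<close> that contains \<open>J\<close>, the essential infimum is at most the mean over \<open>J\<close>, and the essential supremum is at least that over \<open>J\<close>.\<close>

lemma osc_ge_on_subinterval: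
  assumes m: "\<psi> \<in> borel_measurable borel" and nn: "\<And>y. 0 \<le> \<psi> y"
    and J: "J \<in> sets borel" "J \<subseteq> {x - \<delta> <..< x + \<delta>} \<inter> {0..1}" "measure lborel J > 0"
    and N: "\<integral>\<^sup>+y. ennreal (\<psi> y) * indicator J y \<partial>lborel \<le> ennreal (N * measure lborel J)" and N0: "N \<ge> 0"
  shows "esssup (restrict_space lborel J) (\<lambda>y. ereal (\<psi> y)) - ereal N \<le> osc \<psi> \<delta> x"
proof -
  define S where "S = {x - \<delta> <..< x + \<delta>} \<inter> {0..1::real}"
  define M where "M = restrict_space lborel S"
  define MJ where "MJ = restrict_space lborel J"
  have SS: "S \<in> sets borel" unfolding S_def by simp
  have m1: "(\<lambda>y. ereal (\<psi> y)) \<in> borel_measurable M" "(\<lambda>y. - ereal (\<psi> y)) \<in> borel_measurable M"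
    unfolding M_def using m by (auto intro!: measurable_restrict_space1)
  have m2: "(\<lambda>y. ereal (\<psi> y)) \<in> borel_measurable MJ" 
    unfolding MJ_def using m by (auto intro!: measurable_restrict_space1)
  have AEJ: "AE y in lborel. y \<in> J \<longrightarrow> P y" if "AE y in M. P y" for P
  proof -
    have "AE y in lborel. y \<in> S \<longrightarrow> P y" using that SS unfolding M_def by (subst (asm) AE_restrict_space_iff) auto
    then show ?thesis by eventually_elim (use J in \<open>auto simp: S_def\<close>)
  qed
  have 1: "esssup MJ (\<lambda>y. ereal (\<psi> y)) \<le> esssup M (\<lambda>y. ereal (\<psi> y))"
  proof (rule esssup_I[OF m2])
    show "AE y in MJ. ereal (\<psi> y) \<le> esssup M (\<lambda>y. ereal (\<psi> y))"
      unfolding MJ_def using AEJ[OF esssup_AE] J(1) by (subst AE_restrict_space_iff) auto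
  qed
  define e2 where "e2 = essinf M (\<lambda>y. ereal (\<psi> y))"
  have ae2: "AE y in lborel. y \<in> J \<longrightarrow> e2 \<le> ereal (\<psi> y)"
    using AEJ[OF esssup_AE[of "\<lambda>y. - ereal (\<psi> y)" M]]
    by eventually_elim (simp add: e2_def essinf_def ereal_uminus_le_reorder)
  have "e2 \<ge> 0"
  proof -
    have "esssup M (\<lambda>y. - ereal (\<psi> y)) \<le> 0"
      by (rule esssup_I[OF m1(2)]) (use nn in auto)
    then show ?thesis by (simp add: e2_def essinf_def ereal_uminus_le_reorder[of _ 0])
  qed
  have fin: "emeasure lborel J = ennreal (measure lborel J)"
    using emeasure_lborel_finite[of J 0 1] J(2) by (simp add: emeasure_eq_ennreal_measure)
  have e2N: "e2 \<le> ereal N"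
  proof (rule ccontr)
    assume "\<not> e2 \<le> ereal N"
    then have "ereal N < e2" by simp
    then obtain s where s: "ereal N < ereal s" "ereal s < e2" using ereal_dense2[of "ereal N" e2] by blast
    have "ennreal (s * measure lborel J) = (\<integral>\<^sup>+y. ennreal s * indicator J y \<partial>lborel)"
      using J(1) s N0 fin by (subst nn_integral_cmult_indicator) (auto simp: ennreal_mult)
    also have "\<dots> \<le> (\<integral>\<^sup>+y. ennreal (\<psi> y) * indicator J y \<partial>lborel)"
    proof (rule nn_integral_mono_AE)
      show "AE y in lborel. ennreal s * indicator J y \<le> ennreal (\<psi> y) * indicator J y"
        using ae2
      proof eventually_elim
        case (elim y)
        then show ?case using s(2) by (cases "y \<in> J") (auto intro!: ennreal_leI dest: order.strict_trans2)
      qed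
    qed
    also have "\<dots> \<le> ennreal (N * measure lborel J)" by (rule N)
    finally have "s * measure lborel J \<le> N * measure lborel J" using N0 by (subst (asm) ennreal_le_iff) auto
    then show False using s J(3) by simp
  qed
  have "osc \<psi> \<delta> x = esssup M (\<lambda>y. ereal (\<psi> y)) - e2"
    unfolding osc_def Let_def M_def S_def e2_def ..
  also have "\<dots> \<ge> esssup MJ (\<lambda>y. ereal (\<psi> y)) - ereal N" by (rule ereal_minus_mono[OF 1 e2N])
  finally show ?thesis unfolding MJ_def .
qed

text \<open>Cut the unit interval into \<open>n\<close> pieces of length \<open>\<delta> = 1 / n \<le> A\<close>. For \<open>x\<close> in a piece, the window
  \<open>(x - \<delta>, x + \<delta>)\<close> contains this piece, so the oscillation at \<open>x\<close> is at least the essential supremum over the piece minus the mean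
  over it. The mean is at most \<open>n * R\<close>. Integrating over the piece, the seminorm at scale \<open>\<delta>\<close> bounds the
  difference by \<open>n * R\<close> as well, since \<open>\<delta> powr \<alpha> \<le> 1\<close>.\<close>

theorem AE_le_if_alpha_norm_le:
  assumes m: "\<psi> \<in> borel_measurable borel" and nn: "\<And>y. 0 \<le> \<psi> y"
    and n: "n \<ge> 1" "1 / real n \<le> A" and \<alpha>: "0 < \<alpha>" and R: "R \<ge> 0"
    and norm: "alpha_norm A \<alpha> \<psi> \<le> ennreal R"
  shows "AE x in lborel. x \<in> {0..1} \<longrightarrow> \<psi> x \<le> 2 * real n * R"
proof -
  define \<delta> where "\<delta> = 1 / real n"
  have \<delta>: "0 < \<delta>" "\<delta> \<le> A" "\<delta> \<le> 1" using n by (auto simp: \<delta>_def)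
  have semi: "alpha_seminorm A \<alpha> \<psi> \<le> ennreal R" and l1: "L1_norm \<psi> \<le> ennreal R"
    using norm unfolding alpha_norm_def by (auto intro: order_trans[rotated])
  have piece: "AE y in lborel. y \<in> {real k * \<delta> .. real (Suc k) * \<delta>} \<longrightarrow> \<psi> y \<le> 2 * real n * R" if k: "k < n" for k
  proof -
    define J where "J = {real k * \<delta> .. real (Suc k) * \<delta>}"
    have J01: "J \<subseteq> {0..1}"
    proof -
      have "real (Suc k) * \<delta> \<le> real n * \<delta>" using k \<delta> by (intro mult_right_mono) auto
      also have "\<dots> = 1" using n by (simp add: \<delta>_def)
      finally show ?thesis using \<delta> by (auto simp: J_def intro: order_trans[of 0 "real k * \<delta>"] order_trans[of _ "real (Suc k) * \<delta>"])
    qed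
    have Jm: "measure lborel J = \<delta>" using \<delta> by (simp add: J_def algebra_simps)
    have JB: "J \<in> sets borel" by (simp add: J_def)
    define S where "S = esssup (restrict_space lborel J) (\<lambda>y. ereal (\<psi> y))"
    define N where "N = real n * R"
    have N0: "N \<ge> 0" using R by (simp add: N_def)
    have NJ: "(\<integral>\<^sup>+y. ennreal (\<psi> y) * indicator J y \<partial>lborel) \<le> ennreal (N * measure lborel J)"
    proof -
      have "(\<integral>\<^sup>+y. ennreal (\<psi> y) * indicator J y \<partial>lborel) \<le> (\<integral>\<^sup>+y. ennreal (\<psi> y) * indicator {0..1} y \<partial>lborel)"
        using J01 by (intro nn_integral_mono) (auto simp: indicator_def)
      also have "\<dots> = L1_norm \<psi>"
        unfolding L1_norm_def using nn by (subst nn_integral_restrict_space) auto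
      also have "\<dots> \<le> ennreal R" by (rule l1)
      also have "R = N * measure lborel J" using n by (simp add: Jm N_def \<delta>_def)
      finally show ?thesis .
    qed
    have oscx: "S - ereal N \<le> osc \<psi> \<delta> x" if "x \<in> {real k * \<delta> <..< real (Suc k) * \<delta>}" for x
      unfolding S_def
    proof (rule osc_ge_on_subinterval[OF m nn JB _ _ NJ N0])
      show "J \<subseteq> {x - \<delta><..<x + \<delta>} \<inter> {0..1}" using that J01 by (auto simp: J_def algebra_simps)
      show "0 < measure lborel J" using Jm \<delta> by simp
    qed
    have "e2ennreal (S - ereal N) * ennreal \<delta> = (\<integral>\<^sup>+x. e2ennreal (S - ereal N) * indicator {real k * \<delta> <..< real (Suc k) * \<delta>} x \<partial>lborel)"
      using \<delta> by (subst nn_integral_cmult_indicator) (auto simp: algebra_simps)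
    also have "\<dots> \<le> (\<integral>\<^sup>+x. e2ennreal (osc \<psi> \<delta> x) * indicator {0..1} x \<partial>lborel)"
    proof (rule nn_integral_mono)
      fix x
      show "e2ennreal (S - ereal N) * indicator {real k * \<delta> <..< real (Suc k) * \<delta>} x \<le> e2ennreal (osc \<psi> \<delta> x) * indicator {0..1} x"
        using oscx[of x] J01 by (auto simp: indicator_def J_def intro!: e2ennreal_mono)
    qed
    also have "\<dots> = (\<integral>\<^sup>+x. e2ennreal (osc \<psi> \<delta> x) \<partial>unit_leb)"
      by (subst nn_integral_restrict_space) auto
    finally have I: "e2ennreal (S - ereal N) * ennreal \<delta> \<le> (\<integral>\<^sup>+x. e2ennreal (osc \<psi> \<delta> x) \<partial>unit_leb)" .
    have "ennreal (\<delta> powr (-\<alpha>)) * (e2ennreal (S - ereal N) * ennreal \<delta>) \<le> ennreal (\<delta> powr (-\<alpha>)) * (\<integral>\<^sup>+x. e2ennreal (osc \<psi> \<delta> x) \<partial>unit_leb)"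
      by (rule mult_left_mono[OF I]) simp
    also have "\<dots> \<le> alpha_seminorm A \<alpha> \<psi>"
      unfolding alpha_seminorm_def using \<delta> by (intro SUP_upper) auto
    also have "\<dots> \<le> ennreal R" by (rule semi)
    finally have *: "ennreal (\<delta> powr (-\<alpha>)) * (e2ennreal (S - ereal N) * ennreal \<delta>) \<le> ennreal R" .
    have "ennreal 1 \<le> ennreal (\<delta> powr (-\<alpha>))"
      using \<delta> \<alpha> by (intro ennreal_leI) (simp add: powr_minus one_le_inverse powr_le1)
    then have "ennreal 1 * (e2ennreal (S - ereal N) * ennreal \<delta>) \<le> ennreal (\<delta> powr (-\<alpha>)) * (e2ennreal (S - ereal N) * ennreal \<delta>)"
      by (rule mult_right_mono) simp
    with * have **: "e2ennreal (S - ereal N) * ennreal \<delta> \<le> ennreal R" by simp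
    have "e2ennreal (S - ereal N) = e2ennreal (S - ereal N) * ennreal \<delta> * ennreal (real n)"
    proof -
      have "ennreal \<delta> * ennreal (real n) = 1" using n by (simp add: \<delta>_def flip: ennreal_mult)
      then show ?thesis by (simp add: mult.assoc)
    qed
    also have "\<dots> \<le> ennreal R * ennreal (real n)" by (rule mult_right_mono[OF **]) simp
    also have "\<dots> = ennreal N" using R by (simp add: N_def flip: ennreal_mult)
    finally have e: "e2ennreal (S - ereal N) \<le> ennreal N" .
    have "S - ereal N \<le> max 0 (S - ereal N)" by simp
    also have "\<dots> = enn2ereal (e2ennreal (S - ereal N))"
      by (metis e2ennreal_neg enn2ereal_e2ennreal max.absorb1 max.absorb2 nle_le zero_ennreal.rep_eq)
    also have "\<dots> \<le> enn2ereal (ennreal N)" using e by (simp add: less_eq_ennreal.rep_eq)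
    also have "\<dots> = ereal N" using N0 by simp
    finally have "S \<le> ereal N + ereal N" by (subst (asm) ereal_minus_le_iff) auto
    then have S: "S \<le> ereal (2 * real n * R)" by (simp add: N_def mult_ac)
    have "AE y in restrict_space lborel J. ereal (\<psi> y) \<le> S" unfolding S_def by (rule esssup_AE)
    then have "AE y in lborel. y \<in> J \<longrightarrow> ereal (\<psi> y) \<le> S"
      using JB by (subst (asm) AE_restrict_space_iff) auto
    then show ?thesis unfolding J_def[symmetric]
      by eventually_elim (use S in \<open>auto dest: order_trans\<close>)
  qed
  have "AE y in lborel. \<forall>k\<in>{..<n}. y \<in> {real k * \<delta> .. real (Suc k) * \<delta>} \<longrightarrow> \<psi> y \<le> 2 * real n * R"
    by (rule AE_finite_allI) (use piece in auto)
  then have "AE y in lborel. (y \<in> {0..1} \<longrightarrow> \<psi> y \<le> 2 * real n * R)"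
  proof (rule AE_mp, intro AE_I2 impI)
    fix y assume *: "\<forall>k\<in>{..<n}. y \<in> {real k * \<delta> .. real (Suc k) * \<delta>} \<longrightarrow> \<psi> y \<le> 2 * real n * R" and y: "y \<in> {0..1}"
    define k where "k = min (nat \<lfloor>y * real n\<rfloor>) (n - 1)"
    have kn: "k < n" using n by (auto simp: k_def)
    have "real k \<le> y * real n"
    proof -
      have "real k \<le> real (nat \<lfloor>y * real n\<rfloor>)" by (simp add: k_def)
      also have "\<dots> \<le> y * real n" using y by simp
      finally show ?thesis .
    qed
    moreover have "y * real n \<le> real (Suc k)"
    proof (cases "nat \<lfloor>y * real n\<rfloor> \<le> n - 1")
      case True
      then have "k = nat \<lfloor>y * real n\<rfloor>" by (simp add: k_def)
      then show ?thesis using y by (simp add: of_nat_nat) linarith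
    next
      case False
      then have "k = n - 1" by (simp add: k_def)
      then have "real (Suc k) = real n" using n by simp
      then show ?thesis using y by (simp add: mult_left_le_one_le)
    qed
    ultimately have "y \<in> {real k * \<delta> .. real (Suc k) * \<delta>}" using n by (auto simp: \<delta>_def field_simps)
    then show "\<psi> y \<le> 2 * real n * R" using * kn by blast
  qed
  then show ?thesis .
qed

text \<open>The oscillation of the indicator vanishes except within \<open>\<delta>\<close> of the two end points, a set of measure at most \<open>4 * \<delta>\<close>.\<close>

lemma alpha_norm_indicator_interval:
  assumes W: "is_interval W" "W \<in> sets borel" "W \<subseteq> {0..1::real}" and A: "0 < A" "0 < \<alpha>" "\<alpha> \<le> 1"
  shows "alpha_norm A \<alpha> (indicator W) \<le> ennreal (4 * A powr (1 - \<alpha>) + 1)"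
    "L1_norm (indicator W) = ennreal (measure lborel W)" "indicator W \<in> V_space A \<alpha>"
proof -
  have fin: "emeasure lborel W = ennreal (measure lborel W)"
    using emeasure_lborel_finite[OF W(3)] by (simp add: emeasure_eq_ennreal_measure)
  have ind: "ennreal \<bar>indicator W x\<bar> * indicator {0..1} x = indicator W x" for x
    using W(3) by (auto simp: indicator_def subset_iff)
  have "L1_norm (indicator W) = (\<integral>\<^sup>+x. ennreal \<bar>indicator W x\<bar> * indicator {0..1} x \<partial>lborel)"
    unfolding L1_norm_def by (rule nn_integral_restrict_space) simp
  also have "\<dots> = (\<integral>\<^sup>+x. indicator W x \<partial>lborel)" by (rule nn_integral_cong) (rule ind)
  finally have "L1_norm (indicator W) = (\<integral>\<^sup>+x. indicator W x \<partial>lborel)" .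
  then show l1: "L1_norm (indicator W) = ennreal (measure lborel W)" using W fin by simp
  have "measure lborel W \<le> measure lborel {0..1::real}"
    using W emeasure_lborel_finite[of "{0..1::real}"] by (intro measure_mono_fmeasurable) (auto simp: fmeasurable_def)
  then have W1: "measure lborel W \<le> 1" by simp
  define u v where "u = Inf W" and "v = Sup W"
  have bb: "bdd_below W" "bdd_above W" using W(3) by (auto intro: bdd_below_mono bdd_above_mono)
  have inside: "x \<in> W" if "W \<noteq> {}" "u < x" "x < v" for x
  proof -
    have "\<exists>y\<in>W. y < x" using that bb by (simp add: u_def cInf_less_iff)
    moreover have "\<exists>z\<in>W. x < z" using that bb by (simp add: v_def less_cSup_iff)
    ultimately show ?thesis using W(1) unfolding is_interval_1 by (meson less_imp_le)
  qed
  have outside: "u \<le> x \<and> x \<le> v" if "x \<in> W" for x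
    using that bb unfolding u_def v_def by (auto intro: cInf_lower cSup_upper)
  have m: "(indicator W :: real \<Rightarrow> real) \<in> borel_measurable borel" using W by measurable
  have osc: "osc (indicator W) \<delta> x \<le> ereal (indicator ({u-\<delta>..u+\<delta>} \<union> {v-\<delta>..v+\<delta>}) x)" if \<delta>: "\<delta> > 0" for \<delta> x
  proof (cases "x \<in> {u-\<delta>..u+\<delta>} \<union> {v-\<delta>..v+\<delta>}")
    case True
    have "osc (indicator W) \<delta> x \<le> ereal (1 - 0)" by (rule osc_le[OF m]) auto
    then show ?thesis using True by simp
  next
    case False
    consider "W = {}" | "W \<noteq> {}" "u + \<delta> < x" "x < v - \<delta>" | "W \<noteq> {}" "x < u - \<delta> \<or> v + \<delta> < x"
      using False \<delta> by force
    then have "\<exists>c. \<forall>y\<in>{x - \<delta> <..< x + \<delta>} \<inter> {0..1}. indicator W y = (c::real)"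
    proof cases
      case 1 then show ?thesis by (intro exI[of _ 0]) auto
    next
      case 2 then show ?thesis using inside by (intro exI[of _ 1]) (auto simp: indicator_def)
    next
      case 3
      then show ?thesis using outside \<delta> by (intro exI[of _ 0]) (force simp: indicator_def)
    qed
    then obtain c where c: "\<forall>y\<in>{x - \<delta> <..< x + \<delta>} \<inter> {0..1}. indicator W y = (c::real)" ..
    have "osc (indicator W) \<delta> x \<le> ereal (c - c)" by (rule osc_le[OF m]) (use c in auto)
    then show ?thesis using False by simp
  qed
  have "alpha_seminorm A \<alpha> (indicator W) \<le> ennreal (4 * A powr (1 - \<alpha>))"
    unfolding alpha_seminorm_def
  proof (rule SUP_least)
    fix \<delta> assume \<delta>: "\<delta> \<in> {0<..A}"
    have "(\<integral>\<^sup>+x. e2ennreal (osc (indicator W) \<delta> x) \<partial>unit_leb)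
       = (\<integral>\<^sup>+x. e2ennreal (osc (indicator W) \<delta> x) * indicator {0..1} x \<partial>lborel)"
      by (subst nn_integral_restrict_space) auto
    also have "\<dots> \<le> (\<integral>\<^sup>+x. indicator ({u-\<delta>..u+\<delta>} \<union> {v-\<delta>..v+\<delta>}) x \<partial>lborel)"
    proof (rule nn_integral_mono)
      fix x
      have "e2ennreal (osc (indicator W) \<delta> x) \<le> e2ennreal (ereal (indicator ({u-\<delta>..u+\<delta>} \<union> {v-\<delta>..v+\<delta>}) x))"
        using osc \<delta> by (intro e2ennreal_mono) auto
      then show "e2ennreal (osc (indicator W) \<delta> x) * indicator {0..1} x \<le> indicator ({u-\<delta>..u+\<delta>} \<union> {v-\<delta>..v+\<delta>}) x"
        by (auto simp: indicator_def e2ennreal_ereal split: if_splits)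
    qed
    also have "\<dots> = emeasure lborel ({u-\<delta>..u+\<delta>} \<union> {v-\<delta>..v+\<delta>})" by simp
    also have "\<dots> \<le> emeasure lborel {u-\<delta>..u+\<delta>} + emeasure lborel {v-\<delta>..v+\<delta>}"
      by (rule emeasure_subadditive) auto
    also have "\<dots> = ennreal (4 * \<delta>)" using \<delta> by (simp flip: ennreal_plus)
    finally have "ennreal (\<delta> powr (-\<alpha>)) * (\<integral>\<^sup>+x. e2ennreal (osc (indicator W) \<delta> x) \<partial>unit_leb)
        \<le> ennreal (\<delta> powr (-\<alpha>)) * ennreal (4 * \<delta>)" by (rule mult_left_mono) simp
    also have "\<dots> = ennreal (4 * \<delta> powr (1 - \<alpha>))"
      using \<delta> powr_add[of \<delta> "-\<alpha>" 1] by (simp add: powr_one mult_ac flip: ennreal_mult)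
    also have "\<dots> \<le> ennreal (4 * A powr (1 - \<alpha>))"
      using \<delta> A by (intro ennreal_leI mult_left_mono powr_mono2) auto
    finally show "ennreal (\<delta> powr (-\<alpha>)) * (\<integral>\<^sup>+x. e2ennreal (osc (indicator W) \<delta> x) \<partial>unit_leb)
        \<le> ennreal (4 * A powr (1 - \<alpha>))" .
  qed note semi = this
  have "alpha_norm A \<alpha> (indicator W) \<le> ennreal (4 * A powr (1 - \<alpha>)) + ennreal 1"
    unfolding alpha_norm_def l1 using W1 by (intro add_mono semi ennreal_leI)
  then show "alpha_norm A \<alpha> (indicator W) \<le> ennreal (4 * A powr (1 - \<alpha>) + 1)" using A by (subst ennreal_plus) auto
  have "integrable unit_leb (indicator W :: real \<Rightarrow> real)"
    using W fin by (subst integrable_restrict_space) (auto intro!: integrable_real_indicator simp flip: indicator_inter_arith simp: Int_absorb1)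
  then show "indicator W \<in> V_space A \<alpha>"
    unfolding V_space_def using semi by (auto intro: le_less_trans)
qed

section \<open>Transfer operators and preimages of small sets\<close>

lemma set_integral_Lborel_change_of_variables:
  fixes f f' h :: "real \<Rightarrow> real"
  assumes J: "J \<in> sets borel" "f ` J \<in> sets borel"
    and der: "\<And>x. x \<in> J \<Longrightarrow> (f has_real_derivative f' x) (at x)" and inj: "inj_on f J"
    and h: "set_integrable lborel (f ` J) h"
    and hf: "set_integrable lborel J (\<lambda>x. \<bar>f' x\<bar> * h (f x))"
  shows "(LINT x:J|lborel. \<bar>f' x\<bar> * h (f x)) = (LINT x:f ` J|lborel. h x)"
proof -
  have "h absolutely_integrable_on (f ` J)"
    using h unfolding set_integrable_def by (intro integrable_completion[THEN iffD2]) auto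
  then have "integral J (\<lambda>x. \<bar>f' x\<bar> * h (f x)) = integral (f ` J) h"
    using has_absolute_integral_change_of_variables_1'[of J f f' h "integral (f ` J) h"] J der inj
    by (auto intro: has_field_derivative_at_within)
  then show ?thesis
    using set_borel_integral_eq_integral(2)[OF h] set_borel_integral_eq_integral(2)[OF hf] by simp
qed

locale piecewise_expanding_map =
  fixes f :: "real \<Rightarrow> real" and p :: nat and c :: "nat \<Rightarrow> real" and lam :: real
  assumes c0: "c 0 = 0" and cp: "c p = 1" and cmono: "\<And>k. k \<in> {1..p} \<Longrightarrow> c (k - 1) < c k"
    and into: "\<And>x. x \<in> {0..1} \<Longrightarrow> f x \<in> {0..1}"
    and f_meas: "f \<in> borel_measurable (restrict_space borel {0..1})"
    and der: "\<And>k x. k \<in> {1..p} \<Longrightarrow> x \<in> {c (k - 1)<..<c k} \<Longrightarrow> (f has_real_derivative deriv f x) (at x)"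
    and cont: "\<And>k. k \<in> {1..p} \<Longrightarrow> continuous_on {c (k - 1)<..<c k} (deriv f)"
    and expand: "\<And>k x. k \<in> {1..p} \<Longrightarrow> x \<in> {c (k - 1)<..<c k} \<Longrightarrow> lam \<le> \<bar>deriv f x\<bar>"
    and lam: "lam > 0"
begin

definition J :: "nat \<Rightarrow> real set" where "J k = {c (k - 1)<..<c k}"
abbreviation B :: "real set" where "B \<equiv> c ` {0..p}"

lemma c_mono: "i \<le> j \<Longrightarrow> j \<le> p \<Longrightarrow> c i \<le> c j"
proof (induction j rule: dec_induct)
  case (step n)
  then have "c i \<le> c n" by simp
  moreover have "c n < c (Suc n)" using cmono[of "Suc n"] step by simp
  ultimately show ?case by simp
qed simp

lemma J_unit: "k \<in> {1..p} \<Longrightarrow> J k \<subseteq> {0<..<1}"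
  using c_mono[of 0 "k - 1"] c_mono[of k p] c0 cp by (force simp: J_def)

lemma J_disjoint: "i \<in> {1..p} \<Longrightarrow> j \<in> {1..p} \<Longrightarrow> i \<noteq> j \<Longrightarrow> J i \<inter> J j = {}"
proof -
  have *: "J i \<inter> J j = {}" if "i < j" "j \<le> p" for i j
    using c_mono[of i "j - 1"] that by (force simp: J_def)
  assume "i \<in> {1..p}" "j \<in> {1..p}" "i \<noteq> j"
  then show ?thesis using *[of i j] *[of j i] by (cases i j rule: linorder_cases) auto
qed

lemma J_not_B: "k \<in> {1..p} \<Longrightarrow> x \<in> J k \<Longrightarrow> x \<notin> B"
proof
  assume k: "k \<in> {1..p}" "x \<in> J k" and "x \<in> B"
  then obtain i where i: "i \<le> p" "x = c i" by auto
  show False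
  proof (cases "i \<le> k - 1")
    case True
    have "k - 1 \<le> p" using k(1) by (simp only: atLeastAtMost_iff) linarith
    then show False using c_mono[OF True] k i by (auto simp: J_def)
  next
    case False
    then have "k \<le> i" by linarith
    then show False using c_mono[of k i] i k by (auto simp: J_def)
  qed
qed

lemma in_some_J:
  assumes "x \<in> {0..1} - B" shows "\<exists>k\<in>{1..p}. x \<in> J k"
proof -
  have "x \<noteq> c p" "x \<noteq> c 0" using assms by auto
  then have "x < c p" using assms cp by auto
  define k where "k = (LEAST k. x < c k)"
  have k: "x < c k" unfolding k_def by (rule LeastI) fact
  have kp: "k \<le> p" unfolding k_def by (rule Least_le) fact
  have k0: "k \<noteq> 0" using k c0 assms by (intro notI) auto
  then have "\<not> x < c (k - 1)" unfolding k_def using not_less_Least[of "k - 1" "\<lambda>k. x < c k"] by (simp add: k_def)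
  moreover have "x \<noteq> c (k - 1)" using assms kp by auto
  ultimately show ?thesis using k kp k0 by (intro bexI[of _ k]) (auto simp: J_def)
qed

lemma unit_minus_B: "{0..1} - B = (\<Union>k\<in>{1..p}. J k)"
proof (intro equalityI subsetI)
  fix x assume "x \<in> {0..1} - B" then show "x \<in> (\<Union>k\<in>{1..p}. J k)" using in_some_J by blast
next
  fix x assume "x \<in> (\<Union>k\<in>{1..p}. J k)"
  then obtain k where k: "k \<in> {1..p}" "x \<in> J k" by blast
  have "x \<in> {0<..<1}" using J_unit[OF k(1)] k(2) by blast
  then show "x \<in> {0..1} - B" using J_not_B[OF k] by simp
qed

lemma expand_on_J:
  assumes k: "k \<in> {1..p}" and xy: "x \<in> J k" "y \<in> J k"
  shows "lam * \<bar>x - y\<bar> \<le> \<bar>f x - f y\<bar>"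
proof -
  have *: "lam * \<bar>x - y\<bar> \<le> \<bar>f x - f y\<bar>" if "x < y" "x \<in> J k" "y \<in> J k" for x y
  proof -
    have "\<And>z. x \<le> z \<Longrightarrow> z \<le> y \<Longrightarrow> z \<in> J k" using that by (auto simp: J_def)
    then obtain z where z: "x < z" "z < y" "f y - f x = (y - x) * deriv f z"
      using MVT2[OF \<open>x < y\<close>, of f "deriv f"] der[OF k] by (auto simp: J_def)
    have "z \<in> J k" using z that by (auto simp: J_def)
    then have "lam * \<bar>x - y\<bar> \<le> \<bar>deriv f z\<bar> * \<bar>x - y\<bar>"
      using expand[OF k] by (intro mult_right_mono) (auto simp: J_def)
    also have "\<dots> = \<bar>f x - f y\<bar>" using z(3) by (metis abs_minus_commute abs_mult mult.commute)
    finally show ?thesis .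
  qed
  show ?thesis using *[of x y] *[of y x] xy by (cases x y rule: linorder_cases) (auto simp: abs_minus_commute)
qed

lemma inj_on_J: "k \<in> {1..p} \<Longrightarrow> inj_on f (J k)"
proof (rule inj_onI)
  fix x y assume "k \<in> {1..p}" "x \<in> J k" "y \<in> J k" "f x = f y"
  then have "lam * \<bar>x - y\<bar> \<le> 0" using expand_on_J[of k x y] by simp
  then show "x = y" using lam by (simp add: mult_le_0_iff)
qed

lemma cont_on_J: "k \<in> {1..p} \<Longrightarrow> continuous_on (J k) f"
  by (rule DERIV_continuous_on[of _ _ "deriv f"]) (use der in \<open>auto simp: J_def intro: has_field_derivative_at_within\<close>)

lemma open_image_J: "k \<in> {1..p} \<Longrightarrow> open (f ` J k)"
  by (rule injective_into_1d_imp_open_map_UNIV[OF _ cont_on_J inj_on_J]) (auto simp: J_def)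

lemma image_J_unit: "k \<in> {1..p} \<Longrightarrow> f ` J k \<subseteq> {0..1}"
proof
  fix y assume "k \<in> {1..p}" "y \<in> f ` J k"
  then obtain x where "x \<in> J k" "y = f x" by blast
  then show "y \<in> {0..1}" using J_unit[OF \<open>k \<in> {1..p}\<close>] into[of x] by auto
qed

text \<open>The inverse of the \<open>k\<close>-th branch, set to 0 off its image so as to be Borel on the line.\<close>

definition branch_inv :: "nat \<Rightarrow> real \<Rightarrow> real" where
  "branch_inv k x = (if x \<in> f ` J k then the_inv_into (J k) f x else 0)"

lemma branch_inv_f: "k \<in> {1..p} \<Longrightarrow> y \<in> J k \<Longrightarrow> branch_inv k (f y) = y"
  by (auto simp: branch_inv_def the_inv_into_f_f inj_on_J)

lemma branch_inv_meas [measurable]: "k \<in> {1..p} \<Longrightarrow> branch_inv k \<in> borel_measurable borel"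
proof -
  assume k: "k \<in> {1..p}"
  have "(1/lam)-lipschitz_on (f ` J k) (branch_inv k)"
  proof (rule lipschitz_onI)
    fix x y assume "x \<in> f ` J k" "y \<in> f ` J k"
    then obtain x' y' where *: "x' \<in> J k" "y' \<in> J k" "x = f x'" "y = f y'" by blast
    then show "dist (branch_inv k x) (branch_inv k y) \<le> 1 / lam * dist x y"
      using expand_on_J[OF k, of x' y'] lam branch_inv_f[OF k] by (simp add: dist_real_def field_simps)
  qed (use lam in auto)
  then have "continuous_on (f ` J k) (branch_inv k)" by (rule lipschitz_on_continuous_on)
  then have "(\<lambda>x. indicator (f ` J k) x *\<^sub>R branch_inv k x) \<in> borel_measurable borel"
    using open_image_J[OF k] by (intro borel_measurable_continuous_on_indicator) auto
  moreover have "(\<lambda>x. indicator (f ` J k) x *\<^sub>R branch_inv k x) = branch_inv k" by (auto simp: branch_inv_def indicator_def)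
  ultimately show ?thesis by simp
qed

text \<open>The value 1 off the branch keeps the function Borel and bounded away from 0.\<close>

definition branch_slope :: "nat \<Rightarrow> real \<Rightarrow> real" where
  "branch_slope k y = (if y \<in> J k then \<bar>deriv f y\<bar> else 1)"

lemma branch_slope_meas [measurable]: "k \<in> {1..p} \<Longrightarrow> branch_slope k \<in> borel_measurable borel"
proof -
  assume k: "k \<in> {1..p}"
  have JB: "J k \<in> sets borel" by (simp add: J_def)
  have "(\<lambda>x. indicator (J k) x *\<^sub>R deriv f x) \<in> borel_measurable borel"
    using cont[OF k] JB by (intro borel_measurable_continuous_on_indicator) (auto simp: J_def)
  then have "(\<lambda>x. \<bar>indicator (J k) x *\<^sub>R deriv f x\<bar> + indicator (- J k) x) \<in> borel_measurable borel"
    using JB by (intro borel_measurable_add borel_measurable_abs borel_measurable_indicator) auto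
  moreover have "(\<lambda>x. \<bar>indicator (J k) x *\<^sub>R deriv f x\<bar> + indicator (- J k) x) = branch_slope k"
    by (auto simp: branch_slope_def indicator_def)
  ultimately show ?thesis by simp
qed

lemma branch_slope_lower: "k \<in> {1..p} \<Longrightarrow> branch_slope k y \<ge> min lam 1"
  using expand by (auto simp: branch_slope_def J_def min_le_iff_disj)

abbreviation L :: "(real \<Rightarrow> real) \<Rightarrow> real \<Rightarrow> real" where "L \<equiv> transfer_op f B"

definition L_branch :: "nat \<Rightarrow> (real \<Rightarrow> real) \<Rightarrow> real \<Rightarrow> real" where
  "L_branch k \<phi> x = indicator (f ` J k) x * (\<phi> (branch_inv k x) / branch_slope k (branch_inv k x))"

text \<open>Each branch is injective, so the sum over preimages splits into one term per branch; every term is an explicit Borel function.\<close>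

lemma L_eq: "L \<phi> x = (\<Sum>k=1..p. L_branch k \<phi> x)"
proof -
  have "{y \<in> {0..1} - B. f y = x} = (\<Union>k\<in>{1..p}. {y \<in> J k. f y = x})"
    unfolding unit_minus_B by blast
  then have "L \<phi> x = (\<Sum>y\<in>(\<Union>k\<in>{1..p}. {y \<in> J k. f y = x}). \<phi> y / \<bar>deriv f y\<bar>)"
    by (simp add: transfer_op_def)
  also have fin: "finite {y \<in> J k. f y = x}" if "k \<in> {1..p}" for k
  proof (rule finite_subset[of _ "{branch_inv k x}"])
    show "{y \<in> J k. f y = x} \<subseteq> {branch_inv k x}" using branch_inv_f[OF that] by force
  qed simp
  have "(\<Sum>y\<in>(\<Union>k\<in>{1..p}. {y \<in> J k. f y = x}). \<phi> y / \<bar>deriv f y\<bar>)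
     = (\<Sum>k=1..p. \<Sum>y\<in>{y \<in> J k. f y = x}. \<phi> y / \<bar>deriv f y\<bar>)"
  proof (rule sum.UNION_disjoint)
    show "\<forall>i\<in>{1..p}. \<forall>j\<in>{1..p}. i \<noteq> j \<longrightarrow> {y \<in> J i. f y = x} \<inter> {y \<in> J j. f y = x} = {}"
      using J_disjoint by blast
  qed (use fin in auto)
  also have "\<dots> = (\<Sum>k=1..p. L_branch k \<phi> x)"
  proof (rule sum.cong)
    fix k assume k: "k \<in> {1..p}"
    show "(\<Sum>y\<in>{y \<in> J k. f y = x}. \<phi> y / \<bar>deriv f y\<bar>) = L_branch k \<phi> x"
    proof (cases "x \<in> f ` J k")
      case True
      then obtain y where y: "y \<in> J k" "x = f y" by blast
      have "{y \<in> J k. f y = x} = {y}" using y inj_onD[OF inj_on_J[OF k]] by auto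
      then show ?thesis using y branch_inv_f[OF k y(1)] by (simp add: L_branch_def branch_slope_def)
    next
      case False
      then have "{y \<in> J k. f y = x} = {}" by auto
      then show ?thesis using False by (simp only: sum.empty) (simp add: L_branch_def)
    qed
  qed simp
  finally show ?thesis .
qed

lemma L_branch_meas [measurable]: "k \<in> {1..p} \<Longrightarrow> \<phi> \<in> borel_measurable borel \<Longrightarrow> L_branch k \<phi> \<in> borel_measurable borel"
  unfolding L_branch_def using open_image_J[of k] by (intro borel_measurable_times borel_measurable_divide) (auto intro: measurable_compose[OF branch_inv_meas])

lemma L_meas: "\<phi> \<in> borel_measurable borel \<Longrightarrow> L \<phi> \<in> borel_measurable borel"
  unfolding L_eq[abs_def] by (intro borel_measurable_sum) auto

lemma L_nonneg: "(\<And>y. 0 \<le> \<phi> y) \<Longrightarrow> 0 \<le> L \<phi> x"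
  unfolding transfer_op_def by (intro sum_nonneg) auto

lemma L_branch_bound: "k \<in> {1..p} \<Longrightarrow> (\<And>y. \<bar>\<phi> y\<bar> \<le> b) \<Longrightarrow> \<bar>L_branch k \<phi> x\<bar> \<le> b / min lam 1"
proof -
  assume k: "k \<in> {1..p}" and b: "\<And>y. \<bar>\<phi> y\<bar> \<le> b"
  have "0 \<le> b" using b[of 0] by linarith
  have "\<bar>\<phi> (branch_inv k x) / branch_slope k (branch_inv k x)\<bar> = \<bar>\<phi> (branch_inv k x)\<bar> / branch_slope k (branch_inv k x)"
    using branch_slope_lower[OF k, of "branch_inv k x"] lam by (simp add: abs_divide)
  also have "\<dots> \<le> b / min lam 1"
    using branch_slope_lower[OF k, of "branch_inv k x"] lam b \<open>0 \<le> b\<close> by (intro frac_le) auto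
  finally show ?thesis using \<open>0 \<le> b\<close> lam unfolding L_branch_def by (auto simp: indicator_def abs_mult)
qed

lemma L_bound: "(\<And>y. \<bar>\<phi> y\<bar> \<le> b) \<Longrightarrow> \<bar>L \<phi> x\<bar> \<le> real p * (b / min lam 1)"
  unfolding L_eq using sum_norm_bound[of "{1..p}" "\<lambda>k. L_branch k \<phi> x" "b / min lam 1"] L_branch_bound[of _ \<phi> b x] by simp

text \<open>Its iterates are Borel on the line and agree with those of \<open>f\<close> on the unit interval.\<close>

definition f_unit :: "real \<Rightarrow> real" where "f_unit x = (if x \<in> {0..1} then f x else 0)"

lemma f_unit_meas [measurable]: "f_unit \<in> borel_measurable borel"
  unfolding f_unit_def[abs_def] using f_meas by (subst measurable_If_restrict_space_iff) (auto simp: atLeastAtMost_def atLeast_def atMost_def Int_def)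

lemma f_unit_iter: "x \<in> {0..1} \<Longrightarrow> (f_unit ^^ n) x = (f ^^ n) x \<and> (f ^^ n) x \<in> {0..1}"
proof (induction n)
  case (Suc n)
  then have "(f_unit ^^ n) x = (f ^^ n) x" "(f ^^ n) x \<in> {0..1}" by auto
  then show ?case using into f_unit_def[of "(f ^^ n) x"] by simp
qed simp

lemma f_unit_iter_meas [measurable]: "(f_unit ^^ n) \<in> borel_measurable borel"
  by (induction n) (auto intro: measurable_compose[OF _ f_unit_meas] simp: id_def o_def)

text \<open>Change of variables on each branch; the partition points are a null set.\<close>

lemma duality_step:
  assumes g: "g \<in> borel_measurable borel" "\<And>y. \<bar>g y\<bar> \<le> 1"
    and \<phi>: "\<phi> \<in> borel_measurable borel" "\<And>y. \<bar>\<phi> y\<bar> \<le> b"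
  shows "(LINT y:{0..1}|lborel. g (f_unit y) * \<phi> y) = (LINT x:{0..1}|lborel. g x * L \<phi> x)"
proof -
  have gb: "\<bar>g y * \<phi> z\<bar> \<le> b" for y z
    using mult_mono[OF g(2)[of y] \<phi>(2)[of z]] by (simp add: abs_mult)
  have gLb: "\<bar>g x * L_branch k \<phi> x\<bar> \<le> b / min lam 1" if "k \<in> {1..p}" for k x
  proof -
    have "\<bar>L_branch k \<phi> x\<bar> \<le> b / min lam 1" by (rule L_branch_bound[OF that \<phi>(2)])
    then show ?thesis using mult_mono[OF g(2)[of x]] by (force simp: abs_mult)
  qed
  have gFm: "(\<lambda>y. g (f_unit y)) \<in> borel_measurable borel" by (rule measurable_compose[OF f_unit_meas g(1)])
  have piece: "(LINT y:J k|lborel. g (f_unit y) * \<phi> y) = (LINT x:{0..1}|lborel. g x * L_branch k \<phi> x)" if k: "k \<in> {1..p}" for k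
  proof -
    have JB: "J k \<in> sets borel" "f ` J k \<in> sets borel" using open_image_J[OF k] by (auto simp: J_def)
    have J01: "J k \<subseteq> {0..1}" using J_unit[OF k] by auto
    have eq: "\<bar>deriv f y\<bar> * (g (f y) * L_branch k \<phi> (f y)) = g (f_unit y) * \<phi> y" if y: "y \<in> J k" for y
      using y branch_inv_f[OF k y] expand[OF k, of y] lam J01 by (auto simp: L_branch_def branch_slope_def f_unit_def J_def)
    have i1: "set_integrable lborel (f ` J k) (\<lambda>x. g x * L_branch k \<phi> x)"
      by (rule set_integrable_bounded[OF _ gLb[OF k] JB(2) image_J_unit[OF k]]) (use k \<phi> g in auto)
    have i2: "set_integrable lborel (J k) (\<lambda>y. g (f_unit y) * \<phi> y)"
      by (rule set_integrable_bounded[OF _ gb JB(1) J01]) (use gFm \<phi> in auto)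
    have i3: "set_integrable lborel (J k) (\<lambda>y. \<bar>deriv f y\<bar> * (g (f y) * L_branch k \<phi> (f y)))"
      using i2 by (subst set_integrable_cong[OF refl refl]) (auto simp: eq)
    have "(LINT y:J k|lborel. g (f_unit y) * \<phi> y) = (LINT y:J k|lborel. \<bar>deriv f y\<bar> * (g (f y) * L_branch k \<phi> (f y)))"
      by (rule set_lebesgue_integral_cong) (use JB eq in auto)
    also have "\<dots> = (LINT x:f ` J k|lborel. g x * L_branch k \<phi> x)"
      by (rule set_integral_Lborel_change_of_variables[OF JB _ inj_on_J[OF k] i1 i3]) (use der[OF k] in \<open>auto simp: J_def\<close>)
    also have "\<dots> = (LINT x:{0..1}|lborel. g x * L_branch k \<phi> x)"
      unfolding set_lebesgue_integral_def
      by (rule Bochner_Integration.integral_cong) (use image_J_unit[OF k] in \<open>auto simp: L_branch_def indicator_def\<close>)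
    finally show ?thesis .
  qed
  have "B \<in> null_sets lborel" by (intro countable_imp_null_set_lborel countable_finite) auto
  then have ae: "AE y in lborel. y \<notin> B" by (rule AE_not_in)
  have JB: "J k \<in> sets borel" for k by (simp add: J_def)
  have "(LINT y:{0..1}|lborel. g (f_unit y) * \<phi> y) = (LINT y:(\<Union>k\<in>{1..p}. J k)|lborel. g (f_unit y) * \<phi> y)"
    unfolding set_lebesgue_integral_def
  proof (rule integral_cong_AE)
    show "AE y in lborel. indicator {0..1} y *\<^sub>R (g (f_unit y) * \<phi> y) = indicator (\<Union>k\<in>{1..p}. J k) y *\<^sub>R (g (f_unit y) * \<phi> y)"
      using ae
    proof eventually_elim
      fix y assume "y \<notin> B"
      then have "y \<in> {0..1} \<longleftrightarrow> y \<in> (\<Union>k\<in>{1..p}. J k)" using unit_minus_B by blast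
      then show "indicator {0..1} y *\<^sub>R (g (f_unit y) * \<phi> y) = indicator (\<Union>k\<in>{1..p}. J k) y *\<^sub>R (g (f_unit y) * \<phi> y)"
        by (simp only: indicator_def)
    qed
  qed (use borel_measurable_times[OF gFm \<phi>(1)] JB in \<open>auto intro!: borel_measurable_scaleR borel_measurable_indicator\<close>)
  also have "\<dots> = (\<Sum>k\<in>{1..p}. LINT y:J k|lborel. g (f_unit y) * \<phi> y)"
  proof (rule set_integral_finite_Union)
    show "disjoint_family_on J {1..p}" using J_disjoint by (auto simp: disjoint_family_on_def)
    show "set_integrable lborel (J k) (\<lambda>y. g (f_unit y) * \<phi> y)" if "k \<in> {1..p}" for k
    proof (rule set_integrable_bounded[where b=b and l=0 and r=1])
      show "J k \<subseteq> {0..1}" using J_unit[OF that] by auto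
    qed (use gb JB gFm \<phi> in auto)
  qed (use JB in auto)
  also have "\<dots> = (\<Sum>k\<in>{1..p}. LINT x:{0..1}|lborel. g x * L_branch k \<phi> x)" by (intro sum.cong piece) auto
  also have "\<dots> = (LINT x:{0..1}|lborel. \<Sum>k\<in>{1..p}. g x * L_branch k \<phi> x)"
  proof -
    have "set_integrable lborel {0..1} (\<lambda>x. g x * L_branch k \<phi> x)" if "k \<in> {1..p}" for k
      by (rule set_integrable_bounded[where b="b / min lam 1" and l=0 and r=1]) (use gLb[OF that] that g \<phi> in auto)
    then show ?thesis
      unfolding set_integrable_def set_lebesgue_integral_def scaleR_sum_right
      by (subst Bochner_Integration.integral_sum) auto
  qed
  also have "\<dots> = (LINT x:{0..1}|lborel. g x * L \<phi> x)" by (simp add: L_eq sum_distrib_left)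
  finally show ?thesis .
qed

lemma L_iter:
  assumes "\<phi> \<in> borel_measurable borel" "\<And>y. 0 \<le> \<phi> y" "\<And>y. \<bar>\<phi> y\<bar> \<le> b"
  shows "(L ^^ n) \<phi> \<in> borel_measurable borel \<and> (\<forall>y. 0 \<le> (L ^^ n) \<phi> y) \<and> (\<exists>b. \<forall>y. \<bar>(L ^^ n) \<phi> y\<bar> \<le> b)"
proof (induction n)
  case 0
  then show ?case using assms by auto
next
  case (Suc n)
  then obtain b where "\<forall>y. \<bar>(L ^^ n) \<phi> y\<bar> \<le> b" by blast
  then have "\<exists>b. \<forall>y. \<bar>L ((L ^^ n) \<phi>) y\<bar> \<le> b" using L_bound by blast
  then show ?case using Suc L_meas L_nonneg by simp
qed

lemma duality:
  assumes "g \<in> borel_measurable borel" "\<And>y. \<bar>g y\<bar> \<le> 1"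
    and "\<phi> \<in> borel_measurable borel" "\<And>y. 0 \<le> \<phi> y" "\<And>y. \<bar>\<phi> y\<bar> \<le> b"
  shows "(LINT y:{0..1}|lborel. g ((f_unit ^^ n) y) * \<phi> y) = (LINT x:{0..1}|lborel. g x * (L ^^ n) \<phi> x)"
  using assms
proof (induction n arbitrary: \<phi> b)
  case (Suc n)
  have "(LINT y:{0..1}|lborel. g ((f_unit ^^ n) (f_unit y)) * \<phi> y) = (LINT x:{0..1}|lborel. g ((f_unit ^^ n) x) * L \<phi> x)"
    by (rule duality_step[of "\<lambda>y. g ((f_unit ^^ n) y)", OF _ _ Suc.prems(3,5)])
       (use Suc.prems(1,2) in \<open>auto intro: measurable_compose[OF f_unit_iter_meas]\<close>)
  also have "\<dots> = (LINT x:{0..1}|lborel. g x * (L ^^ n) (L \<phi>) x)"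
    by (rule Suc.IH[OF Suc.prems(1,2) L_meas L_nonneg L_bound]) (use Suc.prems in auto)
  finally show ?case by (simp add: funpow_Suc_right del: funpow.simps)
qed simp

text \<open>By duality the measure of the points of \<open>W\<close> that reach \<open>E\<close> is the integral of \<open>(L ^^ n) (indicator W)\<close> over \<open>E\<close>. The
  oscillation norm of this density is at most \<open>C * \<rho> ^ n * K + C * \<bar>W\<bar>\<close>, where \<open>K\<close> bounds the norm of the indicator
  of any interval, and it dominates the essential supremum.\<close>

theorem preimage_measure_bound:
  assumes A: "0 < A" "0 < \<alpha>" "\<alpha> \<le> 1" and m: "m \<ge> 1" "1 / real m \<le> A" and C: "C \<ge> 0" and \<rho>: "0 < \<rho>"
    and LY: "\<And>\<phi> n. \<phi> \<in> V_space A \<alpha> \<Longrightarrow> n \<ge> 1 \<Longrightarrow>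
           alpha_norm A \<alpha> ((L ^^ n) \<phi>) \<le> ennreal (C * \<rho> ^ n) * alpha_norm A \<alpha> \<phi> + ennreal C * L1_norm \<phi>"
    and W: "is_interval W" "W \<in> sets borel" "W \<subseteq> {0..1}" and E: "E \<in> sets borel" "E \<subseteq> {0..1}"
  shows "{y\<in>W. (f ^^ n) y \<in> E} \<in> sets borel"
    "measure lborel {y\<in>W. (f ^^ n) y \<in> E}
      \<le> (2 * real m * C * (4 * A powr (1 - \<alpha>) + 1) + 1) * (\<rho> ^ n + measure lborel W) * measure lborel E"
proof -
  define K where "K = 4 * A powr (1 - \<alpha>) + 1"
  have K: "K \<ge> 1" by (simp add: K_def)
  have set_eq: "{y\<in>W. (f ^^ n) y \<in> E} = (f_unit ^^ n) -` E \<inter> W" using f_unit_iter W(3) by auto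
  show meas: "{y\<in>W. (f ^^ n) y \<in> E} \<in> sets borel"
    unfolding set_eq using measurable_sets[OF f_unit_iter_meas E(1)] W(2) by auto
  have Efin: "emeasure lborel E < \<infinity>" using E(2) by (rule emeasure_lborel_finite)
  show "measure lborel {y\<in>W. (f ^^ n) y \<in> E} \<le> (2 * real m * C * (4 * A powr (1 - \<alpha>) + 1) + 1) * (\<rho> ^ n + measure lborel W) * measure lborel E"
    unfolding K_def[symmetric]
  proof (cases "n = 0")
    case True
    have "measure lborel {y\<in>W. (f ^^ n) y \<in> E} \<le> measure lborel E"
      using meas E Efin True by (intro measure_mono_fmeasurable) (auto simp: fmeasurable_def)
    also have "\<dots> \<le> ((2 * real m * C * K + 1) * (\<rho> ^ n + measure lborel W)) * measure lborel E"
    proof -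
      have "1 * 1 \<le> (2 * real m * C * K + 1) * (\<rho> ^ n + measure lborel W)"
        using K C True by (intro mult_mono) auto
      then show ?thesis using mult_right_mono[of 1 _ "measure lborel E"] by fastforce
    qed
    finally show "measure lborel {y\<in>W. (f ^^ n) y \<in> E} \<le> (2 * real m * C * K + 1) * (\<rho> ^ n + measure lborel W) * measure lborel E" .
  next
    case False
    let ?\<phi> = "indicator W :: real \<Rightarrow> real"
    let ?\<psi> = "(L ^^ n) ?\<phi>"
    note I = alpha_norm_indicator_interval[OF W A]
    have it: "?\<psi> \<in> borel_measurable borel \<and> (\<forall>y. 0 \<le> ?\<psi> y) \<and> (\<exists>b. \<forall>y. \<bar>?\<psi> y\<bar> \<le> b)"
      by (rule L_iter[where b=1]) (use W in \<open>auto simp: indicator_def\<close>)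
    then have \<psi>: "?\<psi> \<in> borel_measurable borel" "\<And>y. 0 \<le> ?\<psi> y" by blast+
    obtain b where b: "\<And>y. \<bar>?\<psi> y\<bar> \<le> b" using it by blast
    define R where "R = C * \<rho> ^ n * K + C * measure lborel W"
    have R: "R \<ge> 0" using C \<rho> K by (simp add: R_def)
    have "alpha_norm A \<alpha> ?\<psi> \<le> ennreal (C * \<rho> ^ n) * alpha_norm A \<alpha> ?\<phi> + ennreal C * L1_norm ?\<phi>"
      by (rule LY[OF I(3)]) (use False in auto)
    also have "\<dots> \<le> ennreal (C * \<rho> ^ n) * ennreal K + ennreal C * ennreal (measure lborel W)"
      using I(1,2) by (intro add_mono mult_left_mono) (auto simp: K_def)
    also have "\<dots> = ennreal R"
    proof -
      have "ennreal (C * \<rho> ^ n) * ennreal K = ennreal (C * \<rho> ^ n * K)"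
        using C \<rho> K by (intro ennreal_mult[symmetric]) auto
      moreover have "ennreal C * ennreal (measure lborel W) = ennreal (C * measure lborel W)"
        using C by (intro ennreal_mult[symmetric]) auto
      ultimately show ?thesis unfolding R_def using C \<rho> K by (subst ennreal_plus) auto
    qed
    finally have norm: "alpha_norm A \<alpha> ?\<psi> \<le> ennreal R" .
    have ae: "AE x in lborel. x \<in> {0..1} \<longrightarrow> ?\<psi> x \<le> 2 * real m * R"
      by (rule AE_le_if_alpha_norm_le[OF \<psi> m A(2) R norm])
    have "measure lborel {y\<in>W. (f ^^ n) y \<in> E} = (LINT y:{0..1}|lborel. indicator E ((f_unit ^^ n) y) * ?\<phi> y)"
    proof -
      have "(LINT y:{0..1}|lborel. indicator E ((f_unit ^^ n) y) * ?\<phi> y) = (\<integral>y. indicator {y\<in>W. (f ^^ n) y \<in> E} y \<partial>lborel)"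
        unfolding set_lebesgue_integral_def set_eq
        by (rule Bochner_Integration.integral_cong) (use W in \<open>auto simp: indicator_def\<close>)
      then show ?thesis using meas by simp
    qed
    also have "\<dots> = (LINT x:{0..1}|lborel. indicator E x * ?\<psi> x)"
      by (rule duality[where b=1]) (use E W in \<open>auto simp: indicator_def\<close>)
    also have "\<dots> \<le> (\<integral>x. 2 * real m * R * indicator E x \<partial>lborel)"
      unfolding set_lebesgue_integral_def
    proof (rule integral_mono_AE)
      have "\<bar>indicator E x * ?\<psi> x\<bar> \<le> b" for x using b[of x] by (auto simp: indicator_def)
      then show "integrable lborel (\<lambda>x. indicator {0..1} x *\<^sub>R (indicator E x * ?\<psi> x))"
        using set_integrable_bounded[of "\<lambda>x. indicator E x * ?\<psi> x" b "{0..1}" 0 1] \<psi> E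
        by (simp add: set_integrable_def)
      show "integrable lborel (\<lambda>x. 2 * real m * R * indicator E x)"
        using E Efin by (intro integrable_mult_right integrable_real_indicator) auto
      show "AE x in lborel. indicator {0..1} x *\<^sub>R (indicator E x * ?\<psi> x) \<le> 2 * real m * R * indicator E x"
        using ae by eventually_elim (use E R in \<open>auto simp: indicator_def\<close>)
    qed
    also have "\<dots> = 2 * real m * R * measure lborel E" using E by simp
    also have "\<dots> \<le> (2 * real m * C * K + 1) * (\<rho> ^ n + measure lborel W) * measure lborel E"
    proof (rule mult_right_mono)
      have "R \<le> C * K * (\<rho> ^ n + measure lborel W)"
        using K C mult_left_mono[of 1 K "C * measure lborel W"] by (simp add: R_def algebra_simps)
      then have "2 * real m * R \<le> 2 * real m * (C * K * (\<rho> ^ n + measure lborel W))" by (intro mult_left_mono) auto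
      also have "\<dots> \<le> (2 * real m * C * K + 1) * (\<rho> ^ n + measure lborel W)" using \<rho> by (simp add: algebra_simps)
      finally show "2 * real m * R \<le> (2 * real m * C * K + 1) * (\<rho> ^ n + measure lborel W)" .
    qed simp
    finally show "measure lborel {y\<in>W. (f ^^ n) y \<in> E} \<le> (2 * real m * C * K + 1) * (\<rho> ^ n + measure lborel W) * measure lborel E" .
  qed
qed

lemma finite_preimage:
  assumes "finite Q" shows "finite {y \<in> {0..1}. f y \<in> Q}"
proof -
  have "{y \<in> {0..1}. f y \<in> Q} \<subseteq> B \<union> (\<Union>k\<in>{1..p}. f -` Q \<inter> J k)" using in_some_J by blast
  moreover have "finite (B \<union> (\<Union>k\<in>{1..p}. f -` Q \<inter> J k))"
  proof (intro finite_UnI finite_UN_I)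
    show "finite (f -` Q \<inter> J k)" if "k \<in> {1..p}" for k by (rule finite_vimage_IntI[OF assms inj_on_J[OF that]])
  qed auto
  ultimately show ?thesis by (rule finite_subset)
qed

lemma finite_iterated_preimage:
  assumes "finite Q" shows "finite {y \<in> {0..1}. (f ^^ i) y \<in> Q}"
  using assms
proof (induction i arbitrary: Q)
  case (Suc i)
  have "{y \<in> {0..1}. (f ^^ Suc i) y \<in> Q} \<subseteq> {y \<in> {0..1}. (f ^^ i) y \<in> {z \<in> {0..1}. f z \<in> Q}}"
    using f_unit_iter[of _ i] by auto
  then show ?case using Suc.IH[OF finite_preimage[OF Suc.prems]] by (rule finite_subset)
qed simp

lemma iterate_derivative:
  assumes y: "y \<in> {0..1}" and off: "\<And>i. i < j \<Longrightarrow> (f ^^ i) y \<notin> B"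
  shows "\<exists>D. ((f ^^ j) has_real_derivative D) (at y) \<and> lam ^ j \<le> \<bar>D\<bar>"
  using off
proof (induction j)
  case 0
  have "((\<lambda>x. x) has_real_derivative 1) (at y)" by (rule DERIV_ident)
  then show ?case by (intro exI[of _ 1]) (simp add: id_def)
next
  case (Suc j)
  then obtain D where D: "((f ^^ j) has_real_derivative D) (at y)" "lam ^ j \<le> \<bar>D\<bar>" by auto
  have "(f ^^ j) y \<in> {0..1} - B" using f_unit_iter[OF y, of j] Suc.prems[of j] by auto
  then obtain k where k: "k \<in> {1..p}" "(f ^^ j) y \<in> J k" using in_some_J by blast
  have "(f has_real_derivative deriv f ((f ^^ j) y)) (at ((f ^^ j) y))" using der[OF k(1)] k(2) by (simp add: J_def)
  from DERIV_chain[OF this D(1)] have "((f ^^ Suc j) has_real_derivative deriv f ((f ^^ j) y) * D) (at y)" by simp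
  moreover have "lam * lam ^ j \<le> \<bar>deriv f ((f ^^ j) y)\<bar> * \<bar>D\<bar>"
    using expand[OF k(1)] k(2) D(2) lam by (intro mult_mono) (auto simp: J_def)
  ultimately show ?case by (intro exI[of _ "deriv f ((f ^^ j) y) * D"]) (simp only: abs_mult power_Suc)
qed

text \<open>If the orbit of \<open>y\<close> avoids the partition points, this is the chain rule. Otherwise \<open>y\<close> is one of finitely
  many exceptional points; the points just to the right of \<open>y\<close> are not exceptional, and by the mean value theorem the
  difference quotients at \<open>y\<close> inherit the bound from them.\<close>

lemma derivative_of_iterate_lower:
  assumes y: "y \<in> {0<..<1}" and diff: "(f ^^ j) differentiable (at y)"
  shows "lam ^ j \<le> \<bar>deriv (f ^^ j) y\<bar>"
proof -
  define Bd where "Bd = (\<Union>i<j. {z \<in> {0..1}. (f ^^ i) z \<in> B})"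
  have "finite Bd" unfolding Bd_def using finite_iterated_preimage[of B] by auto
  then have "open (- (Bd - {y}) \<inter> {0<..<1})" by (intro open_Int open_Compl finite_imp_closed) auto
  moreover have "y \<in> - (Bd - {y}) \<inter> {0<..<1}" using y by auto
  ultimately obtain r where r: "r > 0" "ball y r \<subseteq> - (Bd - {y}) \<inter> {0<..<1}" using openE by blast
  have good: "z \<notin> Bd \<and> z \<in> {0..1}" if "y < z" "z < y + r" for z
  proof -
    have "z \<in> ball y r" using that by (auto simp: dist_real_def)
    then have "z \<in> - (Bd - {y}) \<inter> {0<..<1}" using r(2) by blast
    then show ?thesis using that by auto
  qed
  have dgood: "\<exists>D. ((f ^^ j) has_real_derivative D) (at z) \<and> lam ^ j \<le> \<bar>D\<bar>" if "y < z" "z < y + r" for z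
    by (rule iterate_derivative) (use good[OF that] in \<open>auto simp: Bd_def\<close>)
  obtain D where D: "((f ^^ j) has_real_derivative D) (at y)"
    using diff by (auto simp: real_differentiable_def)
  have quot: "lam ^ j \<le> \<bar>((f ^^ j) z - (f ^^ j) y) / (z - y)\<bar>" if z: "y < z" "z < y + r" for z
  proof -
    have d: "(f ^^ j) differentiable (at w)" if "y < w" "w \<le> z" for w
      using dgood[of w] that z unfolding real_differentiable_def by fastforce
    have "continuous_on {y..z} (f ^^ j)"
    proof (rule continuous_at_imp_continuous_on, rule ballI)
      fix w assume "w \<in> {y..z}"
      then have "(f ^^ j) differentiable (at w)" using d[of w] diff by (cases "w = y") auto
      then show "isCont (f ^^ j) w" by (rule differentiable_imp_continuous_within)
    qed
    then obtain l w where w: "y < w" "w < z" "((f ^^ j) has_real_derivative l) (at w)" "(f ^^ j) z - (f ^^ j) y = (z - y) * l"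
      using MVT[OF z(1), of "f ^^ j"] d by (metis less_imp_le)
    obtain D' where "((f ^^ j) has_real_derivative D') (at w)" "lam ^ j \<le> \<bar>D'\<bar>" using dgood[of w] w z by force
    then have "lam ^ j \<le> \<bar>l\<bar>" using DERIV_unique[OF w(3)] by metis
    then show ?thesis using w(4) z by simp
  qed
  have "((\<lambda>z. ((f ^^ j) z - (f ^^ j) y) / (z - y)) \<longlongrightarrow> D) (at y)" using D by (simp add: has_field_derivative_iff)
  then have "((\<lambda>z. \<bar>((f ^^ j) z - (f ^^ j) y) / (z - y)\<bar>) \<longlongrightarrow> \<bar>D\<bar>) (at_right y)"
    by (intro tendsto_rabs) (rule filterlim_mono[OF _ order_refl at_le], auto)
  moreover have "\<forall>\<^sub>F z in at_right y. lam ^ j \<le> \<bar>((f ^^ j) z - (f ^^ j) y) / (z - y)\<bar>"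
    unfolding eventually_at_right_field using r(1) quot by (intro exI[of _ "y + r"]) auto
  ultimately have "lam ^ j \<le> \<bar>D\<bar>" by (intro tendsto_lowerbound) auto
  then show ?thesis using DERIV_imp_deriv[OF D] by simp
qed

end

section \<open>Regularity of the family in phase and parameter jointly\<close>

lemma interval_sign_const:
  fixes g :: "real \<Rightarrow> real"
  assumes "is_interval W" "continuous_on W g" "\<And>s. s \<in> W \<Longrightarrow> g s \<noteq> 0" "a \<in> W" "a' \<in> W" "g a < 0"
  shows "g a' < 0"
proof (rule ccontr)
  assume "\<not> g a' < 0"
  then have "0 \<le> g a'" by simp
  have "connected (g ` W)" using assms(1,2) by (intro connected_continuous_image) (auto simp: is_interval_connected_1)
  then have "0 \<in> g ` W"
    using assms(4,5,6) \<open>0 \<le> g a'\<close> unfolding is_interval_connected_1[symmetric] is_interval_1 by (meson image_eqI less_imp_le)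
  then show False using assms(3) by force
qed

text \<open>A Hoelder function is uniformly continuous, hence extends continuously to the end point.\<close>

lemma holder_limit_at_right:
  fixes f :: "real \<Rightarrow> real"
  assumes e: "0 < e" and \<alpha>: "0 < \<alpha>"
    and h: "\<And>s t. s \<in> {0<..<e} \<Longrightarrow> t \<in> {0<..<e} \<Longrightarrow> \<bar>f s - f t\<bar> \<le> C * \<bar>s - t\<bar> powr \<alpha>"
  shows "\<exists>l. (f \<longlongrightarrow> l) (at_right 0)"
proof -
  define C' where "C' = \<bar>C\<bar> + 1"
  have h': "\<bar>f s - f t\<bar> \<le> C' * \<bar>s - t\<bar> powr \<alpha>" if "s \<in> {0<..<e}" "t \<in> {0<..<e}" for s t
  proof -
    have "C * \<bar>s - t\<bar> powr \<alpha> \<le> C' * \<bar>s - t\<bar> powr \<alpha>" by (rule mult_right_mono) (auto simp: C'_def)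
    then show ?thesis using h[OF that] by linarith
  qed
  have "uniformly_continuous_on {0<..<e} f"
    unfolding uniformly_continuous_on_def
  proof (intro allI impI)
    fix \<eta> :: real assume \<eta>: "\<eta> > 0"
    define d where "d = (\<eta> / C') powr (1/\<alpha>)"
    have C': "C' > 0" by (simp add: C'_def)
    have d: "d > 0" using \<eta> C' by (simp add: d_def)
    have "dist (f t) (f s) < \<eta>" if st: "s \<in> {0<..<e}" "t \<in> {0<..<e}" "dist t s < d" for s t
    proof -
      have "\<bar>s - t\<bar> powr \<alpha> < d powr \<alpha>"
        using st(3) \<alpha> by (intro powr_less_mono2) (auto simp: dist_real_def)
      also have "\<dots> = \<eta> / C'" using \<alpha> \<eta> C' by (simp add: d_def powr_powr)
      finally have "C' * \<bar>s - t\<bar> powr \<alpha> < \<eta>" using C' by (simp add: pos_less_divide_eq mult.commute)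
      then show ?thesis using h'[OF st(1,2)] by (simp add: dist_real_def abs_minus_commute)
    qed
    then show "\<exists>d>0. \<forall>x\<in>{0<..<e}. \<forall>x'\<in>{0<..<e}. dist x' x < d \<longrightarrow> dist (f x') (f x) < \<eta>"
      using d by blast
  qed
  moreover have "0 \<in> closure {0<..<e}" using e by simp
  ultimately obtain l where "(f \<longlongrightarrow> l) (at 0 within {0<..<e})"
    by (rule uniformly_continuous_on_extension_at_closure)
  moreover have "at 0 within {0<..<e} = at_right 0"
    by (rule at_within_nhd[of 0 "{..<e}"]) (use e in auto)
  ultimately show ?thesis by auto
qed

text \<open>The family with uniform constants: \<open>L\<close> is a Lipschitz constant of the partition points, \<open>H\<close> a common Hoelder
  constant, \<open>M\<close> a bound of the parameter derivative and \<open>gap\<close> a lower bound of the lengths of the branches. The Hoelder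
  conditions in the parameter concern a point that stays in its branch along a whole parameter segment.\<close>

locale param_family =
  fixes \<alpha> :: real and p0 :: nat and b :: "nat \<Rightarrow> real \<Rightarrow> real" and T :: "real \<Rightarrow> real \<Rightarrow> real"
    and x0 :: "real \<Rightarrow> real" and lam Lam H L M gap :: real
  assumes \<alpha>: "0 < \<alpha>" "\<alpha> \<le> 1"
    and T_unit: "\<And>a x. a \<in> {0..1} \<Longrightarrow> x \<in> {0..1} \<Longrightarrow> T a x \<in> {0..1}"
    and T_meas: "\<And>a. a \<in> {0..1} \<Longrightarrow> T a \<in> borel_measurable (restrict_space borel {0..1})"
    and b_ends: "\<And>a. a \<in> {0..1} \<Longrightarrow> b 0 a = 0 \<and> b p0 a = 1"
    and gap: "0 < gap" "\<And>a k. a \<in> {0..1} \<Longrightarrow> k \<in> {1..p0} \<Longrightarrow> b (k - 1) a + gap \<le> b k a"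
    and b_lip: "\<And>k a a'. k \<le> p0 \<Longrightarrow> a \<in> {0..1} \<Longrightarrow> a' \<in> {0..1} \<Longrightarrow> \<bar>b k a - b k a'\<bar> \<le> L * \<bar>a - a'\<bar>"
    and L: "0 \<le> L" and H: "0 \<le> H" and M: "0 \<le> M"
    and T_der: "\<And>a k x. a \<in> {0..1} \<Longrightarrow> k \<in> {1..p0} \<Longrightarrow> x \<in> branch b k a \<Longrightarrow> (T a has_real_derivative deriv (T a) x) (at x)"
    and T'_holder_x: "\<And>a k x y. a \<in> {0..1} \<Longrightarrow> k \<in> {1..p0} \<Longrightarrow> x \<in> branch b k a \<Longrightarrow> y \<in> branch b k a \<Longrightarrow>
       \<bar>deriv (T a) x - deriv (T a) y\<bar> \<le> H * \<bar>x - y\<bar> powr \<alpha>"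
    and lam: "1 < lam"
    and T'_bounds: "\<And>a k x. a \<in> {0..1} \<Longrightarrow> k \<in> {1..p0} \<Longrightarrow> x \<in> branch b k a \<Longrightarrow> lam \<le> \<bar>deriv (T a) x\<bar> \<and> \<bar>deriv (T a) x\<bar> \<le> Lam"
    and T_param: "\<And>a k x. a \<in> {0<..<1} \<Longrightarrow> k \<in> {1..p0} \<Longrightarrow> x \<in> branch b k a \<Longrightarrow>
       ((\<lambda>s. T s x) has_real_derivative param_deriv T a x) (at a)"
    and T'_holder_a: "\<And>s t k x. s \<le> t \<Longrightarrow> {s..t} \<subseteq> {0<..<1} \<Longrightarrow> k \<in> {1..p0} \<Longrightarrow> (\<And>a. a \<in> {s..t} \<Longrightarrow> x \<in> branch b k a) \<Longrightarrow>
       \<bar>deriv (T s) x - deriv (T t) x\<bar> \<le> H * \<bar>s - t\<bar> powr \<alpha>"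
    and P_holder_x: "\<And>a k x y. a \<in> {0..1} \<Longrightarrow> k \<in> {1..p0} \<Longrightarrow> x \<in> branch b k a \<Longrightarrow> y \<in> branch b k a \<Longrightarrow>
       \<bar>param_deriv T a x - param_deriv T a y\<bar> \<le> H * \<bar>x - y\<bar> powr \<alpha>"
    and P_holder_a: "\<And>s t k x. s \<le> t \<Longrightarrow> {s..t} \<subseteq> {0<..<1} \<Longrightarrow> k \<in> {1..p0} \<Longrightarrow> (\<And>a. a \<in> {s..t} \<Longrightarrow> x \<in> branch b k a) \<Longrightarrow>
       \<bar>param_deriv T s x - param_deriv T t x\<bar> \<le> H * \<bar>s - t\<bar> powr \<alpha>"
    and P_bound: "\<And>a k x. a \<in> {0<..<1} \<Longrightarrow> k \<in> {1..p0} \<Longrightarrow> x \<in> branch b k a \<Longrightarrow> \<bar>param_deriv T a x\<bar> \<le> M"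
    and x0_unit: "\<And>a. a \<in> {0..1} \<Longrightarrow> x0 a \<in> {0..1}"
    and x0_der: "\<And>a. a \<in> {0<..<1} \<Longrightarrow> (x0 has_real_derivative deriv x0 a) (at a)"
    and x0'_holder: "\<And>s t. s \<in> {0<..<1} \<Longrightarrow> t \<in> {0<..<1} \<Longrightarrow> \<bar>deriv x0 s - deriv x0 t\<bar> \<le> H * \<bar>s - t\<bar> powr \<alpha>"
begin

lemma piecewise_expanding:
  assumes a: "a \<in> {0..1}"
  shows "piecewise_expanding_map (T a) p0 (\<lambda>k. b k a) lam"
proof
  show "b 0 a = 0" "b p0 a = 1" using b_ends[OF a] by auto
  show "T a y \<in> {0..1}" if "y \<in> {0..1}" for y by (rule T_unit[OF a that])
  show "T a \<in> borel_measurable (restrict_space borel {0..1})" by (rule T_meas[OF a])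
  show "0 < lam" using lam by simp
  fix k assume k: "k \<in> {1..p0}"
  show "(T a has_real_derivative deriv (T a) y) (at y)" if "y \<in> {b (k - 1) a<..<b k a}" for y
    using T_der[OF a k] that unfolding branch_def by blast
  show "lam \<le> \<bar>deriv (T a) y\<bar>" if "y \<in> {b (k - 1) a<..<b k a}" for y
    using T'_bounds[OF a k] that unfolding branch_def by blast
  show "b (k - 1) a < b k a" using gap(1) gap(2)[OF a k] by simp
  show "continuous_on {b (k - 1) a<..<b k a} (deriv (T a))"
  proof (rule continuous_at_imp_continuous_on, rule ballI)
    fix x assume x: "x \<in> {b (k - 1) a<..<b k a}"
    have "((\<lambda>y. H * \<bar>y - x\<bar> powr \<alpha>) \<longlongrightarrow> H * \<bar>x - x\<bar> powr \<alpha>) (at x)"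
      using \<alpha> by (intro tendsto_intros) auto
    then have lim: "((\<lambda>y. H * \<bar>y - x\<bar> powr \<alpha>) \<longlongrightarrow> 0) (at x)" by simp
    have "\<forall>\<^sub>F y in at x. y \<in> {b (k - 1) a<..<b k a}" using x by (intro eventually_at_in_open') auto
    then have "\<forall>\<^sub>F y in at x. \<bar>deriv (T a) y - deriv (T a) x\<bar> \<le> H * \<bar>y - x\<bar> powr \<alpha>"
      by eventually_elim (use T'_holder_x[OF a k] x in \<open>auto simp: branch_def\<close>)
    then have "((\<lambda>y. \<bar>deriv (T a) y - deriv (T a) x\<bar>) \<longlongrightarrow> 0) (at x)"
      by (intro tendsto_sandwich[OF _ _ tendsto_const lim]) auto
    then show "isCont (deriv (T a)) x"
      unfolding isCont_def by (simp add: tendsto_rabs_zero_iff LIM_zero_iff)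
  qed
qed

lemma pred_le: "k \<in> {1..p0} \<Longrightarrow> k - 1 \<le> p0"
  by (simp only: atLeastAtMost_iff) linarith

lemma in_some_branch:
  assumes "a \<in> {0..1}" "z \<in> {0..1}" "z \<notin> part_pts p0 b a"
  obtains k where "k \<in> {1..p0}" "z \<in> branch b k a"
proof -
  interpret pm: piecewise_expanding_map "T a" p0 "\<lambda>k. b k a" lam by (rule piecewise_expanding[OF assms(1)])
  obtain k where "k \<in> {1..p0}" "z \<in> pm.J k"
    using pm.in_some_J[of z] assms unfolding part_pts_def by blast
  then show thesis using that unfolding pm.J_def branch_def by blast
qed

lemma branch_not_part:
  assumes "a \<in> {0..1}" "k \<in> {1..p0}" "z \<in> branch b k a"
  shows "z \<notin> part_pts p0 b a" "z \<in> {0..1}"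
proof -
  interpret pm: piecewise_expanding_map "T a" p0 "\<lambda>k. b k a" lam by (rule piecewise_expanding[OF assms(1)])
  have z: "z \<in> pm.J k" using assms(3) unfolding pm.J_def branch_def .
  show "z \<notin> part_pts p0 b a" unfolding part_pts_def by (rule pm.J_not_B[OF assms(2) z])
  have "z \<in> {0<..<1}" using pm.J_unit[OF assms(2)] z by blast
  then show "z \<in> {0..1}" by simp
qed

definition joint_const :: real where "joint_const = 3 * H * (2 * L + 1) powr \<alpha>"

lemma joint_const_nonneg: "joint_const \<ge> 0" using H by (simp add: joint_const_def)

text \<open>Phase point and parameter cannot be changed one after the other directly, because \<open>x\<close> may leave the branch as the
  parameter moves from \<open>s\<close> to \<open>t\<close>. While the ends of the branch move by at most \<open>\<delta> = L * \<bar>s - t\<bar>\<close>, a point \<open>z\<close> at distance at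
  least \<open>2 * \<delta>\<close> from both ends stays inside; the path from \<open>(s, x)\<close> to \<open>(t, y)\<close> is therefore led through
  \<open>(s, z)\<close> and \<open>(t, z)\<close>.\<close>

lemma joint_holder:
  fixes F :: "real \<Rightarrow> real \<Rightarrow> real"
  assumes Fx: "\<And>a x y. a \<in> {0..1} \<Longrightarrow> x \<in> branch b k a \<Longrightarrow> y \<in> branch b k a \<Longrightarrow> \<bar>F a x - F a y\<bar> \<le> H * \<bar>x - y\<bar> powr \<alpha>"
    and Fa: "\<And>s t x. s \<le> t \<Longrightarrow> {s..t} \<subseteq> {0<..<1} \<Longrightarrow> (\<And>a. a \<in> {s..t} \<Longrightarrow> x \<in> branch b k a) \<Longrightarrow> \<bar>F s x - F t x\<bar> \<le> H * \<bar>s - t\<bar> powr \<alpha>"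
    and k: "k \<in> {1..p0}" and st: "s \<in> {0<..<1}" "t \<in> {0<..<1}" "4 * L * \<bar>s - t\<bar> < gap"
    and xy: "x \<in> branch b k s" "y \<in> branch b k t"
  shows "\<bar>F s x - F t y\<bar> \<le> joint_const * (\<bar>s - t\<bar> + \<bar>x - y\<bar>) powr \<alpha>"
proof -
  have main: "\<bar>F s x - F t y\<bar> \<le> joint_const * (\<bar>s - t\<bar> + \<bar>x - y\<bar>) powr \<alpha>"
    if le: "s \<le> t" and st: "s \<in> {0<..<1}" "t \<in> {0<..<1}" "4 * L * \<bar>s - t\<bar> < gap"
      and xy: "x \<in> branch b k s" "y \<in> branch b k t" for s t x y
  proof -
    define \<delta> where "\<delta> = L * \<bar>s - t\<bar>"
    have \<delta>: "0 \<le> \<delta>" "4 * \<delta> < gap" using L st by (auto simp: \<delta>_def)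
    have s01: "s \<in> {0..1}" and t01: "t \<in> {0..1}" using st by auto
    have gp: "b (k - 1) s + gap \<le> b k s" using gap(2)[OF s01 k] .
    \<comment> \<open>The point nearest to \<open>x\<close> at distance \<open>2 * \<delta>\<close> from the ends.\<close>
    define z where "z = max (b (k - 1) s + 2 * \<delta>) (min x (b k s - 2 * \<delta>))"
    have zx: "\<bar>x - z\<bar> \<le> 2 * \<delta>" using xy(1) \<delta> gp by (auto simp: z_def branch_def)
    have zb: "z \<in> branch b k a" if a: "a \<in> {s..t}" for a
    proof -
      have a01: "a \<in> {0..1}" using a st by auto
      have "L * \<bar>a - s\<bar> \<le> \<delta>" unfolding \<delta>_def using a L by (intro mult_left_mono) auto
      moreover have "\<bar>b k a - b k s\<bar> \<le> L * \<bar>a - s\<bar>" using k by (intro b_lip a01 s01) auto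
      moreover have "\<bar>b (k - 1) a - b (k - 1) s\<bar> \<le> L * \<bar>a - s\<bar>" by (intro b_lip a01 s01 pred_le k)
      ultimately have ba: "\<bar>b k a - b k s\<bar> \<le> \<delta>" "\<bar>b (k - 1) a - b (k - 1) s\<bar> \<le> \<delta>" by linarith+
      have z1: "b (k - 1) s + 2 * \<delta> \<le> z" "z \<le> b k s - 2 * \<delta>" using gp \<delta> by (auto simp: z_def)
      have xs: "b (k - 1) s < x" "x < b k s" using xy(1) by (auto simp: branch_def)
      have z0: "z = x" if "\<delta> = 0" using zx that by simp
      have "b (k - 1) a < z \<and> z < b k a"
        using ba z1 xs z0 \<delta>(1) by (cases "\<delta> = 0") linarith+
      then show ?thesis by (simp add: branch_def)
    qed
    define u where "u = (2 * L + 1) * (\<bar>s - t\<bar> + \<bar>x - y\<bar>)"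
    have u1: "\<bar>s - t\<bar> \<le> u" "2 * \<delta> + \<bar>x - y\<bar> \<le> u"
    proof -
      have "u = \<bar>s - t\<bar> + \<bar>x - y\<bar> + 2 * \<delta> + 2 * L * \<bar>x - y\<bar>" by (simp add: u_def \<delta>_def algebra_simps)
      moreover have "0 \<le> 2 * L * \<bar>x - y\<bar>" using L by simp
      ultimately show "\<bar>s - t\<bar> \<le> u" "2 * \<delta> + \<bar>x - y\<bar> \<le> u" using \<delta>(1) by linarith+
    qed
    have pw: "H * r powr \<alpha> \<le> H * u powr \<alpha>" if "0 \<le> r" "r \<le> u" for r
      using that H \<alpha> by (intro mult_left_mono powr_mono2) auto
    have zs: "z \<in> branch b k s" and zt: "z \<in> branch b k t" using zb le by auto
    have r1: "\<bar>x - z\<bar> \<le> u" and r2: "\<bar>z - y\<bar> \<le> u" using zx u1 by linarith+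
    have "\<bar>F s x - F s z\<bar> \<le> H * u powr \<alpha>"
      by (rule order_trans[OF Fx[OF s01 xy(1) zs] pw[OF _ r1]]) simp
    moreover have "\<bar>F s z - F t z\<bar> \<le> H * u powr \<alpha>"
    proof (rule order_trans[OF Fa[OF le _ zb] pw[OF _ u1(1)]])
      show "{s..t} \<subseteq> {0<..<1}" using st by auto
    qed simp_all
    moreover have "\<bar>F t z - F t y\<bar> \<le> H * u powr \<alpha>"
      by (rule order_trans[OF Fx[OF t01 zt xy(2)] pw[OF _ r2]]) simp
    ultimately have "\<bar>F s x - F t y\<bar> \<le> 3 * H * u powr \<alpha>" by linarith
    also have "u powr \<alpha> = (2 * L + 1) powr \<alpha> * (\<bar>s - t\<bar> + \<bar>x - y\<bar>) powr \<alpha>"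
      unfolding u_def using L by (intro powr_mult)
    finally show ?thesis by (simp add: joint_const_def mult.assoc)
  qed
  show ?thesis
  proof (cases "s \<le> t")
    case True then show ?thesis using main st xy by blast
  next
    case False
    then have "\<bar>F t y - F s x\<bar> \<le> joint_const * (\<bar>t - s\<bar> + \<bar>y - x\<bar>) powr \<alpha>"
      using main[of t s y x] st xy by (auto simp: abs_minus_commute)
    then show ?thesis by (simp add: abs_minus_commute)
  qed
qed

lemma T'_joint_holder:
  assumes "k \<in> {1..p0}" "s \<in> {0<..<1}" "t \<in> {0<..<1}" "4 * L * \<bar>s - t\<bar> < gap" "x \<in> branch b k s" "y \<in> branch b k t"
  shows "\<bar>deriv (T s) x - deriv (T t) y\<bar> \<le> joint_const * (\<bar>s - t\<bar> + \<bar>x - y\<bar>) powr \<alpha>"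
  by (rule joint_holder[where F="\<lambda>a. deriv (T a)", OF T'_holder_x T'_holder_a]) (use assms in auto)

lemma P_joint_holder:
  assumes "k \<in> {1..p0}" "s \<in> {0<..<1}" "t \<in> {0<..<1}" "4 * L * \<bar>s - t\<bar> < gap" "x \<in> branch b k s" "y \<in> branch b k t"
  shows "\<bar>param_deriv T s x - param_deriv T t y\<bar> \<le> joint_const * (\<bar>s - t\<bar> + \<bar>x - y\<bar>) powr \<alpha>"
  by (rule joint_holder[where F="param_deriv T", OF P_holder_x P_holder_a]) (use assms in auto)

lemma b_isCont:
  assumes "k \<le> p0" "a \<in> {0<..<1}" shows "isCont (b k) a"
proof -
  have "L-lipschitz_on {0..1} (b k)"
    by (rule lipschitz_onI) (use b_lip[OF assms(1)] L in \<open>auto simp: dist_real_def\<close>)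
  then have "continuous_on {0<..<1} (b k)"
    using lipschitz_on_continuous_on continuous_on_subset greaterThanLessThan_subseteq_atLeastAtMost_iff by blast
  then show ?thesis using assms(2) by (simp add: continuous_on_eq_continuous_at)
qed

lemma eventually_branch:
  assumes a: "a \<in> {0<..<1}" and k: "k \<in> {1..p0}" and za: "z a \<in> branch b k a" and z: "isCont z a"
  shows "\<forall>\<^sub>F s in nhds a. s \<in> {0<..<1} \<and> z s \<in> branch b k s"
proof -
  have c: "isCont (b k) a" "isCont (b (k - 1)) a" using b_isCont[of _ a] a k by auto
  have "((\<lambda>s. b k s - z s) \<longlongrightarrow> b k a - z a) (nhds a)" "((\<lambda>s. z s - b (k - 1) s) \<longlongrightarrow> z a - b (k - 1) a) (nhds a)"
    using c z by (auto simp: isCont_def tendsto_at_iff_tendsto_nhds intro!: tendsto_intros)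
  moreover have "0 < b k a - z a" "0 < z a - b (k - 1) a" using za by (auto simp: branch_def)
  ultimately have "\<forall>\<^sub>F s in nhds a. 0 < b k s - z s" "\<forall>\<^sub>F s in nhds a. 0 < z s - b (k - 1) s"
    by (blast dest: order_tendstoD(1))+
  moreover have "\<forall>\<^sub>F s in nhds a. s \<in> {0<..<1}" using a by (intro eventually_nhds_in_open) auto
  ultimately show ?thesis by eventually_elim (auto simp: branch_def)
qed

text \<open>Chain rule for two variables. The increment of \<open>T s (z s)\<close> splits into a move in the parameter at the fixed point \<open>z a\<close> and
  a move in phase space at the fixed parameter \<open>s\<close>; the mean value theorem turns the latter into a value of \<open>deriv (T s)\<close>
  near \<open>z a\<close>, which is close to \<open>deriv (T a) (z a)\<close> by joint Hoelder continuity.\<close>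

lemma total_derivative:
  assumes a: "a \<in> {0<..<1}" and k: "k \<in> {1..p0}" and za: "z a \<in> branch b k a"
    and z: "(z has_real_derivative z') (at a)"
  shows "((\<lambda>s. T s (z s)) has_real_derivative deriv (T a) (z a) * z' + param_deriv T a (z a)) (at a)"
proof -
  define D where "D = deriv (T a) (z a)"
  define E where "E s = T s (z s) - T s (z a) - D * (z s - z a)" for s
  have zc: "isCont z a" using z by (rule DERIV_isCont)
  have ev: "\<forall>\<^sub>F s in at a. s \<in> {0<..<1} \<and> z s \<in> branch b k s"
    using eventually_branch[OF a k za zc] by (simp add: eventually_nhds_conv_at)
  have ev2: "\<forall>\<^sub>F s in at a. z a \<in> branch b k s"
    using eventually_branch[OF a k, of "\<lambda>_. z a"] za by (auto simp: eventually_nhds_conv_at elim: eventually_mono)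
  have ev3: "\<forall>\<^sub>F s in at a. 4 * L * \<bar>s - a\<bar> < gap"
  proof (rule order_tendstoD(2))
    show "((\<lambda>s. 4 * L * \<bar>s - a\<bar>) \<longlongrightarrow> 4 * L * \<bar>a - a\<bar>) (at a)" by (intro tendsto_intros)
  qed (use gap in simp)
  have Ebound: "\<forall>\<^sub>F s in at a. \<bar>E s / (s - a)\<bar> \<le> joint_const * (\<bar>s - a\<bar> + \<bar>z s - z a\<bar>) powr \<alpha> * \<bar>(z s - z a) / (s - a)\<bar>"
    using ev ev2 ev3
  proof eventually_elim
    fix s assume s: "s \<in> {0<..<1} \<and> z s \<in> branch b k s" and zas: "z a \<in> branch b k s" and g: "4 * L * \<bar>s - a\<bar> < gap"
    have s01: "s \<in> {0..1}" using s by auto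
    have "\<exists>\<xi>. \<xi> \<in> branch b k s \<and> \<bar>\<xi> - z a\<bar> \<le> \<bar>z s - z a\<bar> \<and> T s (z s) - T s (z a) = deriv (T s) \<xi> * (z s - z a)"
    proof (cases "z s = z a")
      case True then show ?thesis using zas by (intro exI[of _ "z a"]) auto
    next
      case False
      define u v where "u = min (z s) (z a)" and "v = max (z s) (z a)"
      have uv: "u < v" using False by (auto simp: u_def v_def)
      have inb: "\<xi> \<in> branch b k s" if "u \<le> \<xi>" "\<xi> \<le> v" for \<xi>
        using that s zas by (auto simp: u_def v_def branch_def)
      obtain \<xi> where \<xi>: "u < \<xi>" "\<xi> < v" "T s v - T s u = (v - u) * deriv (T s) \<xi>"
        using MVT2[OF uv, of "T s" "deriv (T s)"] T_der[OF s01 k inb] by blast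
      show ?thesis
      proof (intro exI[of _ \<xi>] conjI)
        show "T s (z s) - T s (z a) = deriv (T s) \<xi> * (z s - z a)"
          using \<xi>(3) by (cases "z s \<le> z a") (auto simp: u_def v_def min_def max_def algebra_simps)
      qed (use \<xi> inb in \<open>auto simp: u_def v_def\<close>)
    qed
    then obtain \<xi> where \<xi>: "\<xi> \<in> branch b k s" "\<bar>\<xi> - z a\<bar> \<le> \<bar>z s - z a\<bar>" "T s (z s) - T s (z a) = deriv (T s) \<xi> * (z s - z a)" by blast
    have "\<bar>deriv (T s) \<xi> - D\<bar> \<le> joint_const * (\<bar>s - a\<bar> + \<bar>\<xi> - z a\<bar>) powr \<alpha>"
      unfolding D_def by (rule T'_joint_holder[OF k _ a g \<xi>(1) za]) (use s in auto)
    also have "\<dots> \<le> joint_const * (\<bar>s - a\<bar> + \<bar>z s - z a\<bar>) powr \<alpha>"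
      using \<xi>(2) joint_const_nonneg \<alpha> by (intro mult_left_mono powr_mono2) auto
    finally have d: "\<bar>deriv (T s) \<xi> - D\<bar> \<le> joint_const * (\<bar>s - a\<bar> + \<bar>z s - z a\<bar>) powr \<alpha>" .
    have "\<bar>E s / (s - a)\<bar> = \<bar>deriv (T s) \<xi> - D\<bar> * \<bar>(z s - z a) / (s - a)\<bar>"
      unfolding E_def \<xi>(3) by (simp add: abs_mult abs_divide flip: left_diff_distrib)
    also have "\<dots> \<le> joint_const * (\<bar>s - a\<bar> + \<bar>z s - z a\<bar>) powr \<alpha> * \<bar>(z s - z a) / (s - a)\<bar>"
      by (rule mult_right_mono[OF d]) simp
    finally show "\<bar>E s / (s - a)\<bar> \<le> joint_const * (\<bar>s - a\<bar> + \<bar>z s - z a\<bar>) powr \<alpha> * \<bar>(z s - z a) / (s - a)\<bar>" .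
  qed
  have zlim: "((\<lambda>s. (z s - z a) / (s - a)) \<longlongrightarrow> z') (at a)" using z by (simp add: has_field_derivative_iff)
  have "((\<lambda>s. joint_const * (\<bar>s - a\<bar> + \<bar>z s - z a\<bar>) powr \<alpha> * \<bar>(z s - z a) / (s - a)\<bar>) \<longlongrightarrow>
      joint_const * (\<bar>a - a\<bar> + \<bar>z a - z a\<bar>) powr \<alpha> * \<bar>z'\<bar>) (at a)"
    using \<alpha> zc by (intro tendsto_intros zlim) (auto simp: isCont_def)
  then have lim: "((\<lambda>s. joint_const * (\<bar>s - a\<bar> + \<bar>z s - z a\<bar>) powr \<alpha> * \<bar>(z s - z a) / (s - a)\<bar>) \<longlongrightarrow> 0) (at a)" by simp
  have "((\<lambda>s. E s / (s - a)) \<longlongrightarrow> 0) (at a)"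
    by (rule tendsto_rabs_zero_cancel, rule tendsto_sandwich[OF _ Ebound tendsto_const lim]) auto
  then have Ed: "(E has_real_derivative 0) (at a)"
    by (simp add: has_field_derivative_iff E_def)
  have "((\<lambda>s. E s + T s (z a) + D * (z s - z a)) has_real_derivative 0 + param_deriv T a (z a) + D * (z' - 0)) (at a)"
    by (intro DERIV_add Ed T_param[OF a k za] DERIV_cmult DERIV_diff z DERIV_const)
  moreover have "(\<lambda>s. E s + T s (z a) + D * (z s - z a)) = (\<lambda>s. T s (z s))" by (simp add: E_def)
  ultimately show ?thesis by (simp add: D_def add.commute)
qed

section \<open>Orbits as functions of the parameter\<close>

abbreviation x :: "nat \<Rightarrow> real \<Rightarrow> real" where "x \<equiv> orb T x0"
abbreviation x' :: "nat \<Rightarrow> real \<Rightarrow> real" where "x' j \<equiv> deriv (x j)"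

lemma x_Suc: "x (Suc j) a = T a (x j a)" by (simp add: orb_def)
lemma x_0: "x 0 = x0" by (simp add: orb_def fun_eq_iff)

lemma x_unit: "a \<in> {0..1} \<Longrightarrow> x j a \<in> {0..1}"
  by (induction j) (auto simp: x_0 x_Suc x0_unit simp del: atLeastAtMost_iff intro: T_unit)

text \<open>The parameters whose orbits meet no partition point before time \<open>j\<close>; its components are the partition of \<open>{0<..<e}\<close> at time \<open>j\<close>.\<close>

definition G :: "real \<Rightarrow> nat \<Rightarrow> real set" where
  "G e j = {a \<in> {0<..<e}. \<forall>i<j. x i a \<notin> part_pts p0 b a}"

lemma G_0: "G e 0 = {0<..<e}" by (auto simp: G_def)
lemma G_D: "a \<in> G e j \<Longrightarrow> 0 < a \<and> a < e" by (simp add: G_def)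
lemma G_Suc: "G e (Suc j) = {a \<in> G e j. x j a \<notin> part_pts p0 b a}" by (auto simp: G_def less_Suc_eq)
lemma G_antimono: "i \<le> j \<Longrightarrow> G e j \<subseteq> G e i" by (auto simp: G_def)
lemma G_sub: "G e j \<subseteq> {0<..<e}" by (auto simp: G_def)
lemma G_le: "e \<le> e' \<Longrightarrow> G e j \<subseteq> G e' j" by (auto simp: G_def)

lemma x_Suc_derivative:
  assumes a: "a \<in> {0<..<1}" and d: "(x j has_real_derivative x' j a) (at a)" and off: "x j a \<notin> part_pts p0 b a"
  shows "(x (Suc j) has_real_derivative deriv (T a) (x j a) * x' j a + param_deriv T a (x j a)) (at a)"
proof -
  have "x j a \<in> {0..1}" using x_unit[of a] a by auto
  then obtain k where k: "k \<in> {1..p0}" "x j a \<in> branch b k a" using in_some_branch[of a "x j a"] off a by auto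
  have "x (Suc j) = (\<lambda>s. T s (x j s))" by (simp add: x_Suc fun_eq_iff)
  then show ?thesis using total_derivative[OF a k d] by simp
qed

lemma x_derivative: "a \<in> G 1 j \<Longrightarrow> (x j has_real_derivative x' j a) (at a)"
proof (induction j)
  case 0 then show ?case using x0_der by (simp add: G_0 x_0)
next
  case (Suc j)
  then have a: "a \<in> {0<..<1}" and d: "(x j has_real_derivative x' j a) (at a)" and off: "x j a \<notin> part_pts p0 b a"
    by (auto simp: G_Suc dest: G_D)
  show ?case using x_Suc_derivative[OF a d off] DERIV_imp_deriv by metis
qed

lemma x'_Suc: "a \<in> G 1 (Suc j) \<Longrightarrow> x' (Suc j) a = deriv (T a) (x j a) * x' j a + param_deriv T a (x j a)"
  by (rule DERIV_imp_deriv, rule x_Suc_derivative) (use x_derivative[of a j] in \<open>auto simp: G_Suc dest: G_D\<close>)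

lemma x_isCont: "a \<in> G 1 j \<Longrightarrow> isCont (x j) a"
  using x_derivative DERIV_isCont by blast

lemma open_G: "e \<le> 1 \<Longrightarrow> open (G e j)"
proof (induction j)
  case 0 then show ?case by (simp add: G_0)
next
  case (Suc j)
  show ?case
  proof (subst open_subopen, rule ballI)
    fix a assume a: "a \<in> G e (Suc j)"
    then have aj: "a \<in> G e j" "x j a \<notin> part_pts p0 b a" by (auto simp: G_Suc)
    have a1: "a \<in> {0<..<1}" "a \<in> G 1 j" using aj G_sub[of e j] G_le[OF Suc.prems, of j] Suc.prems by auto
    have "x j a \<in> {0..1}" using x_unit[of a] a1 by auto
    then obtain k where k: "k \<in> {1..p0}" "x j a \<in> branch b k a" using in_some_branch[of a "x j a"] aj a1 by auto
    have "\<forall>\<^sub>F s in nhds a. s \<in> {0<..<1} \<and> x j s \<in> branch b k s"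
      by (rule eventually_branch[OF a1(1) k x_isCont[OF a1(2)]])
    moreover have "\<forall>\<^sub>F s in nhds a. s \<in> G e j" using Suc aj by (intro eventually_nhds_in_open) auto
    ultimately have "\<forall>\<^sub>F s in nhds a. s \<in> G e (Suc j)"
    proof eventually_elim
      fix s assume s: "s \<in> {0<..<1} \<and> x j s \<in> branch b k s" and sG: "s \<in> G e j"
      have "x j s \<notin> part_pts p0 b s" by (rule branch_not_part(1)[OF _ k(1)]) (use s in auto)
      then show "s \<in> G e (Suc j)" using sG by (simp add: G_Suc)
    qed
    then show "\<exists>U. open U \<and> a \<in> U \<and> U \<subseteq> G e (Suc j)" by (auto simp: eventually_nhds)
  qed
qed

text \<open>By the intermediate value theorem the orbits over an interval cannot change branches without meeting a partition point.\<close>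

lemma same_branch:
  assumes W: "is_interval W" "W \<subseteq> G 1 (Suc j)" and a: "a \<in> W" "a' \<in> W" and k: "k \<in> {1..p0}" "x j a \<in> branch b k a"
  shows "x j a' \<in> branch b k a'"
proof -
  have W1: "W \<subseteq> {0<..<1}" "W \<subseteq> G 1 j" using W(2) G_sub[of 1 "Suc j"] G_antimono[of j "Suc j" 1] by auto
  have off: "x j s \<noteq> b i s" if "s \<in> W" "i \<le> p0" for s i
    using W(2) that by (auto simp: G_Suc part_pts_def)
  have cont: "continuous_on W (\<lambda>s. x j s - b i s)" "continuous_on W (\<lambda>s. b i s - x j s)" if "i \<le> p0" for i
  proof -
    have "continuous_on W (x j)" using W1 x_isCont by (intro continuous_at_imp_continuous_on) auto
    moreover have "continuous_on W (b i)" using W1 b_isCont[OF that] by (intro continuous_at_imp_continuous_on) auto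
    ultimately show "continuous_on W (\<lambda>s. x j s - b i s)" "continuous_on W (\<lambda>s. b i s - x j s)" by (auto intro!: continuous_intros)
  qed
  have "x j a' - b k a' < 0"
    by (rule interval_sign_const[OF W(1) cont(1) _ a]) (use off k in \<open>auto simp: branch_def\<close>)
  moreover have "b (k - 1) a' - x j a' < 0"
  proof (rule interval_sign_const[OF W(1) cont(2) _ a])
    have k1: "k - 1 \<le> p0" using k(1) by (simp only: atLeastAtMost_iff) linarith
    then show "k - 1 \<le> p0" .
    show "b (k - 1) s - x j s \<noteq> 0" if "s \<in> W" for s using off[OF that k1] by simp
    show "b (k - 1) a - x j a < 0" using k by (simp add: branch_def)
  qed
  ultimately show ?thesis by (simp add: branch_def)
qed

text \<open>Near 0 the orbits follow one branch and \<open>x j\<close> is Lipschitz, so the coefficients of the recursion for \<open>x'\<close> are Hoelder in the parameter and have right limits at 0.\<close>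

lemma x'_limit_at_0:
  assumes e: "0 < e" "e \<le> 1" and off: "\<And>a i. a \<in> {0<..<e} \<Longrightarrow> i < N \<Longrightarrow> x i a \<notin> part_pts p0 b a"
  shows "j \<le> N \<Longrightarrow> \<exists>l. (x' j \<longlongrightarrow> l) (at_right 0)"
proof (induction j)
  case 0
  show ?case unfolding x_0 by (rule holder_limit_at_right[of 1 \<alpha> _ H]) (use \<alpha> x0'_holder in auto)
next
  case (Suc j)
  then obtain l where l: "(x' j \<longlongrightarrow> l) (at_right 0)" by auto
  define R where "R = \<bar>l\<bar> + 1"
  have "\<forall>\<^sub>F a in at_right 0. \<bar>x' j a\<bar> < R"
    using order_tendstoD(2)[OF tendsto_rabs[OF l], of R] by (simp add: R_def)
  moreover have "\<forall>\<^sub>F a in at_right 0. 4 * L * a < gap"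
  proof (rule order_tendstoD(2))
    show "((\<lambda>a. 4 * L * a) \<longlongrightarrow> 4 * L * 0) (at_right 0)" by (intro tendsto_intros)
  qed (use gap in simp)
  moreover have "\<forall>\<^sub>F a in at_right 0. a < e" using e by (simp add: eventually_at_right_less order_tendstoD(2)[OF tendsto_ident_at])
  ultimately have "\<forall>\<^sub>F a in at_right 0. \<bar>x' j a\<bar> < R \<and> 4 * L * a < gap \<and> a < e" by eventually_elim auto
  then obtain r where r: "r > 0" "\<And>a. 0 < a \<Longrightarrow> a < r \<Longrightarrow> \<bar>x' j a\<bar> < R \<and> 4 * L * a < gap \<and> a < e"
    by (auto simp: eventually_at_right_field)
  let ?W = "{0<..<r}"
  have WG: "?W \<subseteq> G 1 (Suc j)" using r off Suc.prems e by (auto simp: G_def) (metis greaterThanLessThan_iff order_less_le_trans not_le)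
  have WGj: "?W \<subseteq> G 1 j" using WG by (auto simp: G_Suc)
  have int: "is_interval ?W" by (simp add: is_interval_1)
  have "r / 2 \<in> ?W" using r by simp
  then have "r / 2 \<in> G 1 (Suc j)" using WG by blast
  then have h2: "r / 2 \<in> {0<..<1}" "x j (r/2) \<notin> part_pts p0 b (r/2)"
    using G_D[of "r / 2" 1 "Suc j"] unfolding G_Suc by (auto simp del: divide_le_0_iff)
  then obtain k where k: "k \<in> {1..p0}" "x j (r/2) \<in> branch b k (r/2)"
    using in_some_branch[of "r/2" "x j (r/2)"] x_unit[of "r/2" j] by (metis atLeastAtMost_iff greaterThanLessThan_iff less_imp_le)
  have br: "x j a \<in> branch b k a" if "a \<in> ?W" for a
    by (rule same_branch[OF int WG \<open>r / 2 \<in> ?W\<close> that k])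
  have lip: "\<bar>x j s - x j t\<bar> \<le> R * \<bar>s - t\<bar>" if "s \<in> ?W" "t \<in> ?W" for s t
  proof -
    have *: "\<bar>x j s - x j t\<bar> \<le> R * \<bar>s - t\<bar>" if st: "s \<in> ?W" "t \<in> ?W" "s < t" for s t
    proof -
      have in_W: "u \<in> ?W" if "s \<le> u" "u \<le> t" for u using st that by auto
      obtain u where u: "s < u" "u < t" "x j t - x j s = (t - s) * x' j u"
        using MVT2[OF st(3), of "x j" "x' j"] x_derivative WGj in_W by (meson subsetD)
      have "\<bar>x' j u\<bar> \<le> R" using r(2)[of u] in_W[of u] u by auto
      then have "\<bar>t - s\<bar> * \<bar>x' j u\<bar> \<le> \<bar>t - s\<bar> * R" by (intro mult_left_mono) auto
      moreover have "\<bar>x j s - x j t\<bar> = \<bar>t - s\<bar> * \<bar>x' j u\<bar>"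
        using u(3) by (metis abs_minus_commute abs_mult)
      ultimately show ?thesis by (simp only: mult.commute abs_minus_commute)
    qed
    show ?thesis using *[of s t] *[of t s] that by (cases s t rule: linorder_cases) (auto simp: abs_minus_commute)
  qed
  have R0: "R \<ge> 1" by (simp add: R_def)
  have hold: "\<bar>F s (x j s) - F t (x j t)\<bar> \<le> joint_const * (1 + R) powr \<alpha> * \<bar>s - t\<bar> powr \<alpha>"
    if jh: "\<And>s t y z. s \<in> {0<..<1} \<Longrightarrow> t \<in> {0<..<1} \<Longrightarrow> 4 * L * \<bar>s - t\<bar> < gap \<Longrightarrow> y \<in> branch b k s \<Longrightarrow> z \<in> branch b k t \<Longrightarrow>
       \<bar>F s y - F t z\<bar> \<le> joint_const * (\<bar>s - t\<bar> + \<bar>y - z\<bar>) powr \<alpha>" and st: "s \<in> ?W" "t \<in> ?W" for F :: "real \<Rightarrow> real \<Rightarrow> real" and s t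
  proof -
    have "4 * L * \<bar>s - t\<bar> < gap"
    proof -
      have "4 * L * \<bar>s - t\<bar> \<le> 4 * L * max s t" using st L by (intro mult_left_mono) auto
      also have "\<dots> < gap" using r(2)[of "max s t"] st by auto
      finally show ?thesis .
    qed
    then have "\<bar>F s (x j s) - F t (x j t)\<bar> \<le> joint_const * (\<bar>s - t\<bar> + \<bar>x j s - x j t\<bar>) powr \<alpha>"
      using jh[of s t "x j s" "x j t"] br st WG G_sub[of 1 "Suc j"] by blast
    also have "\<dots> \<le> joint_const * ((1 + R) * \<bar>s - t\<bar>) powr \<alpha>"
      using lip[OF st] joint_const_nonneg \<alpha> R0 by (intro mult_left_mono powr_mono2) (auto simp: algebra_simps)
    also have "\<dots> = joint_const * (1 + R) powr \<alpha> * \<bar>s - t\<bar> powr \<alpha>" using R0 by (simp add: powr_mult)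
    finally show ?thesis .
  qed
  obtain l1 where l1: "((\<lambda>a. deriv (T a) (x j a)) \<longlongrightarrow> l1) (at_right 0)"
    using holder_limit_at_right[OF r(1) \<alpha>(1), of "\<lambda>a. deriv (T a) (x j a)" "joint_const * (1 + R) powr \<alpha>"]
      hold[of "\<lambda>a. deriv (T a)"] T'_joint_holder[OF k(1)] by blast
  obtain l2 where l2: "((\<lambda>a. param_deriv T a (x j a)) \<longlongrightarrow> l2) (at_right 0)"
    using holder_limit_at_right[OF r(1) \<alpha>(1), of "\<lambda>a. param_deriv T a (x j a)" "joint_const * (1 + R) powr \<alpha>"]
      hold[of "param_deriv T"] P_joint_holder[OF k(1)] by blast
  have "((\<lambda>a. deriv (T a) (x j a) * x' j a + param_deriv T a (x j a)) \<longlongrightarrow> l1 * l + l2) (at_right 0)"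
    by (intro tendsto_intros l l1 l2)
  moreover have "\<forall>\<^sub>F a in at_right 0. deriv (T a) (x j a) * x' j a + param_deriv T a (x j a) = x' (Suc j) a"
    unfolding eventually_at_right_field using r(1) WG x'_Suc by (intro exI[of _ r]) auto
  ultimately have "(x' (Suc j) \<longlongrightarrow> l1 * l + l2) (at_right 0)"
    by (rule Lim_transform_eventually)
  then show ?case by blast
qed

text \<open>The limit exists, and l'Hopital's rule identifies it with the one-sided derivative at 0.\<close>

lemma x'_tendsto_right_derivative:
  assumes e: "0 < e" "e \<le> 1" and off: "\<And>a i. a \<in> {0<..<e} \<Longrightarrow> i < N \<Longrightarrow> x i a \<notin> part_pts p0 b a"
    and d: "(x N has_real_derivative d) (at_right 0)"
  shows "(x' N \<longlongrightarrow> d) (at_right 0)"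
proof -
  obtain l where l: "(x' N \<longlongrightarrow> l) (at_right 0)" using x'_limit_at_0[OF e off] by blast
  have GN: "{0<..<e} \<subseteq> G 1 N" using e off by (auto simp: G_def)
  have "((\<lambda>a. (x N a - x N 0) / a) \<longlongrightarrow> l) (at_right 0)"
  proof (rule lhopital_right_0[where f'="x' N" and g'="\<lambda>_. 1"])
    have "(x N \<longlongrightarrow> x N 0) (at_right 0)"
      using DERIV_continuous[OF d] by (simp add: continuous_within)
    then show "((\<lambda>a. x N a - x N 0) \<longlongrightarrow> 0) (at_right 0)" by (simp add: LIM_zero)
    show "\<forall>\<^sub>F a in at_right 0. ((\<lambda>a. x N a - x N 0) has_real_derivative x' N a) (at a)"
      unfolding eventually_at_right_field
    proof (intro exI[of _ e] conjI e allI impI)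
      fix a assume "0 < a" "a < e"
      then have "(x N has_real_derivative x' N a) (at a)" using GN x_derivative by auto
      then show "((\<lambda>a. x N a - x N 0) has_real_derivative x' N a) (at a)"
        using DERIV_diff[OF _ DERIV_const[of "x N 0"]] by force
    qed
    show "((\<lambda>a. x' N a / 1) \<longlongrightarrow> l) (at_right 0)" using l by simp
    show "((\<lambda>a. a) \<longlongrightarrow> 0) (at_right (0::real))" by (rule tendsto_ident_at)
    show "\<forall>\<^sub>F a in at_right 0. a \<noteq> (0::real)" by (simp add: eventually_at_filter)
  qed auto
  moreover have "((\<lambda>a. (x N a - x N 0) / a) \<longlongrightarrow> d) (at_right 0)"
    using d by (simp add: has_field_derivative_iff)
  ultimately have "l = d" by (rule tendsto_unique[OF trivial_limit_at_right_real])
  with l show ?thesis by simp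
qed

end

section \<open>Growth and bounded distortion of the parameter derivative\<close>

text \<open>A head start: at time \<open>N\<close> the parameter derivative exceeds \<open>\<kappa>\<close> throughout \<open>{0<..<e1}\<close>. The condition
  \<open>2 * M \<le> (lam - 1) * \<kappa>\<close> makes the inhomogeneous term of the recursion for \<open>x'\<close> harmless, and \<open>L < \<kappa>\<close> makes the orbits move
  faster than the partition points. The bound on \<open>e1\<close> permits the use of joint Hoelder continuity for any two parameters.\<close>

locale expanding_near_0 = param_family +
  fixes N :: nat and e1 \<kappa> D0 :: real
  assumes e1: "0 < e1" "e1 \<le> 1" "4 * L * e1 < gap"
    and N_off: "\<And>a i. a \<in> {0<..<e1} \<Longrightarrow> i < N \<Longrightarrow> x i a \<notin> part_pts p0 b a"
    and \<kappa>: "1 \<le> \<kappa>" "L < \<kappa>" "2 * M \<le> (lam - 1) * \<kappa>"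
    and start: "\<And>a. a \<in> {0<..<e1} \<Longrightarrow> \<kappa> \<le> \<bar>x' N a\<bar> \<and> \<bar>x' N a\<bar> \<le> D0"
begin

text \<open>The rate that remains of \<open>lam\<close> when half of the excess over 1 is spent on the inhomogeneous term.\<close>

definition \<sigma> :: real where "\<sigma> = (1 + lam) / 2"

lemma \<sigma>: "1 < \<sigma>" using lam by (simp add: \<sigma>_def)

abbreviation Ge :: "nat \<Rightarrow> real set" where "Ge \<equiv> G e1"

lemma Ge_G1: "a \<in> Ge j \<Longrightarrow> a \<in> G 1 j" using G_le[OF e1(2)] by blast
lemma Ge_N: "Ge N = {0<..<e1}" using N_off by (auto simp: G_def)
lemma open_Ge: "open (Ge j)" by (rule open_G[OF e1(2)])

text \<open>The inhomogeneous term is at most \<open>M\<close>, which is at most half of \<open>(lam - 1) * \<bar>x' j a\<bar>\<close>.\<close>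

lemma growth_step:
  assumes a: "a \<in> Ge (Suc j)" and k: "\<kappa> \<le> \<bar>x' j a\<bar>"
  shows "\<sigma> * \<bar>x' j a\<bar> \<le> \<bar>x' (Suc j) a\<bar>"
proof -
  have a1: "a \<in> {0<..<1}" using G_D[OF Ge_G1[OF a]] by auto
  have off: "x j a \<notin> part_pts p0 b a" using a by (simp add: G_Suc)
  have "x j a \<in> {0..1}" using x_unit[of a] a1 by auto
  then obtain i where i: "i \<in> {1..p0}" "x j a \<in> branch b i a" using in_some_branch[of a "x j a"] off a1 by auto
  have T: "lam \<le> \<bar>deriv (T a) (x j a)\<bar>" using T'_bounds[of a i "x j a"] i a1 by auto
  have P: "\<bar>param_deriv T a (x j a)\<bar> \<le> M" by (rule P_bound[OF a1 i])
  have "lam * \<bar>x' j a\<bar> \<le> \<bar>deriv (T a) (x j a)\<bar> * \<bar>x' j a\<bar>" by (rule mult_right_mono[OF T]) simp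
  moreover have "2 * M \<le> (lam - 1) * \<bar>x' j a\<bar>"
    using \<kappa>(3) mult_left_mono[OF k, of "lam - 1"] lam by linarith
  ultimately have "\<sigma> * \<bar>x' j a\<bar> \<le> \<bar>deriv (T a) (x j a) * x' j a\<bar> - M"
    unfolding \<sigma>_def abs_mult by (simp add: field_simps)
  also have "\<dots> \<le> \<bar>deriv (T a) (x j a) * x' j a + param_deriv T a (x j a)\<bar>" using P by linarith
  finally show ?thesis using x'_Suc[OF Ge_G1[OF a]] by simp
qed

lemma x'_lower: "a \<in> Ge (N + n) \<Longrightarrow> \<kappa> * \<sigma> ^ n \<le> \<bar>x' (N + n) a\<bar>"
proof (induction n)
  case 0 then show ?case using start by (simp add: Ge_N)
next
  case (Suc n)
  then have "a \<in> Ge (N + n)" by (simp add: G_Suc)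
  then have IH: "\<kappa> * \<sigma> ^ n \<le> \<bar>x' (N + n) a\<bar>" using Suc.IH by simp
  moreover have "\<kappa> * 1 \<le> \<kappa> * \<sigma> ^ n" using \<kappa>(1) \<sigma> by (intro mult_left_mono one_le_power) auto
  ultimately have "\<sigma> * \<bar>x' (N + n) a\<bar> \<le> \<bar>x' (Suc (N + n)) a\<bar>" using growth_step[of a "N + n"] Suc.prems by simp
  moreover have "\<sigma> * (\<kappa> * \<sigma> ^ n) \<le> \<sigma> * \<bar>x' (N + n) a\<bar>" using IH \<sigma> by (intro mult_left_mono) auto
  ultimately show ?case by (simp add: mult_ac)
qed

lemma x'_ge: "N \<le> j \<Longrightarrow> a \<in> Ge j \<Longrightarrow> \<kappa> * \<sigma> ^ (j - N) \<le> \<bar>x' j a\<bar>"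
  using x'_lower[of a "j - N"] by simp

lemma x'_ge_\<kappa>: "N \<le> j \<Longrightarrow> a \<in> Ge j \<Longrightarrow> \<kappa> \<le> \<bar>x' j a\<bar>"
proof -
  assume "N \<le> j" "a \<in> Ge j"
  moreover have "\<kappa> * 1 \<le> \<kappa> * \<sigma> ^ (j - N)" using \<kappa>(1) \<sigma> by (intro mult_left_mono one_le_power) auto
  ultimately show ?thesis using x'_ge[of j a] by simp
qed

lemma growth: "N \<le> i \<Longrightarrow> a \<in> Ge (i + n) \<Longrightarrow> \<sigma> ^ n * \<bar>x' i a\<bar> \<le> \<bar>x' (i + n) a\<bar>"
proof (induction n)
  case (Suc n)
  then have a: "a \<in> Ge (i + n)" by (simp add: G_Suc)
  have "\<sigma> * \<bar>x' (i + n) a\<bar> \<le> \<bar>x' (Suc (i + n)) a\<bar>"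
    using growth_step[of a "i + n"] Suc.prems x'_ge_\<kappa>[of "i + n" a] a by simp
  moreover have "\<sigma> * (\<sigma> ^ n * \<bar>x' i a\<bar>) \<le> \<sigma> * \<bar>x' (i + n) a\<bar>"
    using Suc.IH[OF Suc.prems(1) a] \<sigma> by (intro mult_left_mono) auto
  ultimately show ?case by (simp add: mult_ac)
qed simp

text \<open>Cauchy's mean value theorem compares the two increments through the quotient of the derivatives at one common parameter, which \<open>growth\<close> bounds from below.\<close>

lemma param_contraction:
  assumes W: "is_interval W" "W \<subseteq> Ge (i + n)" and N: "N \<le> i" and aa: "a \<in> W" "a' \<in> W"
  shows "\<sigma> ^ n * \<bar>x i a - x i a'\<bar> \<le> \<bar>x (i + n) a - x (i + n) a'\<bar>"
proof -
  have *: "\<sigma> ^ n * \<bar>x i a - x i a'\<bar> \<le> \<bar>x (i + n) a - x (i + n) a'\<bar>" if aa: "a \<in> W" "a' \<in> W" "a < a'" for a a'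
  proof -
    have inW: "s \<in> Ge (i + n)" if "a \<le> s" "s \<le> a'" for s
      using W aa that unfolding is_interval_1 by blast
    have inW2: "s \<in> Ge i" if "a \<le> s" "s \<le> a'" for s using inW[OF that] G_antimono[of i "i + n"] by auto
    have "\<exists>s>a. s < a' \<and> (x (i+n) a' - x (i+n) a) * x' i s = (x i a' - x i a) * x' (i+n) s"
    proof (rule GMVT'[OF aa(3)])
      show "isCont (x (i + n)) z" "isCont (x i) z" if "a \<le> z" "z \<le> a'" for z
        using x_isCont Ge_G1 inW[OF that] inW2[OF that] by auto
      show "(x i has_real_derivative x' i z) (at z)" "(x (i + n) has_real_derivative x' (i + n) z) (at z)"
        if "a < z" "z < a'" for z
        using x_derivative Ge_G1 inW[of z] inW2[of z] that by auto
    qed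
    then obtain s where s: "a < s" "s < a'" "(x (i+n) a' - x (i+n) a) * x' i s = (x i a' - x i a) * x' (i+n) s"
      by blast
    have "s \<in> Ge (i + n)" using inW s by auto
    then have g: "\<sigma> ^ n * \<bar>x' i s\<bar> \<le> \<bar>x' (i + n) s\<bar>" by (rule growth[OF N])
    have pos: "0 < \<bar>x' i s\<bar>" using x'_ge_\<kappa>[OF N inW2[of s]] s \<kappa> by auto
    have "\<sigma> ^ n * \<bar>x i a - x i a'\<bar> * \<bar>x' i s\<bar> = \<bar>x i a' - x i a\<bar> * (\<sigma> ^ n * \<bar>x' i s\<bar>)"
      by (simp add: abs_minus_commute)
    also have "\<dots> \<le> \<bar>x i a' - x i a\<bar> * \<bar>x' (i + n) s\<bar>" by (rule mult_left_mono[OF g]) simp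
    also have "\<dots> = \<bar>x (i+n) a - x (i+n) a'\<bar> * \<bar>x' i s\<bar>"
      using s(3) by (metis abs_minus_commute abs_mult)
    finally show ?thesis using pos by simp
  qed
  show ?thesis using *[of a a'] *[of a' a] aa by (cases a a' rule: linorder_cases) (auto simp: abs_minus_commute)
qed

lemma param_mvt:
  assumes W: "is_interval W" "W \<subseteq> Ge j" and aa: "a \<in> W" "a' \<in> W"
  obtains s where "s \<in> W" "\<bar>x j a - x j a'\<bar> = \<bar>x' j s\<bar> * \<bar>a - a'\<bar>"
proof -
  have *: "\<exists>s\<in>W. \<bar>x j a - x j a'\<bar> = \<bar>x' j s\<bar> * \<bar>a - a'\<bar>" if aa: "a \<in> W" "a' \<in> W" "a < a'" for a a'
  proof -
    have inW: "s \<in> W" if "a \<le> s" "s \<le> a'" for s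
      using W aa that unfolding is_interval_1 by blast
    obtain s where s: "a < s" "s < a'" "x j a' - x j a = (a' - a) * x' j s"
      using MVT2[OF aa(3), of "x j" "x' j"] x_derivative Ge_G1 inW W(2) by (metis subsetD)
    have "\<bar>x j a - x j a'\<bar> = \<bar>x' j s\<bar> * \<bar>a - a'\<bar>"
      using s(3) by (metis abs_minus_commute abs_mult mult.commute)
    then show ?thesis using inW[of s] s by auto
  qed
  have "\<exists>s\<in>W. \<bar>x j a - x j a'\<bar> = \<bar>x' j s\<bar> * \<bar>a - a'\<bar>"
    using *[of a a'] *[of a' a] aa by (cases a a' rule: linorder_cases) (auto simp: abs_minus_commute)
  then show thesis using that by blast
qed

text \<open>The rate at which the derivative of the family varies along backward orbits: an \<open>\<alpha>\<close>-Hoelder function of points contracted by \<open>1 / \<sigma>\<close>.\<close>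

definition \<theta> :: real where "\<theta> = (1 / \<sigma>) powr \<alpha>"

lemma \<theta>: "0 < \<theta>" "\<theta> < 1"
  using \<sigma> \<alpha> powr_less_mono2[of \<alpha> "1 / \<sigma>" 1] by (auto simp: \<theta>_def)

text \<open>\<open>D0 / \<kappa>\<close> accounts for the first \<open>N\<close> steps; the exponent is the sum of the contributions of the later steps in \<open>ratio_step\<close>.\<close>

definition Dist :: real where
  "Dist = D0 / \<kappa> * exp (joint_const * 2 powr \<alpha> / (1 - \<theta>) + 2 * M / (1 - 1 / \<sigma>))"

lemma D0: "\<kappa> \<le> D0"
  using start[of "e1 / 2"] e1 by auto

lemma Dist_ge_1: "1 \<le> Dist"
proof -
  have "1 \<le> D0 / \<kappa>" using D0 \<kappa> by simp
  moreover have "0 \<le> joint_const * 2 powr \<alpha> / (1 - \<theta>) + 2 * M / (1 - 1 / \<sigma>)"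
    using joint_const_nonneg \<theta> M \<sigma> by (intro add_nonneg_nonneg divide_nonneg_nonneg mult_nonneg_nonneg) auto
  then have "1 \<le> exp (joint_const * 2 powr \<alpha> / (1 - \<theta>) + 2 * M / (1 - 1 / \<sigma>))" by simp
  ultimately show ?thesis unfolding Dist_def using mult_mono[of 1 "D0 / \<kappa>" 1] by force
qed

text \<open>The quotient \<open>x' (i + 1) / x' i\<close> is \<open>deriv (T a) (x i a)\<close> plus a term of order \<open>M / x' i\<close>. The second one is small since
  \<open>x' i\<close> grows from time \<open>N\<close> on. The first one varies little over \<open>W\<close>, because \<open>W\<close> survives for \<open>m + 1\<close> further steps, so that
  the orbits over it are within \<open>(1 / \<sigma>) ^ (m + 1)\<close> of each other at time \<open>i\<close>.\<close>

lemma ratio_step: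
  assumes W: "is_interval W" "W \<subseteq> Ge (i + Suc m)" and N: "N \<le> i" and aa: "a \<in> W" "a' \<in> W"
  shows "\<bar>x' (Suc i) a\<bar> * \<bar>x' i a'\<bar> \<le> \<bar>x' i a\<bar> * \<bar>x' (Suc i) a'\<bar> * exp (joint_const * 2 powr \<alpha> * \<theta> ^ Suc m + 2 * M * (1 / \<sigma>) ^ (i - N))"
proof -
  have WS: "W \<subseteq> Ge (Suc i)" "W \<subseteq> Ge i" using W(2) G_antimono[of "Suc i" "i + Suc m" e1] G_antimono[of "i" "i + Suc m" e1] by auto
  have Ga: "a \<in> Ge (Suc i)" "a' \<in> Ge (Suc i)" "a \<in> Ge i" "a' \<in> Ge i" using WS aa by auto
  have a01: "a \<in> {0<..<1}" "a' \<in> {0<..<1}" using G_D[OF Ge_G1[OF Ga(1)]] G_D[OF Ge_G1[OF Ga(2)]] by auto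
  have "x i a \<in> {0..1}" using x_unit[of a] a01 by auto
  then obtain k where k: "k \<in> {1..p0}" "x i a \<in> branch b k a"
    using in_some_branch[of a "x i a"] a01 Ga(1) by (auto simp: G_Suc)
  have WS1: "W \<subseteq> G 1 (Suc i)" using WS Ge_G1 by auto
  have k': "x i a' \<in> branch b k a'" by (rule same_branch[OF W(1) WS1 aa k])
  define R where "R s = deriv (T s) (x i s) + param_deriv T s (x i s) / x' i s" for s
  have pos: "\<kappa> * \<sigma> ^ (i - N) \<le> \<bar>x' i s\<bar>" "0 < \<bar>x' i s\<bar>" if "s \<in> W" for s
  proof -
    have "s \<in> Ge i" using that WS by auto
    then show "\<kappa> * \<sigma> ^ (i - N) \<le> \<bar>x' i s\<bar>" "0 < \<bar>x' i s\<bar>" using x'_ge[OF N] x'_ge_\<kappa>[OF N] \<kappa> by fastforce+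
  qed
  have R: "x' (Suc i) s = R s * x' i s" if "s \<in> W" for s
    using x'_Suc[of s i] WS1 that pos(2)[OF that] by (auto simp: R_def field_simps)
  have Rlow: "1 \<le> \<bar>R s\<bar>" if "s \<in> W" for s
  proof -
    have "s \<in> Ge (i + 1)" using that WS by auto
    then have "\<sigma> ^ 1 * \<bar>x' i s\<bar> \<le> \<bar>x' (i + 1) s\<bar>" by (rule growth[OF N])
    then have "\<sigma> * \<bar>x' i s\<bar> \<le> \<bar>R s\<bar> * \<bar>x' i s\<bar>" using R[OF that] by (simp add: abs_mult)
    then have "\<sigma> \<le> \<bar>R s\<bar>" using pos(2)[OF that] by simp
    then show ?thesis using \<sigma> by simp
  qed
  have small: "\<bar>x i a - x i a'\<bar> \<le> (1 / \<sigma>) ^ Suc m"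
  proof -
    have "\<sigma> ^ Suc m * \<bar>x i a - x i a'\<bar> \<le> \<bar>x (i + Suc m) a - x (i + Suc m) a'\<bar>"
      by (rule param_contraction[OF W N aa])
    also have "\<dots> \<le> 1" using x_unit[of a "i + Suc m"] x_unit[of a' "i + Suc m"] a01 by auto
    finally show ?thesis using \<sigma> by (simp add: power_one_over field_simps)
  qed
  \<comment> \<open>The parameters are no further apart than the orbit points, so that the latter alone govern the Hoelder bound.\<close>
  have pd: "\<bar>a - a'\<bar> \<le> \<bar>x i a - x i a'\<bar>"
  proof -
    obtain s where s: "s \<in> W" "\<bar>x i a - x i a'\<bar> = \<bar>x' i s\<bar> * \<bar>a - a'\<bar>" by (rule param_mvt[OF W(1) WS(2) aa])
    have "1 \<le> \<bar>x' i s\<bar>" using x'_ge_\<kappa>[OF N] WS s(1) \<kappa>(1) by force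
    then show ?thesis using s(2) mult_right_mono[of 1 "\<bar>x' i s\<bar>" "\<bar>a - a'\<bar>"] by simp
  qed
  have t1: "\<bar>deriv (T a) (x i a) - deriv (T a') (x i a')\<bar> \<le> joint_const * 2 powr \<alpha> * \<theta> ^ Suc m"
  proof -
    have "4 * L * \<bar>a - a'\<bar> < gap"
    proof -
      have "\<bar>a - a'\<bar> \<le> e1" using G_D[OF Ga(1)] G_D[OF Ga(2)] by auto
      then have "4 * L * \<bar>a - a'\<bar> \<le> 4 * L * e1" using L by (intro mult_left_mono) auto
      then show ?thesis using e1 by simp
    qed
    then have "\<bar>deriv (T a) (x i a) - deriv (T a') (x i a')\<bar> \<le> joint_const * (\<bar>a - a'\<bar> + \<bar>x i a - x i a'\<bar>) powr \<alpha>"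
      by (rule T'_joint_holder[OF k(1) a01 _ k(2) k'])
    also have "\<dots> \<le> joint_const * (2 * (1 / \<sigma>) ^ Suc m) powr \<alpha>"
    proof (rule mult_left_mono[OF _ joint_const_nonneg], rule powr_mono2)
      show "\<bar>a - a'\<bar> + \<bar>x i a - x i a'\<bar> \<le> 2 * (1 / \<sigma>) ^ Suc m" using pd small by linarith
    qed (use \<alpha> in auto)
    also have "(2 * (1 / \<sigma>) ^ Suc m) powr \<alpha> = 2 powr \<alpha> * \<theta> ^ Suc m"
    proof -
      have "((1 / \<sigma>) ^ Suc m) powr \<alpha> = ((1 / \<sigma>) powr real (Suc m)) powr \<alpha>"
        using \<sigma> by (subst powr_realpow) auto
      also have "\<dots> = ((1 / \<sigma>) powr \<alpha>) powr real (Suc m)" by (simp only: powr_powr mult.commute)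
      also have "\<dots> = \<theta> ^ Suc m" unfolding \<theta>_def using \<sigma> by (subst powr_realpow) auto
      finally show ?thesis by (simp only: powr_mult)
    qed
    finally show ?thesis by simp
  qed
  have t2: "\<bar>param_deriv T s (x i s) / x' i s\<bar> \<le> M * (1 / \<sigma>) ^ (i - N)" if "s \<in> W" "s \<in> {0<..<1}" "x i s \<in> branch b k s" for s
  proof -
    have "1 * \<sigma> ^ (i - N) \<le> \<kappa> * \<sigma> ^ (i - N)" using \<kappa> \<sigma> by (intro mult_right_mono) auto
    then have "\<sigma> ^ (i - N) \<le> \<bar>x' i s\<bar>" using pos(1)[OF that(1)] by simp
    then have "\<bar>param_deriv T s (x i s)\<bar> / \<bar>x' i s\<bar> \<le> M / \<sigma> ^ (i - N)"
      using P_bound[OF that(2) k(1) that(3)] \<sigma> M by (intro frac_le) auto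
    then show ?thesis by (simp add: divide_inverse abs_mult power_inverse)
  qed
  define \<epsilon> where "\<epsilon> = joint_const * 2 powr \<alpha> * \<theta> ^ Suc m + 2 * M * (1 / \<sigma>) ^ (i - N)"
  have eps0: "0 \<le> \<epsilon>" unfolding \<epsilon>_def using joint_const_nonneg \<theta> M \<sigma> by (intro add_nonneg_nonneg mult_nonneg_nonneg) auto
  have "\<bar>R a - R a'\<bar> \<le> \<epsilon>"
    using t1 t2[OF aa(1) a01(1) k(2)] t2[OF aa(2) a01(2) k'] unfolding R_def \<epsilon>_def by linarith
  then have "\<bar>R a\<bar> \<le> \<bar>R a'\<bar> + \<epsilon>" by linarith
  also have "\<dots> \<le> \<bar>R a'\<bar> * (1 + \<epsilon>)" using mult_right_mono[OF Rlow[OF aa(2)] eps0] by (simp add: algebra_simps)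
  also have "\<dots> \<le> \<bar>R a'\<bar> * exp \<epsilon>" by (intro mult_left_mono exp_ge_add_one_self) auto
  finally have "\<bar>R a\<bar> \<le> \<bar>R a'\<bar> * exp \<epsilon>" .
  then have "\<bar>R a\<bar> * (\<bar>x' i a\<bar> * \<bar>x' i a'\<bar>) \<le> \<bar>R a'\<bar> * exp \<epsilon> * (\<bar>x' i a\<bar> * \<bar>x' i a'\<bar>)"
    by (rule mult_right_mono) simp
  then show ?thesis unfolding R[OF aa(1)] R[OF aa(2)] \<epsilon>_def[symmetric] by (simp add: abs_mult mult_ac)
qed

text \<open>The step contributions form two geometric series, one decreasing towards the past of time \<open>j\<close> and one decreasing from time \<open>N\<close> on.\<close>

lemma distortion:
  assumes W: "is_interval W" "W \<subseteq> Ge j" and N: "N \<le> j" and aa: "a \<in> W" "a' \<in> W"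
  shows "\<bar>x' j a\<bar> \<le> Dist * \<bar>x' j a'\<bar>"
proof -
  define n where "n = j - N"
  have j: "j = N + n" using N by (simp add: n_def)
  define \<epsilon> where "\<epsilon> l = joint_const * 2 powr \<alpha> * \<theta> ^ (n - l) + 2 * M * (1 / \<sigma>) ^ l" for l
  have step: "\<bar>x' (N + l) a\<bar> * \<bar>x' N a'\<bar> \<le> \<bar>x' N a\<bar> * \<bar>x' (N + l) a'\<bar> * exp (\<Sum>i<l. \<epsilon> i)" if "l \<le> n" for l
    using that
  proof (induction l)
    case (Suc l)
    have "n - l = Suc (n - Suc l)" "N + n = (N + l) + Suc (n - Suc l)" using Suc.prems by auto
    then have r: "\<bar>x' (Suc (N + l)) a\<bar> * \<bar>x' (N + l) a'\<bar> \<le> \<bar>x' (N + l) a\<bar> * \<bar>x' (Suc (N + l)) a'\<bar> * exp (\<epsilon> l)"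
      using ratio_step[OF W(1), of "N + l" "n - Suc l" a a'] W(2) aa by (simp add: j \<epsilon>_def)
    have IH: "\<bar>x' (N + l) a\<bar> * \<bar>x' N a'\<bar> \<le> \<bar>x' N a\<bar> * \<bar>x' (N + l) a'\<bar> * exp (\<Sum>i<l. \<epsilon> i)" using Suc by simp
    have "a' \<in> Ge (N + l)" using aa W(2) G_antimono[of "N + l" "N + n" e1] Suc.prems by (auto simp: j)
    then have p: "0 < \<bar>x' (N + l) a'\<bar>" using x'_ge_\<kappa>[of "N + l" a'] \<kappa> by simp
    have "(\<bar>x' (Suc (N + l)) a\<bar> * \<bar>x' N a'\<bar>) * \<bar>x' (N + l) a'\<bar> = (\<bar>x' (Suc (N + l)) a\<bar> * \<bar>x' (N + l) a'\<bar>) * \<bar>x' N a'\<bar>" by simp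
    also have "\<dots> \<le> (\<bar>x' (N + l) a\<bar> * \<bar>x' (Suc (N + l)) a'\<bar> * exp (\<epsilon> l)) * \<bar>x' N a'\<bar>" by (rule mult_right_mono[OF r]) simp
    also have "\<dots> = (\<bar>x' (N + l) a\<bar> * \<bar>x' N a'\<bar>) * (\<bar>x' (Suc (N + l)) a'\<bar> * exp (\<epsilon> l))" by simp
    also have "\<dots> \<le> (\<bar>x' N a\<bar> * \<bar>x' (N + l) a'\<bar> * exp (\<Sum>i<l. \<epsilon> i)) * (\<bar>x' (Suc (N + l)) a'\<bar> * exp (\<epsilon> l))"
      by (rule mult_right_mono[OF IH]) simp
    also have "\<dots> = (\<bar>x' N a\<bar> * \<bar>x' (Suc (N + l)) a'\<bar> * exp (\<Sum>i<Suc l. \<epsilon> i)) * \<bar>x' (N + l) a'\<bar>"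
      by (simp add: exp_add mult_ac)
    finally show ?case using p by simp
  qed simp
  have sum: "(\<Sum>i<n. \<epsilon> i) \<le> joint_const * 2 powr \<alpha> / (1 - \<theta>) + 2 * M / (1 - 1 / \<sigma>)"
  proof -
    have "(\<Sum>i<n. \<epsilon> i) = joint_const * 2 powr \<alpha> * (\<Sum>i<n. \<theta> ^ (n - i)) + 2 * M * (\<Sum>i<n. (1 / \<sigma>) ^ i)"
      by (simp add: \<epsilon>_def sum.distrib sum_distrib_left)
    also have "(\<Sum>i<n. \<theta> ^ (n - i)) \<le> (\<Sum>i<n. \<theta> ^ i)"
    proof -
      have "(\<Sum>i<n. \<theta> ^ (n - i)) \<le> (\<Sum>i<n. \<theta> ^ (n - Suc i))" using \<theta> by (intro sum_mono power_decreasing) auto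
      also have "\<dots> = (\<Sum>i<n. \<theta> ^ i)" by (rule sum.nat_diff_reindex)
      finally show ?thesis .
    qed
    also have "\<dots> \<le> 1 / (1 - \<theta>)" by (rule geometric_partial_sum[OF \<theta>])
    also have "(\<Sum>i<n. (1 / \<sigma>) ^ i) \<le> 1 / (1 - 1 / \<sigma>)" by (rule geometric_partial_sum) (use \<sigma> in auto)
    finally show ?thesis using joint_const_nonneg M by (simp add: mult_left_mono)
  qed
  have aN: "a \<in> {0<..<e1}" "a' \<in> {0<..<e1}" using aa W(2) G_sub by blast+
  have "\<bar>x' j a\<bar> * \<kappa> \<le> \<bar>x' j a\<bar> * \<bar>x' N a'\<bar>" using start[OF aN(2)] by (intro mult_left_mono) auto
  also have "\<dots> \<le> \<bar>x' N a\<bar> * \<bar>x' j a'\<bar> * exp (\<Sum>i<n. \<epsilon> i)" using step[of n] by (simp add: j)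
  also have "\<dots> \<le> D0 * \<bar>x' j a'\<bar> * exp (joint_const * 2 powr \<alpha> / (1 - \<theta>) + 2 * M / (1 - 1 / \<sigma>))"
    using start[OF aN(1)] sum by (intro mult_mono) auto
  finally show ?thesis unfolding Dist_def using \<kappa> by (simp add: field_simps)
qed

text \<open>On a component of the parameter set at time \<open>j \<ge> N\<close>, the orbit point moves with speed at least \<open>\<kappa> > L\<close>, faster than any
  partition point. So it meets each of them at most once, and there are countably many components.\<close>

lemma countable_complement: "countable ({0<..<e1} - Ge j)"
proof (induction j)
  case 0 then show ?case by (simp add: G_0)
next
  case (Suc j)
  show ?case
  proof (cases "j < N")
    case True
    then have "Ge (Suc j) = {0<..<e1}" using N_off by (auto simp: G_def)
    then show ?thesis by simp
  next
    case False
    define Z where "Z W k = {a \<in> W. x j a = b k a}" for W k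
    have "Ge j - Ge (Suc j) \<subseteq> (\<Union>W\<in>components (Ge j). \<Union>k\<in>{0..p0}. Z W k)"
    proof
      fix a assume a: "a \<in> Ge j - Ge (Suc j)"
      then obtain k where "k \<in> {0..p0}" "x j a = b k a" by (auto simp: G_Suc part_pts_def)
      moreover obtain W where "W \<in> components (Ge j)" "a \<in> W" using a Union_components[of "Ge j"] by blast
      ultimately show "a \<in> (\<Union>W\<in>components (Ge j). \<Union>k\<in>{0..p0}. Z W k)" by (auto simp: Z_def)
    qed
    moreover have "countable (Z W k)" if W: "W \<in> components (Ge j)" and k: "k \<in> {0..p0}" for W k
    proof -
      note Wp = components_open_real[OF open_Ge W]
      have "a = a'" if "a \<in> Z W k" "a' \<in> Z W k" for a a'
      proof (rule ccontr)
        assume ne: "a \<noteq> a'"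
        have aa: "a \<in> W" "a' \<in> W" using that by (auto simp: Z_def)
        have a01: "a \<in> {0..1}" "a' \<in> {0..1}" using aa Wp(4) G_sub[of e1 j] e1 by force+
        obtain s where s: "s \<in> W" "\<bar>x j a - x j a'\<bar> = \<bar>x' j s\<bar> * \<bar>a - a'\<bar>" by (rule param_mvt[OF Wp(2,4) aa])
        have "\<kappa> \<le> \<bar>x' j s\<bar>" using x'_ge_\<kappa>[of j s] False s(1) Wp(4) by auto
        then have "L < \<bar>x' j s\<bar>" using \<kappa> by simp
        then have "L * \<bar>a - a'\<bar> < \<bar>x j a - x j a'\<bar>" unfolding s(2) using ne by (intro mult_strict_right_mono) auto
        also have "\<dots> = \<bar>b k a - b k a'\<bar>" using that by (simp add: Z_def)
        also have "\<dots> \<le> L * \<bar>a - a'\<bar>" using k by (intro b_lip a01) auto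
        finally show False by simp
      qed
      then have "finite (Z W k)"
        by (cases "Z W k = {}") (metis finite.emptyI, metis (full_types) equals0I finite.emptyI finite.insertI finite_subset insertCI subsetI)
      then show ?thesis by (rule countable_finite)
    qed
    moreover have "countable (\<Union>W\<in>components (Ge j). \<Union>k\<in>{0..p0}. Z W k)"
      using calculation(2) by (intro countable_UN countable_components_open open_Ge) auto
    ultimately have "countable (Ge j - Ge (Suc j))" by (meson countable_subset)
    moreover have "{0<..<e1} - Ge (Suc j) \<subseteq> ({0<..<e1} - Ge j) \<union> (Ge j - Ge (Suc j))" by auto
    ultimately show ?thesis using Suc.IH by (meson countable_Un countable_subset)
  qed
qed

end

section \<open>Visits within one parameter interval\<close>

text \<open>\<open>pre\<close> is the conclusion of \<open>preimage_measure_bound\<close>, with constants that are uniform in the parameter.\<close>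

locale expanding_near_0_transfer = expanding_near_0 +
  fixes Kc \<rho> :: real
  assumes Kc: "0 \<le> Kc" and \<rho>: "0 < \<rho>" "\<rho> < 1"
    and pre: "\<And>a n W E. a \<in> {0<..<e1} \<Longrightarrow> is_interval W \<Longrightarrow> W \<in> sets borel \<Longrightarrow> W \<subseteq> {0..1} \<Longrightarrow> E \<in> sets borel \<Longrightarrow> E \<subseteq> {0..1} \<Longrightarrow>
       {y\<in>W. (T a ^^ n) y \<in> E} \<in> sets borel \<and>
       measure lborel {y\<in>W. (T a ^^ n) y \<in> E} \<le> Kc * (\<rho> ^ n + measure lborel W) * measure lborel E"
begin

lemma Lam: "1 \<le> Lam"
proof -
  have h: "(1/2::real) \<in> {0..1}" by simp
  have "p0 \<noteq> 0" using b_ends[OF h] by (intro notI) auto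
  then have k: "1 \<in> {1..p0}" by simp
  have "b 0 (1/2) + gap \<le> b 1 (1/2)" using gap(2)[OF h k] by simp
  then have "(b 0 (1/2) + b 1 (1/2)) / 2 \<in> branch b 1 (1/2)" using gap(1) by (auto simp: branch_def)
  then show ?thesis using T'_bounds[OF h k] lam by fastforce
qed

lemma T_iter_unit: "a \<in> {0..1} \<Longrightarrow> y \<in> {0..1} \<Longrightarrow> (T a ^^ i) y \<in> {0..1}"
  by (induction i) (simp_all del: atLeastAtMost_iff add: T_unit)

lemma T_lipschitz_branch:
  assumes a: "a \<in> {0..1}" and k: "k \<in> {1..p0}" and zy: "z \<in> branch b k a" "y \<in> branch b k a"
  shows "\<bar>T a z - T a y\<bar> \<le> Lam * \<bar>z - y\<bar>"
proof -
  have *: "\<bar>T a z - T a y\<bar> \<le> Lam * \<bar>z - y\<bar>" if zy: "z < y" "z \<in> branch b k a" "y \<in> branch b k a" for z y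
  proof -
    have inb: "w \<in> branch b k a" if "z \<le> w" "w \<le> y" for w using that zy by (auto simp: branch_def)
    obtain w where w: "z < w" "w < y" "T a y - T a z = (y - z) * deriv (T a) w"
      using MVT2[OF zy(1), of "T a" "deriv (T a)"] T_der[OF a k inb] by blast
    have "\<bar>T a z - T a y\<bar> = \<bar>deriv (T a) w\<bar> * \<bar>z - y\<bar>" using w(3) by (metis abs_minus_commute abs_mult mult.commute)
    also have "\<dots> \<le> Lam * \<bar>z - y\<bar>" using T'_bounds[OF a k inb] w by (intro mult_right_mono) auto
    finally show ?thesis .
  qed
  show ?thesis using *[of z y] *[of y z] zy by (cases z y rule: linorder_cases) (auto simp: abs_minus_commute)
qed

lemma T_lipschitz_param:
  assumes a: "a \<in> {0<..<1}" "a0 \<in> {0<..<1}" and k: "k \<in> {1..p0}"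
    and y: "\<And>s. min a a0 \<le> s \<Longrightarrow> s \<le> max a a0 \<Longrightarrow> y \<in> branch b k s"
  shows "\<bar>T a y - T a0 y\<bar> \<le> M * \<bar>a - a0\<bar>"
proof (cases "a = a0")
  case False
  define s t where "s = min a a0" and "t = max a a0"
  have st: "s < t" using False by (auto simp: s_def t_def)
  have d: "((\<lambda>r. T r y) has_real_derivative param_deriv T w y) (at w)" if "s \<le> w" "w \<le> t" for w
  proof -
    have "w \<in> {0<..<1}" using that a by (auto simp: s_def t_def)
    then show ?thesis using T_param[OF _ k y[of w]] that by (simp add: s_def t_def)
  qed
  obtain w where w: "s < w" "w < t" "T t y - T s y = (t - s) * param_deriv T w y"
    using MVT2[OF st, of "\<lambda>r. T r y" "\<lambda>w. param_deriv T w y"] d by blast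
  have "\<bar>T a y - T a0 y\<bar> = \<bar>T t y - T s y\<bar>" "\<bar>a - a0\<bar> = \<bar>t - s\<bar>"
    by (auto simp: s_def t_def min_def max_def)
  moreover have "\<bar>param_deriv T w y\<bar> \<le> M"
  proof -
    have "w \<in> {0<..<1}" using w a by (auto simp: s_def t_def)
    then show ?thesis using P_bound[OF _ k y[of w]] w by (simp add: s_def t_def)
  qed
  then have "\<bar>t - s\<bar> * \<bar>param_deriv T w y\<bar> \<le> \<bar>t - s\<bar> * M" by (rule mult_left_mono) simp
  ultimately show ?thesis using w(3) by (simp add: abs_mult mult.commute)
qed simp

text \<open>As long as the orbit of \<open>y\<close> under \<open>T a0\<close> stays further from the partition points than the accumulated error plus their
  own displacement, both orbits use the same branches, and one step multiplies the error by at most \<open>Lam\<close> and adds at most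
  \<open>M * d\<close>.\<close>

lemma shadowing:
  assumes a: "a0 \<in> {0<..<1}" "a \<in> {0<..<1}" and d: "\<bar>a - a0\<bar> \<le> d" and y: "y \<in> {0..1}"
    and far: "\<And>i k. i < m \<Longrightarrow> k \<le> p0 \<Longrightarrow> (M * (1 + Lam) ^ i + L) * d < \<bar>(T a0 ^^ i) y - b k a0\<bar>"
  shows "i \<le> m \<Longrightarrow> \<bar>(T a ^^ i) y - (T a0 ^^ i) y\<bar> \<le> M * (1 + Lam) ^ i * d"
proof (induction i)
  case 0 then show ?case using M d by simp
next
  case (Suc i)
  have a01: "a0 \<in> {0..1}" "a \<in> {0..1}" using a by auto
  define Y Z where "Y = (T a0 ^^ i) y" and "Z = (T a ^^ i) y"
  define \<eta> where "\<eta> = M * (1 + Lam) ^ i * d"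
  have IH: "\<bar>Z - Y\<bar> \<le> \<eta>" using Suc by (simp add: Y_def Z_def \<eta>_def)
  have d0: "0 \<le> d" using d by linarith
  have \<eta>0: "0 \<le> \<eta>" using M Lam d0 by (simp add: \<eta>_def)
  have Ld: "0 \<le> L * d" using L d0 by simp
  have fr: "\<eta> + L * d < \<bar>Y - b k a0\<bar>" if "k \<le> p0" for k
    using far[of i k] Suc.prems that by (simp add: Y_def \<eta>_def distrib_right)
  have Yu: "Y \<in> {0..1}" unfolding Y_def by (rule T_iter_unit[OF a01(1) y])
  have "Y \<notin> part_pts p0 b a0"
  proof
    assume "Y \<in> part_pts p0 b a0"
    then obtain k where "k \<le> p0" "Y = b k a0" by (auto simp: part_pts_def)
    then show False using fr[of k] \<eta>0 Ld by simp
  qed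
  then obtain k where k: "k \<in> {1..p0}" "Y \<in> branch b k a0" using in_some_branch[OF a01(1) Yu] by blast
  have kk: "k \<le> p0" using k(1) by simp
  have inb: "Y \<in> branch b k s \<and> Z \<in> branch b k s" if s: "min a a0 \<le> s" "s \<le> max a a0" for s
  proof -
    have s01: "s \<in> {0..1}" using s a01 by auto
    have "\<bar>s - a0\<bar> \<le> d" using s d by auto
    then have "L * \<bar>s - a0\<bar> \<le> L * d" using L by (rule mult_left_mono)
    then have b1: "\<bar>b k s - b k a0\<bar> \<le> L * d" and b2: "\<bar>b (k - 1) s - b (k - 1) a0\<bar> \<le> L * d"
      using b_lip[OF kk s01 a01(1)] b_lip[OF pred_le[OF k(1)] s01 a01(1)] by linarith+
    have Yb: "b (k - 1) a0 < Y" "Y < b k a0" using k(2) by (auto simp: branch_def)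
    have f1: "\<eta> + L * d < b k a0 - Y" using fr[OF kk] Yb by simp
    have f2: "\<eta> + L * d < Y - b (k - 1) a0" using fr[OF pred_le[OF k(1)]] Yb by simp
    have "b (k - 1) s < Y \<and> Y < b k s \<and> b (k - 1) s < Z \<and> Z < b k s"
      using b1 b2 f1 f2 IH \<eta>0 by linarith
    then show ?thesis by (simp add: branch_def)
  qed
  have "\<bar>T a Z - T a Y\<bar> \<le> Lam * \<bar>Z - Y\<bar>"
    using T_lipschitz_branch[OF a01(2) k(1)] inb[of a] by auto
  also have "\<dots> \<le> Lam * \<eta>" using IH Lam by (intro mult_left_mono) auto
  finally have 1: "\<bar>T a Z - T a Y\<bar> \<le> Lam * \<eta>" .
  have "\<bar>T a Y - T a0 Y\<bar> \<le> M * \<bar>a - a0\<bar>" by (rule T_lipschitz_param[OF a(2,1) k(1)]) (use inb in blast)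
  also have "\<dots> \<le> M * d" using d M by (rule mult_left_mono)
  finally have 2: "\<bar>T a Y - T a0 Y\<bar> \<le> M * d" .
  have "M * d * 1 \<le> M * d * (1 + Lam) ^ i" using M d0 Lam by (intro mult_left_mono one_le_power) auto
  then have "Lam * \<eta> + M * d \<le> M * (1 + Lam) ^ Suc i * d" by (simp add: \<eta>_def algebra_simps)
  then show ?case using 1 2 by (simp add: Y_def Z_def)
qed

lemma visit_borel:
  assumes "open U"
  shows "{a\<in>U \<inter> Ge j. x j a \<in> {u..v}} \<in> sets borel"
proof -
  have "continuous_on (U \<inter> Ge j) (x j)"
    by (intro continuous_at_imp_continuous_on ballI x_isCont Ge_G1) auto
  then have "x j \<in> borel_measurable (restrict_space borel (U \<inter> Ge j))"
    by (rule borel_measurable_continuous_on_restrict)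
  then have "x j -` {u..v} \<inter> space (restrict_space borel (U \<inter> Ge j)) \<in> sets (restrict_space borel (U \<inter> Ge j))"
    by (rule measurable_sets) simp
  moreover have "U \<inter> Ge j \<in> sets borel" using assms open_Ge by auto
  ultimately have "x j -` {u..v} \<inter> (U \<inter> Ge j) \<in> sets borel"
    by (simp add: space_restrict_space sets_restrict_space_iff)
  moreover have "x j -` {u..v} \<inter> (U \<inter> Ge j) = {a\<in>U \<inter> Ge j. x j a \<in> {u..v}}" by auto
  ultimately show ?thesis by simp
qed

text \<open>Throughout, \<open>U\<close> is an interval of the parameter partition at a time \<open>q \<ge> N\<close>, and \<open>W\<close> the interval of phase space that the orbits over \<open>U\<close> fill at time \<open>q\<close>.\<close>

context
  fixes q :: nat and U :: "real set"
  assumes q: "N \<le> q" and U: "U \<in> components (Ge q)"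
begin

abbreviation W where "W \<equiv> x q ` U"

lemma U_facts: "open U" "is_interval U" "U \<noteq> {}" "U \<subseteq> Ge q" "U \<in> sets borel" "U \<subseteq> {0<..<e1}" "U \<subseteq> {0..1}"
proof -
  show "open U" "is_interval U" "U \<noteq> {}" "U \<subseteq> Ge q" "U \<in> sets borel"
    using components_open_real[OF open_Ge U] by auto
  show s: "U \<subseteq> {0<..<e1}" using \<open>U \<subseteq> Ge q\<close> G_sub by blast
  show "U \<subseteq> {0..1}" using s e1 by force
qed

lemma U_cont: "continuous_on U (x q)"
  by (intro continuous_at_imp_continuous_on ballI x_isCont Ge_G1) (use U_facts(4) in auto)

lemma U_expand:
  assumes "a0 \<in> U" "a \<in> U" "a' \<in> U"
  shows "\<bar>x' q a0\<bar> / Dist * \<bar>a - a'\<bar> \<le> \<bar>x q a - x q a'\<bar>" "\<bar>x q a - x q a'\<bar> \<le> Dist * \<bar>x' q a0\<bar> * \<bar>a - a'\<bar>"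
proof -
  obtain s where s: "s \<in> U" "\<bar>x q a - x q a'\<bar> = \<bar>x' q s\<bar> * \<bar>a - a'\<bar>"
    by (rule param_mvt[OF U_facts(2,4) assms(2,3)])
  have "\<bar>x' q a0\<bar> \<le> Dist * \<bar>x' q s\<bar>" by (rule distortion[OF U_facts(2,4) q assms(1) s(1)])
  then have "\<bar>x' q a0\<bar> / Dist \<le> \<bar>x' q s\<bar>" using Dist_ge_1 by (simp add: field_simps)
  then show "\<bar>x' q a0\<bar> / Dist * \<bar>a - a'\<bar> \<le> \<bar>x q a - x q a'\<bar>" unfolding s(2) by (rule mult_right_mono) simp
  have "\<bar>x' q s\<bar> \<le> Dist * \<bar>x' q a0\<bar>" by (rule distortion[OF U_facts(2,4) q s(1) assms(1)])
  then show "\<bar>x q a - x q a'\<bar> \<le> Dist * \<bar>x' q a0\<bar> * \<bar>a - a'\<bar>" unfolding s(2) by (rule mult_right_mono) simp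
qed

lemma x'_ge_1: "a0 \<in> U \<Longrightarrow> 1 \<le> \<bar>x' q a0\<bar>"
  using x'_ge_\<kappa>[OF q] U_facts(4) \<kappa>(1) by force

lemma W_facts: "is_interval W" "W \<in> sets borel" "W \<subseteq> {0..1}"
proof -
  have "connected W" using U_facts(2) by (intro connected_continuous_image U_cont) (simp add: is_interval_connected_1)
  then show "is_interval W" by (simp add: is_interval_connected_1)
  show "W \<subseteq> {0..1}" using x_unit[of _ q] U_facts(7) by (meson image_subsetI subsetD)
  have "inj_on (x q) U"
  proof (rule inj_onI)
    fix a a' assume aa: "a \<in> U" "a' \<in> U" "x q a = x q a'"
    have "\<bar>x' q a\<bar> / Dist * \<bar>a - a'\<bar> \<le> 0" using U_expand(1)[OF aa(1) aa(1,2)] aa(3) by simp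
    moreover have "0 < \<bar>x' q a\<bar> / Dist" using x'_ge_1[OF aa(1)] Dist_ge_1 by (intro divide_pos_pos) auto
    ultimately have "\<bar>a - a'\<bar> \<le> 0" by (metis abs_ge_zero mult_pos_pos not_le)
    then show "a = a'" by simp
  qed
  then have "open W" by (intro injective_into_1d_imp_open_map_UNIV[OF U_facts(1) U_cont]) auto
  then show "W \<in> sets borel" by (rule borel_open)
qed

text \<open>The map \<open>x q\<close> from \<open>U\<close> to \<open>W\<close> stretches by \<open>\<bar>x' q a0\<bar>\<close> up to the distortion constant.\<close>

lemma U_W_measure:
  assumes a0: "a0 \<in> U"
  shows "measure lborel U \<le> Dist / \<bar>x' q a0\<bar> * measure lborel W"
    "measure lborel W \<le> Dist * \<bar>x' q a0\<bar> * measure lborel U"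
proof -
  have p: "0 < \<bar>x' q a0\<bar> / Dist" using x'_ge_1[OF a0] Dist_ge_1 by (intro divide_pos_pos) auto
  show "measure lborel U \<le> Dist / \<bar>x' q a0\<bar> * measure lborel W"
  proof (rule measure_le_diameter[OF U_facts(5,7)])
    show "0 \<le> Dist / \<bar>x' q a0\<bar> * measure lborel W" using Dist_ge_1 by simp
    fix a a' assume aa: "a \<in> U" "a' \<in> U"
    have "\<bar>x' q a0\<bar> / Dist * \<bar>a - a'\<bar> \<le> measure lborel W"
      using U_expand(1)[OF a0 aa] borel_interval_measure_bound[OF W_facts(1,3,2), of "x q a" "x q a'"] aa by force
    then show "\<bar>a - a'\<bar> \<le> Dist / \<bar>x' q a0\<bar> * measure lborel W"
      using x'_ge_1[OF a0] Dist_ge_1 by (simp add: field_simps)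
  qed
  show "measure lborel W \<le> Dist * \<bar>x' q a0\<bar> * measure lborel U"
  proof (rule measure_le_diameter[OF W_facts(2,3)])
    show "0 \<le> Dist * \<bar>x' q a0\<bar> * measure lborel U" using Dist_ge_1 by simp
    fix w w' assume "w \<in> W" "w' \<in> W"
    then obtain a a' where aa: "a \<in> U" "a' \<in> U" "w = x q a" "w' = x q a'" by blast
    have "\<bar>w - w'\<bar> \<le> Dist * \<bar>x' q a0\<bar> * \<bar>a - a'\<bar>" using U_expand(2)[OF a0 aa(1,2)] aa by simp
    also have "\<dots> \<le> Dist * \<bar>x' q a0\<bar> * measure lborel U"
      using borel_interval_measure_bound[OF U_facts(2,7,5) aa(1,2)] Dist_ge_1 by (intro mult_left_mono) auto
    finally show "\<bar>w - w'\<bar> \<le> Dist * \<bar>x' q a0\<bar> * measure lborel U" .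
  qed
qed

lemma W_pos: "0 < measure lborel W"
proof -
  obtain a0 where a0: "a0 \<in> U" using U_facts(3) by blast
  have "0 < measure lborel U" by (rule measure_component_pos[OF open_Ge U U_facts(7)])
  then have "0 < Dist / \<bar>x' q a0\<bar> * measure lborel W" using U_W_measure(1)[OF a0] by linarith
  then show ?thesis using Dist_ge_1 by (auto simp: zero_less_mult_iff zero_less_divide_iff)
qed

lemma W_le_1: "measure lborel W \<le> 1"
  by (rule measure_le_diameter[OF W_facts(2,3)]) (use W_facts(3) in \<open>auto simp: subset_iff abs_le_iff, fastforce+\<close>)

lemma U_small: "measure lborel U \<le> (1 / \<sigma>) ^ (q - N)"
proof (rule measure_le_diameter[OF U_facts(5,7)])
  show "0 \<le> (1 / \<sigma>) ^ (q - N)" using \<sigma> by simp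
  fix a a' assume aa: "a \<in> U" "a' \<in> U"
  obtain s where s: "s \<in> U" "\<bar>x q a - x q a'\<bar> = \<bar>x' q s\<bar> * \<bar>a - a'\<bar>" by (rule param_mvt[OF U_facts(2,4) aa])
  have "1 * \<sigma> ^ (q - N) \<le> \<kappa> * \<sigma> ^ (q - N)" using \<kappa> \<sigma> by (intro mult_right_mono) auto
  then have "\<sigma> ^ (q - N) \<le> \<bar>x' q s\<bar>" using x'_ge[OF q, of s] s(1) U_facts(4) by auto
  then have "\<sigma> ^ (q - N) * \<bar>a - a'\<bar> \<le> \<bar>x q a - x q a'\<bar>" unfolding s(2) by (rule mult_right_mono) simp
  also have "\<dots> \<le> 1"
  proof -
    have "x q a \<in> {0..1}" "x q a' \<in> {0..1}" using aa U_facts(7) x_unit by blast+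
    then show ?thesis by auto
  qed
  finally show "\<bar>a - a'\<bar> \<le> (1 / \<sigma>) ^ (q - N)" using \<sigma> by (simp add: power_one_over field_simps)
qed

text \<open>The preimage bound for the single map \<open>T a0\<close> on \<open>W\<close>, carried back to \<open>U\<close>: bounded distortion turns proportions of \<open>W\<close> into proportions of \<open>U\<close>.\<close>

lemma pull_back:
  assumes a0: "a0 \<in> U" and E: "E \<in> sets borel" "E \<subseteq> {0..1}"
  shows "{a\<in>U. x q a \<in> {y\<in>W. (T a0 ^^ n) y \<in> E}} \<in> sets borel"
    "measure lborel {a\<in>U. x q a \<in> {y\<in>W. (T a0 ^^ n) y \<in> E}} \<le>
      Dist\<^sup>2 * measure lborel U / measure lborel W * (Kc * (\<rho> ^ n + measure lborel W) * measure lborel E)"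
proof -
  let ?S = "{y\<in>W. (T a0 ^^ n) y \<in> E}"
  have a0': "a0 \<in> {0<..<e1}" using a0 U_facts(6) by blast
  note P = pre[OF a0' W_facts E, of n]
  have p: "0 < \<bar>x' q a0\<bar> / Dist" using x'_ge_1[OF a0] Dist_ge_1 by (intro divide_pos_pos) auto
  have S: "?S \<in> sets borel" "?S \<subseteq> {0..1}" using P W_facts(3) by auto
  note I = measure_preimage_expanding[OF U_facts(5,7) U_cont p U_expand(1)[OF a0] S]
  show "{a\<in>U. x q a \<in> ?S} \<in> sets borel" by (rule I(1))
  have "measure lborel {a\<in>U. x q a \<in> ?S} \<le> measure lborel ?S / (\<bar>x' q a0\<bar> / Dist)" by (rule I(2))
  also have "\<dots> = Dist / \<bar>x' q a0\<bar> * measure lborel ?S" by simp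
  also have "\<dots> \<le> Dist\<^sup>2 * measure lborel U / measure lborel W * (Kc * (\<rho> ^ n + measure lborel W) * measure lborel E)"
  proof (rule mult_mono)
    show "Dist / \<bar>x' q a0\<bar> \<le> Dist\<^sup>2 * measure lborel U / measure lborel W"
      using U_W_measure(2)[OF a0] x'_ge_1[OF a0] W_pos Dist_ge_1
      by (simp add: field_simps power2_eq_square)
  qed (use P Dist_ge_1 in auto)
  finally show "measure lborel {a\<in>U. x q a \<in> ?S} \<le> Dist\<^sup>2 * measure lborel U / measure lborel W * (Kc * (\<rho> ^ n + measure lborel W) * measure lborel E)" .
qed

text \<open>The error of \<open>shadowing\<close> after \<open>m\<close> steps for two parameters in \<open>U\<close>, together with the displacement of the partition points.\<close>

definition \<eta> :: "nat \<Rightarrow> real" where "\<eta> m = (M * (1 + Lam) ^ m + L) * measure lborel U"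

lemma \<eta>_nonneg: "0 \<le> \<eta> m" using M L Lam by (simp add: \<eta>_def)

text \<open>Fix \<open>a0\<close> in \<open>U\<close> and compare \<open>T a\<close> with \<open>T a0\<close> on \<open>W\<close>. Unless the orbit of \<open>x q a\<close> under \<open>T a0\<close> comes within \<open>\<eta> m\<close> of a partition
  point during the \<open>m\<close> steps, it ends within \<open>\<eta> m\<close> of \<open>x (q + m) a\<close>. So a visit to \<open>{u..v}\<close> forces a visit under \<open>T a0\<close> to
  the \<open>\<eta> m\<close>-neighbourhood of this interval, or at an earlier time to that of a partition point. Both kinds
  are counted by \<open>pull_back\<close>. As \<open>\<bar>W\<bar> \<ge> \<rho> ^ m\<close>, the first has a probability proportional to the length; the second gives the
  error term, where \<open>\<rho> ^ i + \<bar>W\<bar>\<close> is only bounded by 2 and division by \<open>\<bar>W\<bar>\<close> costs a factor \<open>1 / \<rho> ^ m\<close>.\<close>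

lemma visit_bound:
  assumes uv: "u \<le> v" and big: "\<rho> ^ m \<le> measure lborel W"
  shows "measure lborel {a\<in>U \<inter> Ge (q + m). x (q + m) a \<in> {u..v}} \<le>
    measure lborel U * (Dist\<^sup>2 * (2 * Kc * (v - u) + 8 * Kc * real (m + 1) * real (p0 + 1) * \<eta> m / \<rho> ^ m))"
proof -
  obtain a0 where a0: "a0 \<in> U" using U_facts(3) by blast
  have a0': "a0 \<in> {0<..<1}" using a0 U_facts(6) e1 by force
  \<comment> \<open>Targets under the single map: a thickened interval and thickened partition points.\<close>
  define E where "E = {u - \<eta> m..v + \<eta> m} \<inter> {0..1}"
  define F where "F k = {b k a0 - \<eta> m..b k a0 + \<eta> m} \<inter> {0..1}" for k
  define S where "S n E = {a\<in>U. x q a \<in> {y\<in>W. (T a0 ^^ n) y \<in> E}}" for n E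
  have EB: "E \<in> sets borel" "E \<subseteq> {0..1}" and FB: "F k \<in> sets borel" "F k \<subseteq> {0..1}" for k
    by (auto simp: E_def F_def)
  have mE: "measure lborel E \<le> v - u + 2 * \<eta> m"
  proof -
    have "measure lborel E \<le> measure lborel {u - \<eta> m..v + \<eta> m}" by (intro measure_mono_fmeasurable) (auto simp: E_def fmeasurable_def emeasure_lborel_Icc_eq)
    then show ?thesis using uv \<eta>_nonneg[of m] by simp
  qed
  have mF: "measure lborel (F k) \<le> 2 * \<eta> m" for k
  proof -
    have "measure lborel (F k) \<le> measure lborel {b k a0 - \<eta> m..b k a0 + \<eta> m}" by (intro measure_mono_fmeasurable) (auto simp: F_def fmeasurable_def emeasure_lborel_Icc_eq)
    then show ?thesis using \<eta>_nonneg[of m] by simp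
  qed
  have cover: "{a\<in>U \<inter> Ge (q + m). x (q + m) a \<in> {u..v}} \<subseteq> S m E \<union> (\<Union>i<m. \<Union>k\<le>p0. S i (F k))"
  proof
    fix a assume a: "a \<in> {a\<in>U \<inter> Ge (q + m). x (q + m) a \<in> {u..v}}"
    have aU: "a \<in> U" using a by simp
    have a1: "a \<in> {0<..<1}" "a \<in> {0..1}" using aU U_facts(6) e1 by force+
    have y: "x q a \<in> {0..1}" using x_unit[OF a1(2)] .
    have a0u: "a0 \<in> {0..1}" using a0' by auto
    have Tu: "(T a0 ^^ i) (x q a) \<in> {0..1}" for i by (rule T_iter_unit[OF a0u y])
    have "a \<in> S m E" if no: "a \<notin> (\<Union>i<m. \<Union>k\<le>p0. S i (F k))"
    proof -
      have dU: "\<bar>a - a0\<bar> \<le> measure lborel U" by (rule borel_interval_measure_bound[OF U_facts(2,7,5) aU a0])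
      have mono: "(M * (1 + Lam) ^ i + L) * measure lborel U \<le> \<eta> m" if "i \<le> m" for i
        unfolding \<eta>_def using M Lam that
        by (intro mult_right_mono add_right_mono mult_left_mono power_increasing) auto
      have far: "(M * (1 + Lam) ^ i + L) * measure lborel U < \<bar>(T a0 ^^ i) (x q a) - b k a0\<bar>" if "i < m" "k \<le> p0" for i k
      proof -
        have "a \<notin> S i (F k)" using no that by blast
        then have "(T a0 ^^ i) (x q a) \<notin> F k" using aU by (auto simp: S_def)
        then have "\<eta> m < \<bar>(T a0 ^^ i) (x q a) - b k a0\<bar>" using Tu[of i] by (auto simp: F_def)
        then show ?thesis using mono[of i] that by simp
      qed
      have "\<bar>(T a ^^ m) (x q a) - (T a0 ^^ m) (x q a)\<bar> \<le> M * (1 + Lam) ^ m * measure lborel U"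
        by (rule shadowing[OF a0' a1(1) dU y far order_refl])
      also have "\<dots> \<le> \<eta> m" unfolding \<eta>_def using L by (intro mult_right_mono) auto
      also have "(T a ^^ m) (x q a) = x (q + m) a" by (simp add: orb_def funpow_add add.commute[of q])
      finally have "(T a0 ^^ m) (x q a) \<in> E" using a Tu[of m] by (auto simp: E_def)
      then show ?thesis using aU by (auto simp: S_def)
    qed
    then show "a \<in> S m E \<union> (\<Union>i<m. \<Union>k\<le>p0. S i (F k))" by blast
  qed
  define D where "D = Dist\<^sup>2 * measure lborel U"
  have D0: "0 \<le> D" by (simp add: D_def)
  note Wp = W_pos
  have S1: "measure lborel (S m E) \<le> D * (2 * Kc * (v - u + 2 * \<eta> m))"
  proof -
    have "measure lborel (S m E) \<le> D / measure lborel W * (Kc * (\<rho> ^ m + measure lborel W) * measure lborel E)"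
      unfolding S_def D_def by (rule pull_back(2)[OF a0 EB])
    also have "\<dots> \<le> D / measure lborel W * (Kc * (2 * measure lborel W) * (v - u + 2 * \<eta> m))"
      using big mE Kc D0 uv \<eta>_nonneg[of m] Wp by (intro mult_left_mono mult_mono) auto
    also have "\<dots> = D * (2 * Kc * (v - u + 2 * \<eta> m))" using Wp by (simp add: field_simps)
    finally show ?thesis .
  qed
  have S2: "measure lborel (S i (F k)) \<le> D * (4 * Kc * \<eta> m / \<rho> ^ m)" for i k
  proof -
    have "measure lborel (S i (F k)) \<le> D / measure lborel W * (Kc * (\<rho> ^ i + measure lborel W) * measure lborel (F k))"
      unfolding S_def D_def by (rule pull_back(2)[OF a0 FB])
    also have "\<dots> \<le> D / \<rho> ^ m * (Kc * 2 * (2 * \<eta> m))"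
    proof (rule mult_mono)
      show "D / measure lborel W \<le> D / \<rho> ^ m" using big \<rho> D0 Wp by (intro divide_left_mono mult_pos_pos) auto
      have "\<rho> ^ i + measure lborel W \<le> 2" using W_le_1 power_le_one[of \<rho> i] \<rho> by simp
      then show "Kc * (\<rho> ^ i + measure lborel W) * measure lborel (F k) \<le> Kc * 2 * (2 * \<eta> m)"
        using Kc mF by (intro mult_mono mult_left_mono) auto
    qed (use D0 \<rho> Kc in auto)
    finally show ?thesis by (simp add: mult_ac)
  qed
  have SB: "S n E' \<in> sets borel" if "E' \<in> sets borel" "E' \<subseteq> {0..1}" for n E'
    unfolding S_def by (rule pull_back(1)[OF a0 that])
  have SU: "S n E' \<subseteq> {0..1}" for n E' using U_facts(7) by (auto simp: S_def)
  have fm: "S n E' \<in> fmeasurable lborel" if "E' \<in> sets borel" "E' \<subseteq> {0..1}" for n E'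
    using SB[OF that] emeasure_lborel_finite[OF SU] by (simp add: fmeasurable_def)
  have fmU: "(\<Union>i<m. \<Union>k\<le>p0. S i (F k)) \<in> fmeasurable lborel"
    using fm FB by (intro fmeasurable.finite_UN) auto
  have "measure lborel {a\<in>U \<inter> Ge (q + m). x (q + m) a \<in> {u..v}} \<le> measure lborel (S m E \<union> (\<Union>i<m. \<Union>k\<le>p0. S i (F k)))"
  proof (rule measure_mono_fmeasurable[OF cover])
    show "{a\<in>U \<inter> Ge (q + m). x (q + m) a \<in> {u..v}} \<in> sets lborel" using visit_borel[OF U_facts(1)] by simp
    show "S m E \<union> (\<Union>i<m. \<Union>k\<le>p0. S i (F k)) \<in> fmeasurable lborel"
      by (intro fmeasurable.Un fm EB fmU)
  qed
  also have "\<dots> \<le> measure lborel (S m E) + measure lborel (\<Union>i<m. \<Union>k\<le>p0. S i (F k))"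
    by (rule measure_Un_le) (use fm[OF EB, of m] fmU in \<open>auto dest: fmeasurableD\<close>)
  also have "measure lborel (\<Union>i<m. \<Union>k\<le>p0. S i (F k)) \<le> (\<Sum>i<m. measure lborel (\<Union>k\<le>p0. S i (F k)))"
    by (rule measure_UNION_le) (use SB FB in auto)
  also have "\<dots> \<le> (\<Sum>i<m. \<Sum>k\<le>p0. measure lborel (S i (F k)))"
    by (intro sum_mono measure_UNION_le) (use SB FB in auto)
  also have "\<dots> \<le> (\<Sum>i<m. \<Sum>k\<le>p0. D * (4 * Kc * \<eta> m / \<rho> ^ m))" by (intro sum_mono S2)
  also have "\<dots> = real m * real (p0 + 1) * (D * (4 * Kc * \<eta> m / \<rho> ^ m))" by simp
  finally have "measure lborel {a\<in>U \<inter> Ge (q + m). x (q + m) a \<in> {u..v}}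
     \<le> D * (2 * Kc * (v - u + 2 * \<eta> m)) + real m * real (p0 + 1) * (D * (4 * Kc * \<eta> m / \<rho> ^ m))"
    using S1 by simp
  also have "\<dots> \<le> D * (2 * Kc * (v - u) + 8 * Kc * real (m + 1) * real (p0 + 1) * \<eta> m / \<rho> ^ m)"
  proof -
    define t where "t = Kc * \<eta> m"
    define r where "r = 1 / \<rho> ^ m"
    have t: "0 \<le> t" using Kc \<eta>_nonneg by (simp add: t_def)
    have r: "1 \<le> r" using \<rho> power_le_one[of \<rho> m] by (simp add: r_def)
    have "t * 1 \<le> t * (real (p0 + 1) * r)"
      using mult_mono[of 1 "real (p0 + 1)" 1 r] r t by (intro mult_left_mono) auto
    moreover have "0 \<le> real m * real (p0 + 1) * (t * r)" using t r by simp
    moreover have "real (m + 1) * real (p0 + 1) * (t * r) = real m * real (p0 + 1) * (t * r) + t * (real (p0 + 1) * r)"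
      by (simp add: algebra_simps)
    moreover have "real m * real (p0 + 1) * (4 * (t * r)) = 4 * (real m * real (p0 + 1) * (t * r))" by simp
    ultimately have "4 * t + real m * real (p0 + 1) * (4 * (t * r)) \<le> 8 * (real (m + 1) * real (p0 + 1) * (t * r))"
      using t by linarith
    then have "2 * Kc * (v - u + 2 * \<eta> m) + real m * real (p0 + 1) * (4 * Kc * \<eta> m / \<rho> ^ m)
      \<le> 2 * Kc * (v - u) + 8 * Kc * real (m + 1) * real (p0 + 1) * \<eta> m / \<rho> ^ m"
      by (simp add: t_def r_def algebra_simps add_divide_distrib)
    from mult_left_mono[OF this D0] show ?thesis by (simp add: algebra_simps)
  qed
  finally show ?thesis by (simp add: D_def mult_ac)
qed

end

end

section \<open>Frequencies along almost every orbit\<close>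

lemma error_tendsto_0:
  fixes A s :: real
  assumes "0 < s"
  shows "(\<lambda>j. (sqrt (real j) + 1) * exp (sqrt (real j) * A - real j * s)) \<longlonglongrightarrow> 0"
  using assms by real_asymp

lemma stretched_exp_summable:
  fixes s :: real
  assumes "0 < s"
  shows "summable (\<lambda>j. exp (real j powr (1/4) - s * (sqrt (real j) - 1)))"
proof (rule summable_comparison_test_ev)
  have "eventually (\<lambda>j. exp (real j powr (1/4) - s * (sqrt (real j) - 1)) \<le> 1 / real j ^ 2) sequentially"
    using assms by real_asymp
  then show "\<forall>\<^sub>F j in sequentially. norm (exp (real j powr (1/4) - s * (sqrt (real j) - 1))) \<le> inverse (real j ^ 2)"
    by eventually_elim (simp only: real_norm_def abs_exp_cancel inverse_eq_divide)
  show "summable (\<lambda>j. inverse (real j ^ 2))" by (rule inverse_power_summable) simp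
qed

lemma ennreal_inverse_antimono:
  fixes a c :: ennreal
  assumes "a \<le> c" shows "inverse c \<le> inverse a"
proof (cases "a = 0 \<or> c = top")
  case False
  then have "a \<noteq> top" "c \<noteq> 0" "a \<noteq> 0" "c \<noteq> top" using assms by (auto simp: top_unique)
  then obtain r t where rt: "a = ennreal r" "c = ennreal t" "0 < r" "0 < t"
    by (metis ennreal_cases ennreal_eq_0_iff not_le)
  then show ?thesis using assms by (simp add: inverse_ennreal ennreal_leI)
qed auto

text \<open>\<open>III\<close> is the summability condition at the exponent 1/4; any exponent below 1/2 would be beaten by \<open>\<rho> ^ sqrt j\<close>.\<close>

locale expanding_near_0_partition = expanding_near_0_transfer +
  fixes K :: "real \<Rightarrow> real set" and e3 Cs :: real
  assumes e3: "e1 \<le> e3" "e3 \<le> 1" and Cs: "0 \<le> Cs"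
    and K_orb: "\<And>a j. a \<in> G 1 j \<Longrightarrow> x j a \<in> K a"
    and III: "\<And>n. n \<ge> 1 \<Longrightarrow> (\<Sum>\<^sub>\<infinity>\<omega>\<in>param_partition x K (part_pts p0 b) n {0..e3}.
          inverse (SUP a\<in>\<omega>. ennreal \<bar>x' n a\<bar>)) \<le> ennreal (Cs * exp (real n powr (1/4)))"
begin

text \<open>A component is admissible because orbits stay in the support \<open>K a\<close> until they meet a partition point. It is maximal because admissible intervals are connected and open, hence contained in the set of which it is a component.\<close>

lemma component_in_param_partition:
  assumes a: "a \<in> G e3 n"
  shows "connected_component_set (G e3 n) a \<in> param_partition x K (part_pts p0 b) n {0..e3}"
proof -
  let ?V = "connected_component_set (G e3 n) a"
  have V: "?V \<in> components (G e3 n)" "a \<in> ?V" using connected_component_in_components[OF a] by auto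
  note Vp = components_open_real[OF open_G[OF e3(2)] V(1)]
  have "admissible_interval x K (part_pts p0 b) n {0..e3} ?V"
    unfolding admissible_interval_def
  proof (intro conjI ballI allI impI Vp(1,2,3))
    show "?V \<subseteq> {0..e3}" using Vp(4) G_sub[of e3 n] by force
    fix s i assume s: "s \<in> ?V" and i: "i < n"
    have sG: "s \<in> G e3 n" using s Vp(4) by blast
    then have "s \<in> G 1 i" using G_le[OF e3(2)] G_antimono[of i n 1] i by (meson less_imp_le subsetD)
    then show "x i s \<in> K s - part_pts p0 b s" using K_orb[of s i] sG i by (auto simp: G_def)
  qed
  moreover have "W' = ?V" if W': "admissible_interval x K (part_pts p0 b) n {0..e3} W'" "?V \<subseteq> W'" for W'
  proof -
    have W'p: "open W'" "is_interval W'" "W' \<subseteq> {0..e3}" "\<forall>s\<in>W'. \<forall>i<n. x i s \<in> K s - part_pts p0 b s"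
      using W'(1) by (auto simp: admissible_interval_def)
    have "W' \<subseteq> interior {0..e3}" using W'p(1,3) by (rule interior_maximal[rotated])
    then have "W' \<subseteq> G e3 n" using W'p(4) by (auto simp: G_def)
    moreover have "connected W'" using W'p(2) by (simp add: is_interval_connected_1)
    ultimately have "W' \<subseteq> ?V" using V(2) W'(2) by (intro connected_component_maximal) auto
    then show ?thesis using W'(2) by auto
  qed
  ultimately show ?thesis by (auto simp: param_partition_def)
qed

text \<open>The intervals of the partition at time \<open>n\<close> over which the orbits fill less than length \<open>r\<close>.\<close>

definition short_comps :: "nat \<Rightarrow> real \<Rightarrow> real set set" where
  "short_comps n r = {U \<in> components (Ge n). measure lborel (x n ` U) < r}"

definition Short :: "nat \<Rightarrow> real \<Rightarrow> real set" where "Short n r = \<Union>(short_comps n r)"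

lemma Short_open: "open (Short n r)"
  unfolding Short_def 
proof (rule open_Union, rule ballI)
  fix U assume "U \<in> short_comps n r"
  then have "U \<in> components (Ge n)" by (simp add: short_comps_def)
  then show "open U" by (rule components_open_real(1)[OF open_Ge])
qed

lemma Short_sub: "Short n r \<subseteq> {0<..<e1}"
proof
  fix a assume "a \<in> Short n r"
  then obtain U where U: "U \<in> components (Ge n)" "a \<in> U" by (auto simp: Short_def short_comps_def)
  then have "a \<in> Ge n" using components_open_real(4)[OF open_Ge U(1)] by blast
  then show "a \<in> {0<..<e1}" using G_sub by blast
qed

text \<open>Summability is given on \<open>{0..e3}\<close>, the intervals are cut at \<open>e1 \<le> e3\<close>. Only an interval that extends up to the cut can differ from an interval of the larger partition.\<close>

lemma not_partition_reaches_end: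
  assumes U: "U \<in> components (Ge n)" and a: "a \<in> U" and no: "U \<notin> param_partition x K (part_pts p0 b) n {0..e3}"
  shows "{a..<e1} \<subseteq> U"
proof -
  note Up = components_open_real[OF open_Ge U]
  have aG: "a \<in> G e3 n" using a Up(4) G_le[OF e3(1)] by blast
  let ?V = "connected_component_set (G e3 n) a"
  have V: "?V \<in> components (G e3 n)" "a \<in> ?V" using connected_component_in_components[OF aG] by auto
  note Vp = components_open_real[OF open_G[OF e3(2)] V(1)]
  have conU: "connected U" using Up(2) by (simp add: is_interval_connected_1)
  have UV: "U \<subseteq> ?V" by (rule connected_component_maximal[OF a conU]) (use Up(4) G_le[OF e3(1)] in blast)
  have "U = ?V" if "?V \<subseteq> {0<..<e1}"
  proof -
    have "?V \<subseteq> Ge n" using that Vp(4) by (auto simp: G_def)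
    moreover have "connected ?V" by simp
    ultimately have "?V \<subseteq> connected_component_set (Ge n) a" by (intro connected_component_maximal[OF V(2)])
    also have "\<dots> = U" by (rule component_eq_connected_component[OF U a])
    finally show ?thesis using UV by auto
  qed
  then have "\<not> ?V \<subseteq> {0<..<e1}" using no component_in_param_partition[OF aG] by auto
  then obtain c where c: "c \<in> ?V" "c \<notin> {0<..<e1}" by blast
  have "0 < c" using c(1) Vp(4) G_D by blast
  then have ce: "e1 \<le> c" using c(2) by auto
  have sub: "{a..<e1} \<subseteq> Ge n"
  proof
    fix s assume s: "s \<in> {a..<e1}"
    have "s \<in> ?V" using V(2) c(1) s ce Vp(2) unfolding is_interval_1 by (meson atLeastLessThan_iff less_imp_le order_trans)
    then have "s \<in> G e3 n" using Vp(4) by blast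
    then show "s \<in> Ge n" using s by (auto simp: G_def)
  qed
  have "{a..<e1} \<subseteq> connected_component_set (Ge n) a"
  proof (rule connected_component_maximal[OF _ _ sub])
    have "a < e1" using a Up(4) G_D by blast
    then show "a \<in> {a..<e1}" by simp
    show "connected {a..<e1}" by (simp add: is_interval_connected_1[symmetric] is_interval_1) 
  qed
  then show ?thesis using component_eq_connected_component[OF U a] by simp
qed

text \<open>By bounded distortion \<open>\<bar>U\<bar>\<close> is at most a constant times \<open>\<bar>x n ` U\<bar>\<close>, hence times \<open>r\<close>, divided by the supremum of \<open>\<bar>x' n\<bar>\<close> on
  \<open>U\<close>; the sum of these quotients is the one bounded by \<open>III\<close>. At most one interval touches the cut at \<open>e1\<close>, which the
  summand 1 accounts for.\<close>

lemma Short_measure: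
  assumes n: "1 \<le> n" "N \<le> n" and r: "0 \<le> r"
  shows "measure lborel (Short n r) \<le> r * Dist\<^sup>2 * (Cs * exp (real n powr (1/4)) + 1)"
proof -
  let ?PP = "param_partition x K (part_pts p0 b) n {0..e3}"
  define s where "s U = (SUP a\<in>U. ennreal \<bar>x' n a\<bar>)" for U
  have each: "emeasure lborel U \<le> ennreal (r * Dist\<^sup>2) * inverse (s U) \<and> emeasure lborel U \<le> ennreal (r * Dist\<^sup>2)"
    if U: "U \<in> short_comps n r" for U
  proof -
    have Uc: "U \<in> components (Ge n)" and Wr: "measure lborel (x n ` U) < r" using U by (auto simp: short_comps_def)
    note Uf = U_facts[OF n(2) Uc]
    obtain a0 where a0: "a0 \<in> U" using Uf(3) by blast
    have x1: "1 \<le> \<bar>x' n a0\<bar>" by (rule x'_ge_1[OF n(2) Uc a0])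
    have em: "emeasure lborel U = ennreal (measure lborel U)"
      using emeasure_lborel_finite[OF Uf(7)] by (intro emeasure_eq_ennreal_measure) (simp add: less_top)
    have mU: "measure lborel U \<le> Dist / \<bar>x' n a0\<bar> * r"
      by (rule order_trans[OF U_W_measure(1)[OF n(2) Uc a0]]) (use Wr Dist_ge_1 in \<open>auto intro!: mult_left_mono divide_right_mono\<close>)
    have sup: "s U \<le> ennreal (Dist * \<bar>x' n a0\<bar>)"
      unfolding s_def by (rule SUP_least) (intro ennreal_leI distortion[OF Uf(2,4) n(2) _ a0])
    have pos: "0 < Dist * \<bar>x' n a0\<bar>" using Dist_ge_1 x1 by (intro mult_pos_pos) auto
    have "ennreal (measure lborel U) \<le> ennreal (r * Dist\<^sup>2 * inverse (Dist * \<bar>x' n a0\<bar>))"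
    proof (rule ennreal_leI)
      have "Dist / \<bar>x' n a0\<bar> * r = r * Dist\<^sup>2 * inverse (Dist * \<bar>x' n a0\<bar>)"
        using x1 Dist_ge_1 by (simp add: field_simps power2_eq_square)
      then show "measure lborel U \<le> r * Dist\<^sup>2 * inverse (Dist * \<bar>x' n a0\<bar>)" using mU by simp
    qed
    also have "\<dots> = ennreal (r * Dist\<^sup>2) * ennreal (inverse (Dist * \<bar>x' n a0\<bar>))"
      proof (rule ennreal_mult)
      show "0 \<le> inverse (Dist * \<bar>x' n a0\<bar>)" using pos by (rule less_imp_le[OF positive_imp_inverse_positive])
    qed (use r in simp)
    also have "ennreal (inverse (Dist * \<bar>x' n a0\<bar>)) = inverse (ennreal (Dist * \<bar>x' n a0\<bar>))"
      by (rule inverse_ennreal[OF pos, symmetric])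
    also have "\<dots> \<le> inverse (s U)" by (rule ennreal_inverse_antimono[OF sup])
    finally have 1: "emeasure lborel U \<le> ennreal (r * Dist\<^sup>2) * inverse (s U)"
      unfolding em by (simp add: mult_left_mono)
    have "Dist / \<bar>x' n a0\<bar> \<le> Dist * Dist"
      using x1 Dist_ge_1 mult_mono[of 1 Dist 1 "\<bar>x' n a0\<bar>"] by (simp add: divide_le_eq mult.assoc)
    then have "Dist / \<bar>x' n a0\<bar> * r \<le> r * Dist\<^sup>2"
      using r by (metis mult.commute mult_right_mono power2_eq_square)
    then have 2: "emeasure lborel U \<le> ennreal (r * Dist\<^sup>2)" unfolding em using mU by (intro ennreal_leI) simp
    show ?thesis using 1 2 by blast
  qed
  have fin: "(\<Sum>U\<in>F. emeasure lborel U) \<le> ennreal (r * Dist\<^sup>2 * (Cs * exp (real n powr (1/4)) + 1))"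
    if F: "finite F" "F \<subseteq> short_comps n r" for F
  proof -
    have comp: "U \<in> components (Ge n)" if "U \<in> F" for U using F that by (auto simp: short_comps_def)
    have F2: "card (F - ?PP) \<le> 1"
    proof -
      have "U = V" if UV: "U \<in> F - ?PP" "V \<in> F - ?PP" for U V
      proof -
        have Uc: "U \<in> components (Ge n)" and Vc: "V \<in> components (Ge n)" using comp UV by auto
      obtain a where a: "a \<in> U" using components_open_real(3)[OF open_Ge Uc] by blast
      obtain c where c: "c \<in> V" using components_open_real(3)[OF open_Ge Vc] by blast
      have lt: "a < e1" "c < e1" using a c Uc Vc components_open_real(4)[OF open_Ge] G_D by blast+
      have "max a c \<in> U" "max a c \<in> V"
        using not_partition_reaches_end[OF Uc a] not_partition_reaches_end[OF Vc c] UV lt by auto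
        then show "U = V"
          using component_eq_connected_component[OF Uc] component_eq_connected_component[OF Vc] by metis
      qed
      then show ?thesis using F(1) card_le_Suc0_iff_eq[of "F - ?PP"] by auto
    qed
    have "(\<Sum>U\<in>F. emeasure lborel U) = (\<Sum>U\<in>F \<inter> ?PP. emeasure lborel U) + (\<Sum>U\<in>F - ?PP. emeasure lborel U)"
      using F(1) by (metis sum.Int_Diff)
    also have "\<dots> \<le> (\<Sum>U\<in>F \<inter> ?PP. ennreal (r * Dist\<^sup>2) * inverse (s U)) + (\<Sum>U\<in>F - ?PP. ennreal (r * Dist\<^sup>2))"
      using each F by (intro add_mono sum_mono) auto
    also have "(\<Sum>U\<in>F - ?PP. ennreal (r * Dist\<^sup>2)) = of_nat (card (F - ?PP)) * ennreal (r * Dist\<^sup>2)" by simp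
    also have "\<dots> \<le> 1 * ennreal (r * Dist\<^sup>2)"
      using F2 by (intro mult_right_mono) (auto simp: of_nat_le_1_iff intro: order_trans[OF _ order.refl])
    also have "(\<Sum>U\<in>F \<inter> ?PP. ennreal (r * Dist\<^sup>2) * inverse (s U)) = ennreal (r * Dist\<^sup>2) * (\<Sum>U\<in>F \<inter> ?PP. inverse (s U))"
      by (simp add: sum_distrib_left)
    also have "(\<Sum>U\<in>F \<inter> ?PP. inverse (s U)) \<le> (\<Sum>\<^sub>\<infinity>U\<in>?PP. inverse (s U))"
      unfolding nonneg_infsum_complete[of ?PP "\<lambda>U. inverse (s U)", OF zero_le]
      by (rule SUP_upper) (use F in auto)
    also have "\<dots> \<le> ennreal (Cs * exp (real n powr (1/4)))" unfolding s_def by (rule III[OF n(1)])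
    finally have "(\<Sum>U\<in>F. emeasure lborel U) \<le> ennreal (r * Dist\<^sup>2) * ennreal (Cs * exp (real n powr (1/4))) + 1 * ennreal (r * Dist\<^sup>2)"
      by (simp add: mult_left_mono add_mono)
    also have "\<dots> = ennreal (r * Dist\<^sup>2 * (Cs * exp (real n powr (1/4)))) + ennreal (r * Dist\<^sup>2)"
      using r Cs by (subst ennreal_mult) auto
    also have "\<dots> = ennreal (r * Dist\<^sup>2 * (Cs * exp (real n powr (1/4)) + 1))"
      using r Cs by (subst ennreal_plus[symmetric]) (auto simp: algebra_simps)
    finally show ?thesis .
  qed
  have "emeasure lborel (Short n r) \<le> ennreal (r * Dist\<^sup>2 * (Cs * exp (real n powr (1/4)) + 1))"
    unfolding Short_def
  proof (rule emeasure_Union_le_if_finite_sums_le)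
    show "countable (short_comps n r)"
      unfolding short_comps_def by (rule countable_subset[OF _ countable_components_open[OF open_Ge[of n]]]) auto
    show "U \<in> sets lborel" if "U \<in> short_comps n r" for U
    proof -
      have "U \<in> components (Ge n)" using that by (simp add: short_comps_def)
      then show ?thesis using components_open_real(5)[OF open_Ge] by simp
    qed
  qed (rule fin)
  then show ?thesis using r Cs by (simp add: measure_def enn2real_leI)
qed

text \<open>The bound of \<open>visit_bound\<close> per unit of length.\<close>

definition C\<^sub>0 :: real where "C\<^sub>0 = 2 * Kc * Dist\<^sup>2"

text \<open>The orbit at time \<open>j\<close> is viewed from time \<open>q j = j - m j\<close> with \<open>m j\<close> about \<open>sqrt j\<close>. On the intervals of time \<open>q j\<close> that are not
  short, the plateau has average at most \<open>C\<^sub>0\<close> times its width, up to an error of order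
  \<open>sqrt j * ((1 + Lam) * \<sigma> / \<rho>) ^ sqrt j / \<sigma> ^ j\<close>, which tends to 0. The short ones have measure of order
  \<open>\<rho> ^ sqrt j * exp (j powr (1/4))\<close>, which is summable. Plateaus are Lipschitz, so \<open>param_contraction\<close> makes the
  visit functions nearly constant on later intervals, and the strong law applies.\<close>

lemma plateau_frequency:
  assumes uv: "u < v" and d: "0 < d"
  shows "AE a in lborel. a \<in> {0<..<e1} \<longrightarrow>
    (\<forall>\<epsilon>>0. \<forall>\<^sub>F n in sequentially. (\<Sum>i=1..n. plateau u v d (x i a)) \<le> (C\<^sub>0 * (v - u + 2 * d) + \<epsilon>) * real n)"
proof -
  define m where "m j = nat \<lfloor>sqrt (real j)\<rfloor>" for j
  define q where "q j = j - m j" for j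
  \<comment> \<open>From time \<open>J0\<close> on, \<open>m j \<le> j / 4\<close> and hence \<open>q j \<ge> N\<close>.\<close>
  define J0 where "J0 = 2 * N + 16"
  have m_le: "real (m j) \<le> sqrt (real j)" "sqrt (real j) - 1 \<le> real (m j)" for j
    unfolding m_def by (simp_all add: of_nat_nat)
  have big: "1 \<le> q j \<and> N \<le> q j \<and> j = q j + m j" if j: "J0 \<le> j" for j
  proof -
    have j16: "16 \<le> real j" "2 * real N + 16 \<le> real j" using j by (auto simp: J0_def)
    then have "sqrt 16 \<le> sqrt (real j)" by (intro real_sqrt_le_mono)
    then have s4: "4 \<le> sqrt (real j)" by simp
    then have "4 * sqrt (real j) \<le> sqrt (real j) * sqrt (real j)" by (intro mult_right_mono) auto
    then have "4 * sqrt (real j) \<le> real j" by simp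
    then have "real (m j) \<le> real j / 4" using m_le[of j] by linarith
    then have "real (m j) + real N + 1 \<le> real j" using j16 by linarith
    then have "m j + N + 1 \<le> j" by linarith
    then show ?thesis unfolding q_def by linarith
  qed
  \<comment> \<open>The visit function, cut off before time \<open>N\<close> and outside the open set of regular parameters.\<close>
  define Z where "Z j a = (if j < N then 0 else indicator (Ge j) a * plateau u v d (x j a))" for j a
  \<comment> \<open>Before time \<open>J0\<close> everything is discarded, which does not affect summability.\<close>
  define Bad where "Bad j = (if j < J0 then {0<..<e1} else Short (q j) (\<rho> ^ m j))" for j
  define B where "B = (1 + Lam) / \<rho>"
  define c1 where "c1 = Dist\<^sup>2 * (8 * Kc * real (p0 + 1) * (M + L)) * \<sigma> ^ N"
  define err where "err j = c1 * ((sqrt (real j) + 1) * exp (sqrt (real j) * ln (B * \<sigma>) - real j * ln \<sigma>))" for j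
  have B1: "1 \<le> B" using Lam \<rho> by (simp add: B_def field_simps)
  have B\<sigma>: "1 \<le> B * \<sigma>" using B1 \<sigma> mult_mono[of 1 B 1 \<sigma>] by simp
  have Zm: "Z j \<in> borel_measurable borel" for j
  proof -
    have "continuous_on (Ge j) (\<lambda>a. plateau u v d (x j a))"
      by (intro continuous_at_imp_continuous_on ballI isCont_o2[OF x_isCont isCont_plateau] d) (rule Ge_G1)
    then have "(\<lambda>a. indicator (Ge j) a *\<^sub>R plateau u v d (x j a)) \<in> borel_measurable borel"
      using open_Ge by (intro borel_measurable_continuous_on_indicator) auto
    then show ?thesis unfolding Z_def[abs_def] by simp
  qed
  have Zb: "0 \<le> Z j a" "Z j a \<le> 1" for j a
    using plateau_bounds[OF d, of u v "x j a"] by (auto simp: Z_def indicator_def)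
  have osc: "\<bar>Z j a - Z j a'\<bar> \<le> (1 / d) * (1 / \<sigma>) ^ (n - j)"
    if "j \<le> n" "W \<in> components (Ge n)" "a \<in> W" "a' \<in> W" for j n W a a'
  proof (cases "j < N")
    case True then show ?thesis using \<sigma> d by (simp add: Z_def)
  next
    case False
    note Wp = components_open_real[OF open_Ge that(2)]
    have n: "n = j + (n - j)" using that(1) by simp
    have aj: "a \<in> Ge j" "a' \<in> Ge j" using Wp(4) that G_antimono[OF that(1), of e1] by auto
    have "\<sigma> ^ (n - j) * \<bar>x j a - x j a'\<bar> \<le> \<bar>x (j + (n - j)) a - x (j + (n - j)) a'\<bar>"
      by (rule param_contraction[OF Wp(2) _ _ that(3,4)]) (use Wp(4) n False in auto)
    also have "\<dots> \<le> 1"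
    proof -
      have "a \<in> {0..1}" "a' \<in> {0..1}" using G_D[OF aj(1)] G_D[OF aj(2)] e1 by auto
      then have "x (j + (n - j)) a \<in> {0..1}" "x (j + (n - j)) a' \<in> {0..1}" by (auto intro!: x_unit simp del: atLeastAtMost_iff)
      then show ?thesis by auto
    qed
    finally have xx: "\<bar>x j a - x j a'\<bar> \<le> (1 / \<sigma>) ^ (n - j)" using \<sigma> by (simp add: power_one_over field_simps)
    have "\<bar>Z j a - Z j a'\<bar> = \<bar>plateau u v d (x j a) - plateau u v d (x j a')\<bar>" using False aj by (simp add: Z_def)
    also have "\<dots> \<le> \<bar>x j a - x j a'\<bar> / d" by (rule plateau_lipschitz[OF d])
    also have "\<dots> \<le> (1 / \<sigma>) ^ (n - j) / d" using xx d by (intro divide_right_mono) auto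
    finally show ?thesis by simp
  qed
  have BadB: "Bad j \<in> sets borel" "Bad j \<subseteq> {0<..<e1}" for j
    using Short_open Short_sub by (auto simp: Bad_def)
  have summ: "summable (\<lambda>j. measure lborel (Bad j))"
  proof (rule summable_comparison_test_ev)
    define \<kappa>' where "\<kappa>' = - ln \<rho>"
    have \<kappa>': "0 < \<kappa>'" using \<rho> by (simp add: \<kappa>'_def)
    show "summable (\<lambda>j. Dist\<^sup>2 * (Cs + 1) * exp (real j powr (1/4) - \<kappa>' * (sqrt (real j) - 1)))"
      by (intro summable_mult stretched_exp_summable \<kappa>')
    show "\<forall>\<^sub>F j in sequentially. norm (measure lborel (Bad j)) \<le> Dist\<^sup>2 * (Cs + 1) * exp (real j powr (1/4) - \<kappa>' * (sqrt (real j) - 1))"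
      using eventually_ge_at_top[of J0]
    proof eventually_elim
      fix j assume j: "J0 \<le> j"
      have r: "\<rho> ^ m j \<le> exp (- \<kappa>' * (sqrt (real j) - 1))"
      proof -
        have "\<rho> ^ m j = exp (real (m j) * ln \<rho>)" using \<rho> by (simp add: exp_of_nat_mult)
        also have "\<dots> \<le> exp (- \<kappa>' * (sqrt (real j) - 1))"
          using mult_left_mono[OF m_le(2)[of j], of \<kappa>'] \<kappa>' by (simp add: \<kappa>'_def mult.commute)
        finally show ?thesis .
      qed
      have q1: "real (q j) powr (1/4) \<le> real j powr (1/4)" by (intro powr_mono2) (auto simp: q_def)
      have "measure lborel (Bad j) \<le> \<rho> ^ m j * Dist\<^sup>2 * (Cs * exp (real (q j) powr (1/4)) + 1)"
        using Short_measure[of "q j" "\<rho> ^ m j"] big[OF j] j \<rho> by (simp add: Bad_def)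
      also have "\<dots> \<le> exp (- \<kappa>' * (sqrt (real j) - 1)) * Dist\<^sup>2 * ((Cs + 1) * exp (real j powr (1/4)))"
      proof (rule mult_mono)
        have "Cs * exp (real (q j) powr (1/4)) \<le> Cs * exp (real j powr (1/4))" using q1 Cs by (intro mult_left_mono) auto
        moreover have "1 \<le> exp (real j powr (1/4))" by simp
        ultimately show "Cs * exp (real (q j) powr (1/4)) + 1 \<le> (Cs + 1) * exp (real j powr (1/4))"
          unfolding distrib_right by linarith
      qed (use r \<rho> Cs in \<open>auto intro!: mult_right_mono\<close>)
      also have "\<dots> = Dist\<^sup>2 * (Cs + 1) * exp (real j powr (1/4) - \<kappa>' * (sqrt (real j) - 1))"
      proof -
        have "exp (real j powr (1/4) - \<kappa>' * (sqrt (real j) - 1)) = exp (- \<kappa>' * (sqrt (real j) - 1)) * exp (real j powr (1/4))"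
          unfolding exp_add[symmetric] by (rule arg_cong[of _ _ exp]) simp
        then show ?thesis by (simp only: mult_ac)
      qed
      finally show "norm (measure lborel (Bad j)) \<le> Dist\<^sup>2 * (Cs + 1) * exp (real j powr (1/4) - \<kappa>' * (sqrt (real j) - 1))" by simp
    qed
  qed
  have avg: "comp_avg (Ge (q j)) (Z j) a \<le> C\<^sub>0 * (v - u + 2 * d) + err j" if a: "a \<in> Ge (q j) - Bad j" for a j
  proof -
    have j: "J0 \<le> j" using a G_sub[of e1 "q j"] by (auto simp: Bad_def split: if_splits)
    note bj = big[OF j]
    let ?U = "connected_component_set (Ge (q j)) a"
    have aG: "a \<in> Ge (q j)" using a by simp
    have U: "?U \<in> components (Ge (q j))" "a \<in> ?U" using connected_component_in_components[OF aG] by auto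
    have qN: "N \<le> q j" using bj by simp
    note Uf = U_facts[OF qN U(1)]
    have "?U \<notin> short_comps (q j) (\<rho> ^ m j)" using a j U(2) by (auto simp: Bad_def Short_def)
    then have large: "\<rho> ^ m j \<le> measure lborel (x (q j) ` ?U)" using U(1) by (simp add: short_comps_def)
    define S where "S = {a\<in>?U \<inter> Ge (q j + m j). x (q j + m j) a \<in> {u - d..v + d}}"
    have Sm: "S \<in> sets borel" unfolding S_def by (rule visit_borel[OF Uf(1)])
    have fin: "emeasure lborel S < \<infinity>" by (rule emeasure_lborel_finite[of _ 0 1]) (use Uf(7) in \<open>auto simp: S_def\<close>)
    have pos: "0 < measure lborel ?U" by (rule measure_component_pos[OF open_Ge U(1) Uf(7)])
    have jj: "q j + m j = j" using bj by simp
    have "(LINT a:?U|lborel. Z j a) \<le> (\<integral>a. indicator S a \<partial>lborel)"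
      unfolding set_lebesgue_integral_def
    proof (rule integral_mono)
      show "integrable lborel (\<lambda>a. indicator ?U a *\<^sub>R Z j a)"
        using set_integrable_bounded[of "Z j" 1 ?U 0 1] Zm Zb Uf(5,7) by (simp add: set_integrable_def)
      show "integrable lborel (indicator S :: real \<Rightarrow> real)" using Sm fin by (intro integrable_real_indicator) auto
      show "indicator ?U a *\<^sub>R Z j a \<le> indicator S a" for a
      proof (cases "a \<in> S")
        case True then show ?thesis using Zb[of j a] by (simp add: indicator_def)
      next
        case False
        show ?thesis
        proof (cases "a \<in> ?U \<inter> Ge j")
          case True
          then have "x j a \<notin> {u - d..v + d}" using False unfolding S_def jj by blast
          then show ?thesis using False plateau_outside[OF d] by (simp add: Z_def)
        next
          case nG: False
          then have "indicator ?U a *\<^sub>R Z j a = 0" by (auto simp: Z_def indicator_def)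
          then show ?thesis by (simp only: indicator_pos_le)
        qed
      qed
    qed
    also have "\<dots> = measure lborel S" using Sm by simp
    also have "\<dots> \<le> measure lborel ?U * (Dist\<^sup>2 * (2 * Kc * ((v + d) - (u - d)) + 8 * Kc * real (m j + 1) * real (p0 + 1) * \<eta> ?U (m j) / \<rho> ^ m j))"
      unfolding S_def by (rule visit_bound[OF qN U(1) _ large]) (use uv d in simp)
    finally have "comp_avg (Ge (q j)) (Z j) a \<le> Dist\<^sup>2 * (2 * Kc * ((v + d) - (u - d)) + 8 * Kc * real (m j + 1) * real (p0 + 1) * \<eta> ?U (m j) / \<rho> ^ m j)"
      unfolding comp_avg_def using pos by (simp add: divide_le_eq mult.commute)
    also have "\<dots> = C\<^sub>0 * (v - u + 2 * d) + Dist\<^sup>2 * (8 * Kc * real (p0 + 1)) * (real (m j + 1) * \<eta> ?U (m j) / \<rho> ^ m j)"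
      by (simp add: C\<^sub>0_def algebra_simps add_divide_distrib)
    also have "Dist\<^sup>2 * (8 * Kc * real (p0 + 1)) * (real (m j + 1) * \<eta> ?U (m j) / \<rho> ^ m j) \<le> err j"
    proof -
      have eta: "\<eta> ?U (m j) \<le> (M + L) * (1 + Lam) ^ m j * (1 / \<sigma>) ^ (q j - N)"
      proof -
        have "L * 1 \<le> L * (1 + Lam) ^ m j" using L Lam by (intro mult_left_mono one_le_power) auto
        then have "M * (1 + Lam) ^ m j + L \<le> (M + L) * (1 + Lam) ^ m j" by (simp add: algebra_simps)
        then show ?thesis unfolding \<eta>_def[OF qN U(1)]
          using U_small[OF qN U(1)] M L Lam by (intro mult_mono) auto
      qed
      have "real (m j + 1) * \<eta> ?U (m j) / \<rho> ^ m j \<le> (sqrt (real j) + 1) * ((M + L) * (1 + Lam) ^ m j * (1 / \<sigma>) ^ (q j - N)) / \<rho> ^ m j"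
        using m_le[of j] eta \<rho> \<eta>_nonneg[OF qN U(1)] by (intro divide_right_mono mult_mono) auto
      also have "\<dots> = (M + L) * ((sqrt (real j) + 1) * (B ^ m j * (1 / \<sigma>) ^ (q j - N)))"
        by (simp add: B_def power_divide mult_ac)
      also have "B ^ m j * (1 / \<sigma>) ^ (q j - N) = \<sigma> ^ N * ((B * \<sigma>) ^ m j * (1 / \<sigma>) ^ j)"
      proof -
        have "\<sigma> ^ j = \<sigma> ^ (q j - N) * \<sigma> ^ N * \<sigma> ^ m j" using bj by (simp flip: power_add)
        then show ?thesis using \<sigma> by (simp add: power_mult_distrib power_one_over field_simps)
      qed
      also have "(B * \<sigma>) ^ m j * (1 / \<sigma>) ^ j \<le> exp (sqrt (real j) * ln (B * \<sigma>) - real j * ln \<sigma>)"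
      proof -
        have "(B * \<sigma>) ^ m j = exp (real (m j) * ln (B * \<sigma>))" using B\<sigma> by (simp add: exp_of_nat_mult)
        also have "\<dots> \<le> exp (sqrt (real j) * ln (B * \<sigma>))"
          using m_le[of j] B\<sigma> ln_ge_zero[OF B\<sigma>] by (simp add: mult_right_mono)
        finally have 1: "(B * \<sigma>) ^ m j \<le> exp (sqrt (real j) * ln (B * \<sigma>))" .
        have 2: "(1 / \<sigma>) ^ j = exp (- (real j * ln \<sigma>))" using \<sigma> by (simp add: exp_minus exp_of_nat_mult divide_inverse power_inverse)
        show ?thesis unfolding 2 using 1 by (simp add: exp_diff exp_minus field_simps)
      qed
      finally have "real (m j + 1) * \<eta> ?U (m j) / \<rho> ^ m j \<le> (M + L) * ((sqrt (real j) + 1) * (\<sigma> ^ N * exp (sqrt (real j) * ln (B * \<sigma>) - real j * ln \<sigma>)))"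
        using M L \<sigma> by (simp add: mult_left_mono)
      then have "Dist\<^sup>2 * (8 * Kc * real (p0 + 1)) * (real (m j + 1) * \<eta> ?U (m j) / \<rho> ^ m j)
        \<le> Dist\<^sup>2 * (8 * Kc * real (p0 + 1)) * ((M + L) * ((sqrt (real j) + 1) * (\<sigma> ^ N * exp (sqrt (real j) * ln (B * \<sigma>) - real j * ln \<sigma>))))"
        using Kc by (intro mult_left_mono) auto
      also have "\<dots> = err j" by (simp add: err_def c1_def)
      finally show ?thesis .
    qed
    finally show ?thesis by simp
  qed
  have err0: "err \<longlonglongrightarrow> 0"
  proof -
    have "0 < ln \<sigma>" using \<sigma> by simp
    from tendsto_mult_left[OF error_tendsto_0[OF this], of c1] show ?thesis unfolding err_def[abs_def] by simp
  qed
  have C0: "0 \<le> C\<^sub>0 * (v - u + 2 * d)" using Kc uv d by (simp add: C\<^sub>0_def)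
  have freq: "AE a in lborel. a \<in> {0<..<e1} \<longrightarrow>
     (\<forall>\<eta>>0. \<forall>\<^sub>F n in sequentially. (\<Sum>j=1..n. Z j a) \<le> (C\<^sub>0 * (v - u + 2 * d) + \<eta>) * real n)"
  proof (rule frequency_bound_from_component_averages[where G=Ge and \<theta>="1 / \<sigma>" and c="1 / d" and Bad=Bad and err=err])
    show "comp_avg (Ge (j - nat \<lfloor>sqrt (real j)\<rfloor>)) (Z j) a \<le> C\<^sub>0 * (v - u + 2 * d) + err j"
      if "a \<in> Ge (j - nat \<lfloor>sqrt (real j)\<rfloor>) - Bad j" for j a
      using avg[of a j] that unfolding q_def m_def .
    show "m \<le> n \<Longrightarrow> Ge n \<subseteq> Ge m" for m n by (rule G_antimono)
    show "\<bar>Z j a - Z j a'\<bar> \<le> (1 / d) * (1 / \<sigma>) ^ (n - j)"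
      if "j \<le> n" "W \<in> components (Ge n)" "a \<in> W" "a' \<in> W" for j n W a a'
      by (rule osc[OF that])
  qed (use e1 \<sigma> d in \<open>auto intro!: open_Ge G_sub countable_complement Zm Zb summ err0 C0 BadB(1) simp del: greaterThanLessThan_iff dest: BadB(2)[THEN subsetD]\<close>)
  have "AE a in lborel. \<forall>n. a \<notin> {0<..<e1} - Ge n"
    unfolding AE_all_countable by (intro allI AE_not_in countable_imp_null_set_lborel countable_complement)
  with freq show ?thesis
  proof eventually_elim
    fix a assume fr: "a \<in> {0<..<e1} \<longrightarrow>
     (\<forall>\<eta>>0. \<forall>\<^sub>F n in sequentially. (\<Sum>j=1..n. Z j a) \<le> (C\<^sub>0 * (v - u + 2 * d) + \<eta>) * real n)"
      and full: "\<forall>n. a \<notin> {0<..<e1} - Ge n"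
    show "a \<in> {0<..<e1} \<longrightarrow> (\<forall>\<epsilon>>0. \<forall>\<^sub>F n in sequentially. (\<Sum>i=1..n. plateau u v d (x i a)) \<le> (C\<^sub>0 * (v - u + 2 * d) + \<epsilon>) * real n)"
    proof (intro impI allI)
      fix \<epsilon> :: real assume a: "a \<in> {0<..<e1}" and \<epsilon>: "0 < \<epsilon>"
      have aG: "a \<in> Ge n" for n using full a by blast
      \<comment> \<open>The first \<open>N\<close> visits, missing in \<open>Z\<close>, are absorbed by \<open>\<epsilon>\<close>.\<close>
      have pl: "plateau u v d (x i a) \<le> Z i a + (if i < N then 1 else 0)" for i
        using aG[of i] plateau_bounds[OF d, of u v "x i a"] by (simp add: Z_def)
      have "\<forall>\<^sub>F n in sequentially. (\<Sum>j=1..n. Z j a) \<le> (C\<^sub>0 * (v - u + 2 * d) + \<epsilon> / 2) * real n"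
        using fr a \<epsilon> by simp
      moreover have "\<forall>\<^sub>F n in sequentially. nat \<lceil>real N / (\<epsilon> / 2)\<rceil> \<le> n" by (rule eventually_ge_at_top)
      ultimately show "\<forall>\<^sub>F n in sequentially. (\<Sum>i=1..n. plateau u v d (x i a)) \<le> (C\<^sub>0 * (v - u + 2 * d) + \<epsilon>) * real n"
      proof eventually_elim
        fix n assume n: "(\<Sum>j=1..n. Z j a) \<le> (C\<^sub>0 * (v - u + 2 * d) + \<epsilon> / 2) * real n" and nN: "nat \<lceil>real N / (\<epsilon> / 2)\<rceil> \<le> n"
        have "real N / (\<epsilon> / 2) \<le> real n" using nN by linarith
        then have Nn: "real N \<le> \<epsilon> / 2 * real n" using \<epsilon> by (simp add: field_simps)
        have "(\<Sum>i=1..n. plateau u v d (x i a)) \<le> (\<Sum>i=1..n. Z i a + (if i < N then 1 else 0))"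
          by (rule sum_mono) (rule pl)
        also have "\<dots> = (\<Sum>i=1..n. Z i a) + real (card ({1..n} \<inter> {i. i < N}))"
          by (simp add: sum.distrib sum.If_cases)
        also have "card ({1..n} \<inter> {i. i < N}) \<le> card {..<N}" by (rule card_mono) auto
        finally have "(\<Sum>i=1..n. plateau u v d (x i a)) \<le> (\<Sum>i=1..n. Z i a) + real N" by simp
        then show "(\<Sum>i=1..n. plateau u v d (x i a)) \<le> (C\<^sub>0 * (v - u + 2 * d) + \<epsilon>) * real n"
          using n Nn by (simp add: algebra_simps)
      qed
    qed
  qed
qed

theorem rational_plateau_frequencies:
  "AE a in lborel. a \<in> {0<..<e1} \<longrightarrow> (\<forall>u\<in>\<rat>. \<forall>v\<in>\<rat>. \<forall>d\<in>\<rat>. u < v \<longrightarrow> 0 < d \<longrightarrow>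
    (\<forall>\<epsilon>>0. \<forall>\<^sub>F n in sequentially. (\<Sum>i=1..n. plateau u v d (x i a)) \<le> (C\<^sub>0 * (v - u + 2 * d) + \<epsilon>) * real n))"
proof -
  have "AE a in lborel. \<forall>u\<in>\<rat>. \<forall>v\<in>\<rat>. \<forall>d\<in>\<rat>. u < v \<longrightarrow> 0 < d \<longrightarrow> a \<in> {0<..<e1} \<longrightarrow>
    (\<forall>\<epsilon>>0. \<forall>\<^sub>F n in sequentially. (\<Sum>i=1..n. plateau u v d (x i a)) \<le> (C\<^sub>0 * (v - u + 2 * d) + \<epsilon>) * real n)"
    unfolding AE_ball_countable[OF countable_rat]
  proof (intro ballI)
    fix u v d :: real
    show "AE a in lborel. u < v \<longrightarrow> 0 < d \<longrightarrow> a \<in> {0<..<e1} \<longrightarrow>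
      (\<forall>\<epsilon>>0. \<forall>\<^sub>F n in sequentially. (\<Sum>i=1..n. plateau u v d (x i a)) \<le> (C\<^sub>0 * (v - u + 2 * d) + \<epsilon>) * real n)"
      by (cases "u < v \<and> 0 < d") (use plateau_frequency[of u v d] in auto)
  qed
  then show ?thesis by eventually_elim blast
qed

end

section \<open>From the conditions on the family to quantitative bounds\<close>

text \<open>The preimage of a neighbourhood of \<open>f z\<close> contains a neighbourhood of \<open>z\<close>, and invariance equates the measures of the former and of its preimage.\<close>

lemma measure_support_invariant:
  assumes ac: "acip f M" and z: "z \<in> measure_support M" and c: "isCont f z" and fz: "f z \<in> {0..1}"
  shows "f z \<in> measure_support M"
proof -
  have sets: "sets M = sets unit_leb" and fM: "f \<in> measurable M M" and di: "distr M M f = M"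
    using ac by (auto simp: acip_def)
  have sp: "space M = {0..1}" using sets_eq_imp_space_eq[OF sets] by (simp add: space_restrict_space)
  have op: "U \<inter> space M \<in> sets M" if "open U" for U :: "real set"
    using that unfolding sets sp by (auto simp: sets_restrict_space)
  have "0 < emeasure M (U \<inter> space M)" if U: "open U" "f z \<in> U" for U
  proof -
    have "\<forall>\<^sub>F w in nhds z. f w \<in> U"
      using c U by (metis continuous_at_imp_continuous_on eventually_nhds_top isCont_def tendsto_at_iff_tendsto_nhds topological_tendstoD)
    then obtain V where V: "open V" "z \<in> V" "\<And>w. w \<in> V \<Longrightarrow> f w \<in> U" by (auto simp: eventually_nhds)
    have "0 < emeasure M (V \<inter> space M)" using z V by (auto simp: measure_support_def)
    also have "\<dots> \<le> emeasure M (f -` (U \<inter> space M) \<inter> space M)"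
      using V(3) measurable_space[OF fM] measurable_sets[OF fM op[OF U(1)]] by (intro emeasure_mono) auto
    also have "\<dots> = emeasure (distr M M f) (U \<inter> space M)" using fM op[OF U(1)] by (simp add: emeasure_distr)
    finally show ?thesis unfolding di .
  qed
  then show ?thesis using fz by (auto simp: measure_support_def sp)
qed

lemma holder_with_mono:
  assumes "holder_with \<alpha> C S f" "C \<le> C'" "x \<in> S" "y \<in> S"
  shows "\<bar>f x - f y\<bar> \<le> C' * \<bar>x - y\<bar> powr \<alpha>"
proof -
  have "\<bar>f x - f y\<bar> \<le> C * \<bar>x - y\<bar> powr \<alpha>" using assms by (auto simp: holder_with_def)
  also have "\<dots> \<le> C' * \<bar>x - y\<bar> powr \<alpha>" using assms(2) by (intro mult_right_mono) auto
  finally show ?thesis .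
qed

text \<open>The constants are combined from those of finitely many branches; \<open>gap\<close> is positive because the lengths of the branches are continuous on a
  compact interval. For the bound \<open>M\<close>, the values of the family lie in \<open>{0..1}\<close>, so the mean value theorem gives a parameter
  near \<open>a\<close> where the parameter derivative at the midpoint of the branch is bounded, and Hoelder continuity
  carries the bound first to \<open>a\<close> and then to the whole branch.\<close>

lemma obtain_param_family:
  assumes \<alpha>: "0 < \<alpha>" "\<alpha> \<le> 1"
    and ef: "expanding_family \<alpha> p0 b T" and af: "acip_family T \<mu> h"
    and pi: "property_i p0 b" and pii: "property_ii \<alpha> p0 b T"
    and x0: "x0 ` {0..1} \<subseteq> {0..1}" "C1_holder_on \<alpha> {0..1} x0"
  obtains lam Lam H L M gap where "param_family \<alpha> p0 b T x0 lam Lam H L M gap"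
proof -
  have T_unit: "T a y \<in> {0..1}" if "a \<in> {0..1}" "y \<in> {0..1}" for a y
    using ef that unfolding expanding_family_def by blast
  have ends: "b 0 a = 0 \<and> b p0 a = 1" if "a \<in> {0..1}" for a using ef that unfolding expanding_family_def by blast
  have bmono: "b (k - 1) a < b k a" if "a \<in> {0..1}" "k \<in> {1..p0}" for a k
    using ef that unfolding expanding_family_def by blast
  have "p0 \<noteq> 0" using ends[of 0] by (intro notI) auto
  obtain lam Lam where lam: "1 < lam" and bnd: "\<And>a k y. a \<in> {0..1} \<Longrightarrow> k \<in> {1..p0} \<Longrightarrow> y \<in> branch b k a \<Longrightarrow>
      lam \<le> \<bar>deriv (T a) y\<bar> \<and> \<bar>deriv (T a) y\<bar> \<le> Lam"
    using ef unfolding expanding_family_def by blast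
  obtain C1 where C1: "\<And>a k. a \<in> {0..1} \<Longrightarrow> k \<in> {1..p0} \<Longrightarrow> holder_with \<alpha> C1 (branch b k a) (deriv (T a))"
    using ef unfolding expanding_family_def by blast
  obtain C2 where C2: "\<And>y J. y \<in> {0..1} \<Longrightarrow> is_interval J \<Longrightarrow> J \<subseteq> {0..1} \<Longrightarrow> (\<And>a k. a \<in> J \<Longrightarrow> k \<le> p0 \<Longrightarrow> b k a \<noteq> y) \<Longrightarrow>
      C1_holder_with \<alpha> C2 J (\<lambda>a. T a y) \<and> holder_with \<alpha> C2 J (\<lambda>a. deriv (T a) y)"
    using pii unfolding property_ii_def by blast
  obtain C3 where C3: "\<And>a k. a \<in> {0..1} \<Longrightarrow> k \<in> {1..p0} \<Longrightarrow> holder_with \<alpha> C3 (branch b k a) (param_deriv T a)"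
    using pii unfolding property_ii_def by blast
  obtain C4 g where g: "\<And>a. a \<in> {0..1} \<Longrightarrow> (x0 has_real_derivative g a) (at a within {0..1})" "holder_with \<alpha> C4 {0..1} g"
    using x0(2) unfolding C1_holder_on_def C1_holder_with_def by blast
  define H where "H = max 0 (max (max C1 C2) (max C3 C4))"
  have H: "0 \<le> H" "C1 \<le> H" "C2 \<le> H" "C3 \<le> H" "C4 \<le> H" by (auto simp: H_def)
  have "\<forall>k\<in>{0..p0}. \<exists>L. L-lipschitz_on {0..1} (b k)" using pi by (auto simp: property_i_def)
  then obtain Lk where Lk: "\<And>k. k \<in> {0..p0} \<Longrightarrow> (Lk k)-lipschitz_on {0..1} (b k)" by metis
  define L where "L = (\<Sum>k\<in>{0..p0}. Lk k)"
  have Lk0: "0 \<le> Lk k" if "k \<in> {0..p0}" for k using Lk[OF that] lipschitz_on_nonneg by blast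
  have L0: "0 \<le> L" unfolding L_def using Lk0 by (intro sum_nonneg) auto
  have b_lip: "\<bar>b k a - b k a'\<bar> \<le> L * \<bar>a - a'\<bar>" if "k \<le> p0" "a \<in> {0..1}" "a' \<in> {0..1}" for k a a'
  proof -
    have k: "k \<in> {0..p0}" using that by simp
    have "\<bar>b k a - b k a'\<bar> \<le> Lk k * \<bar>a - a'\<bar>" using lipschitz_onD[OF Lk[OF k] that(2,3)] by (simp add: dist_real_def)
    also have "\<dots> \<le> L * \<bar>a - a'\<bar>" unfolding L_def using k Lk0 by (intro mult_right_mono member_le_sum) auto
    finally show ?thesis .
  qed
  have b_cont: "continuous_on {0..1} (b k)" if "k \<le> p0" for k
    using Lk[of k] that by (intro lipschitz_on_continuous_on) auto
  have "\<exists>c>0. \<forall>a\<in>{0..1}. b (k - 1) a + c \<le> b k a" if k: "k \<in> {1..p0}" for k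
  proof -
    have k1: "k \<le> p0" "k - 1 \<le> p0" using k by (simp, simp only: atLeastAtMost_iff, linarith)
    have "continuous_on {0..1} (\<lambda>a. b k a - b (k - 1) a)" by (intro continuous_intros b_cont k1)
    then obtain a0 where a0: "a0 \<in> {0..1}" "\<And>a. a \<in> {0..1} \<Longrightarrow> b k a0 - b (k - 1) a0 \<le> b k a - b (k - 1) a"
      using continuous_attains_inf[of "{0..1::real}" "\<lambda>a. b k a - b (k - 1) a"] by auto
    show ?thesis
      by (intro exI[of _ "b k a0 - b (k - 1) a0"]) (use a0 bmono[OF a0(1) k] in force)
  qed
  then obtain gk where gk: "\<And>k. k \<in> {1..p0} \<Longrightarrow> gk k > 0" "\<And>k a. k \<in> {1..p0} \<Longrightarrow> a \<in> {0..1} \<Longrightarrow> b (k - 1) a + gk k \<le> b k a"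
    by metis
  define gap where "gap = Min (gk ` {1..p0})"
  have ne: "{1..p0} \<noteq> {}" using \<open>p0 \<noteq> 0\<close> by simp
  have gap0: "0 < gap" unfolding gap_def using gk(1) ne by (subst Min_gr_iff) auto
  have gap: "b (k - 1) a + gap \<le> b k a" if "a \<in> {0..1}" "k \<in> {1..p0}" for a k
  proof -
    have "gap \<le> gk k" unfolding gap_def using that by (intro Min_le) auto
    then show ?thesis using gk(2)[OF that(2,1)] by linarith
  qed
  have T_der: "(T a has_real_derivative deriv (T a) y) (at y)" if "a \<in> {0..1}" "k \<in> {1..p0}" "y \<in> branch b k a" for a k y
  proof -
    have "C1_holder_on \<alpha> (branch b k a) (T a)" using ef that unfolding expanding_family_def by blast
    then obtain C where "C1_holder_with \<alpha> C (branch b k a) (T a)" by (auto simp: C1_holder_on_def)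
    then obtain f' where "\<forall>y\<in>branch b k a. (T a has_real_derivative f' y) (at y within branch b k a)"
      by (auto simp: C1_holder_with_def)
    then have "(T a has_real_derivative f' y) (at y within branch b k a)" using that(3) by blast
    moreover have "at y within branch b k a = at y"
      by (rule at_within_open[OF that(3)]) (simp add: branch_def)
    ultimately have "(T a has_real_derivative f' y) (at y)" by simp
    then show ?thesis using DERIV_imp_deriv by metis
  qed
  have T_meas: "T a \<in> borel_measurable (restrict_space borel {0..1})" if "a \<in> {0..1}" for a
  proof -
    have "acip (T a) (\<mu> a)" using af that unfolding acip_family_def by blast
    then have s: "sets (\<mu> a) = sets unit_leb" and m: "T a \<in> measurable (\<mu> a) (\<mu> a)" by (auto simp: acip_def)
    have "T a \<in> measurable unit_leb unit_leb" using m measurable_cong_sets[OF s s] by simp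
    moreover have "(\<lambda>z. z) \<in> measurable unit_leb (borel :: real measure)"
      by (rule measurable_restrict_space1) simp
    ultimately have "(\<lambda>z. T a z) \<in> measurable unit_leb borel" by (rule measurable_compose)
    moreover have "sets unit_leb = sets (restrict_space borel {0..1::real})" by (simp add: sets_restrict_space)
    ultimately show ?thesis using measurable_cong_sets[OF _ refl, of unit_leb "restrict_space borel {0..1}" borel] by blast
  qed
  have b_mono: "b i a \<le> b j a" if "i \<le> j" "j \<le> p0" "a \<in> {0..1}" for i j a
    using that(1,2)
  proof (induction j rule: dec_induct)
    case (step n)
    then show ?case using bmono[OF that(3), of "Suc n"] by simp
  qed simp
  have off: "b i a \<noteq> y" "y \<in> {0..1}" if a: "a \<in> {0..1}" and k: "k \<in> {1..p0}" and y: "y \<in> branch b k a" and i: "i \<le> p0" for a k y i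
  proof -
    have k1: "k \<le> p0" "k - 1 \<le> p0" using k by (simp, simp only: atLeastAtMost_iff, linarith)
    show "b i a \<noteq> y"
    proof (cases "i \<le> k - 1")
      case True then show ?thesis using b_mono[OF True k1(2) a] y by (auto simp: branch_def)
    next
      case False
      then have "k \<le> i" by linarith
      then show ?thesis using b_mono[OF _ i a, of k] y by (auto simp: branch_def)
    qed
    show "y \<in> {0..1}" using b_mono[of 0 "k - 1" a] b_mono[of k p0 a] ends[OF a] y k1 a by (auto simp: branch_def)
  qed
  have T_param: "((\<lambda>s. T s y) has_real_derivative param_deriv T a y) (at a)"
    if a: "a \<in> {0<..<1}" and k: "k \<in> {1..p0}" and y: "y \<in> branch b k a" for a k y
  proof -
    have k1: "k \<le> p0" "k - 1 \<le> p0" using k by (simp, simp only: atLeastAtMost_iff, linarith)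
    have ic: "isCont (b i) a" if "i \<le> p0" for i
      using continuous_on_interior[OF b_cont[OF that]] a by (simp add: interior_atLeastAtMost_real)
    have "\<forall>\<^sub>F s in nhds a. b (k - 1) s < y" "\<forall>\<^sub>F s in nhds a. y < b k s"
      using order_tendstoD(2)[of "b (k - 1)" "b (k - 1) a" "nhds a" y] order_tendstoD(1)[of "b k" "b k a" "nhds a" y]
        ic[OF k1(1)] ic[OF k1(2)] y by (auto simp: branch_def isCont_def tendsto_at_iff_tendsto_nhds)
    moreover have "\<forall>\<^sub>F s in nhds a. s \<in> {0<..<1}" using a by (intro eventually_nhds_in_open) auto
    ultimately have "\<forall>\<^sub>F s in nhds a. s \<in> {0<..<1} \<and> y \<in> branch b k s" by eventually_elim (auto simp: branch_def)
    then obtain r where r: "r > 0" "\<And>s. dist s a < r \<Longrightarrow> s \<in> {0<..<1} \<and> y \<in> branch b k s"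
      unfolding eventually_nhds_metric by blast
    define J where "J = {a - r<..<a + r}"
    have J: "s \<in> {0<..<1} \<and> y \<in> branch b k s" if "s \<in> J" for s using r(2)[of s] that by (auto simp: J_def dist_real_def)
    have aJ: "a \<in> J" using r by (simp add: J_def)
    have a01: "a \<in> {0..1}" using a by auto
    have "C1_holder_with \<alpha> C2 J (\<lambda>s. T s y)"
    proof (rule conjunct1, rule C2)
      show "y \<in> {0..1}" by (rule off(2)[OF a01 k y le0])
      show "is_interval J" by (simp add: J_def is_interval_1)
      show "J \<subseteq> {0..1}" using J by force
      show "b i s \<noteq> y" if "s \<in> J" "i \<le> p0" for s i by (rule off(1)[OF _ k _ that(2)]) (use J[OF that(1)] in auto)
    qed
    then obtain f' where "((\<lambda>s. T s y) has_real_derivative f' a) (at a within J)" using aJ unfolding C1_holder_with_def by blast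
    moreover have "at a within J = at a" by (rule at_within_open[OF aJ]) (simp add: J_def)
    ultimately have d: "((\<lambda>s. T s y) has_real_derivative f' a) (at a)" by simp
    have "at a within {0..1} = at a" using a by (intro at_within_interior) (simp add: interior_atLeastAtMost_real)
    then have "param_deriv T a y = f' a"
      unfolding param_deriv_def using d by (simp add: has_real_derivative_iff_has_vector_derivative vector_derivative_at)
    then show ?thesis using d by simp
  qed
  have segment: "C1_holder_with \<alpha> C2 {s..t} (\<lambda>a. T a y) \<and> holder_with \<alpha> C2 {s..t} (\<lambda>a. deriv (T a) y)"
    if st: "s \<le> t" "{s..t} \<subseteq> {0<..<1}" and k: "k \<in> {1..p0}" and y: "\<And>a. a \<in> {s..t} \<Longrightarrow> y \<in> branch b k a" for s t k y
  proof (rule C2)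
    have s: "s \<in> {s..t}" using st by simp
    have in01: "a \<in> {0..1}" if "a \<in> {s..t}" for a using st(2) that by force
    show "y \<in> {0..1}" by (rule off(2)[OF in01[OF s] k y[OF s] le0])
    show "is_interval {s..t}" by (simp add: is_interval_1)
    show "{s..t} \<subseteq> {0..1}" using in01 by blast
    show "b i a \<noteq> y" if "a \<in> {s..t}" "i \<le> p0" for a i by (rule off(1)[OF in01[OF that(1)] k y[OF that(1)] that(2)])
  qed
  have T'_a: "\<bar>deriv (T s) y - deriv (T t) y\<bar> \<le> H * \<bar>s - t\<bar> powr \<alpha>"
    if "s \<le> t" "{s..t} \<subseteq> {0<..<1}" "k \<in> {1..p0}" "\<And>a. a \<in> {s..t} \<Longrightarrow> y \<in> branch b k a" for s t k y
    using holder_with_mono[OF conjunct2[OF segment[OF that]] H(3), of s t] that(1) by simp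
  have P_a: "\<bar>param_deriv T s y - param_deriv T t y\<bar> \<le> H * \<bar>s - t\<bar> powr \<alpha>"
    if st: "s \<le> t" "{s..t} \<subseteq> {0<..<1}" "k \<in> {1..p0}" and y: "\<And>a. a \<in> {s..t} \<Longrightarrow> y \<in> branch b k a" for s t k y
  proof (cases "s = t")
    case False
    then have lt: "s < t" using st by simp
    obtain f' where f': "\<And>a. a \<in> {s..t} \<Longrightarrow> ((\<lambda>a. T a y) has_real_derivative f' a) (at a within {s..t})" "holder_with \<alpha> C2 {s..t} f'"
      using segment[OF st y] unfolding C1_holder_with_def by blast
    have eq: "param_deriv T a y = f' a" if a: "a \<in> {s..t}" for a
    proof -
      have "((\<lambda>a. T a y) has_real_derivative param_deriv T a y) (at a)" using T_param[OF _ st(3) y[OF a]] st(2) a by blast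
      then have "((\<lambda>a. T a y) has_real_derivative param_deriv T a y) (at a within {s..t})" by (rule has_field_derivative_at_within)
      then show ?thesis
        using vector_derivative_unique_within_closed_interval[OF lt, of a "\<lambda>a. T a y" "param_deriv T a y" "f' a"] f'(1)[OF a] a
        by (simp add: has_real_derivative_iff_has_vector_derivative)
    qed
    show ?thesis using holder_with_mono[OF f'(2) H(3), of s t] eq[of s] eq[of t] st(1) by simp
  qed simp
  have P_x: "\<bar>param_deriv T a y - param_deriv T a z\<bar> \<le> H * \<bar>y - z\<bar> powr \<alpha>"
    if "a \<in> {0..1}" "k \<in> {1..p0}" "y \<in> branch b k a" "z \<in> branch b k a" for a k y z
    by (rule holder_with_mono[OF C3[OF that(1,2)] H(4) that(3,4)])
  \<comment> \<open>A parameter step during which the midpoint of a branch stays inside this branch.\<close>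
  define \<eta> where "\<eta> = min (1/4) (gap / (4 * (L + 1)))"
  have \<eta>: "0 < \<eta>" "\<eta> \<le> 1/4" "L * \<eta> \<le> gap / 4"
  proof -
    show "0 < \<eta>" using gap0 L0 by (simp add: \<eta>_def)
    show "\<eta> \<le> 1/4" unfolding \<eta>_def by (rule min.cobounded1)
    have "L * \<eta> \<le> (L + 1) * (gap / (4 * (L + 1)))" using L0 \<open>0 < \<eta>\<close> gap0 by (intro mult_mono) (simp_all add: \<eta>_def)
    also have "\<dots> = gap / 4" using L0 by (simp add: field_simps)
    finally show "L * \<eta> \<le> gap / 4" .
  qed
  define M where "M = 1 / \<eta> + 2 * H"
  have mid: "u' < (u + v) / 2 \<and> (u + v) / 2 < v'"
    if "\<bar>v' - v\<bar> \<le> r / 4" "\<bar>u' - u\<bar> \<le> r / 4" "u + r \<le> v" "0 < r" for u v u' v' r :: real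
    using abs_le_D2[OF that(1)] abs_le_D1[OF that(2)] that(3,4) by (simp add: field_simps)
  have P_b: "\<bar>param_deriv T a y\<bar> \<le> M" if a: "a \<in> {0<..<1}" and k: "k \<in> {1..p0}" and y: "y \<in> branch b k a" for a k y
  proof -
    have k1: "k \<le> p0" "k - 1 \<le> p0" using k by (simp, simp only: atLeastAtMost_iff, linarith)
    have a01: "a \<in> {0..1}" using a by auto
    define c where "c = (b (k - 1) a + b k a) / 2"
    \<comment> \<open>A segment of length \<open>\<eta>\<close> that starts or ends at \<open>a\<close> and stays in \<open>{0<..<1}\<close>.\<close>
    define s t where "s = (if a \<le> 1/2 then a else a - \<eta>)" and "t = (if a \<le> 1/2 then a + \<eta> else a)"
    have st: "s < t" "t - s = \<eta>" "a = s \<or> a = t" "{s..t} \<subseteq> {0<..<1}"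
      using \<eta> a by (auto simp: s_def t_def)
    have cb: "c \<in> branch b k r" if r: "r \<in> {s..t}" for r
    proof -
      have r01: "r \<in> {0..1}" using r st(4) by force
      have "\<bar>r - a\<bar> \<le> \<eta>" using r st by auto
      then have "L * \<bar>r - a\<bar> \<le> gap / 4" using \<eta>(3) L0 mult_left_mono[of "\<bar>r - a\<bar>" \<eta> L] by linarith
      then have "\<bar>b k r - b k a\<bar> \<le> gap / 4" "\<bar>b (k - 1) r - b (k - 1) a\<bar> \<le> gap / 4"
        using b_lip[OF k1(1) r01 a01] b_lip[OF k1(2) r01 a01] by linarith+
      then have "b (k - 1) r < c" "c < b k r" using mid[OF _ _ gap[OF a01 k] gap0] unfolding c_def by blast+
      then show ?thesis by (simp add: branch_def)
    qed
    obtain \<xi> where \<xi>: "s < \<xi>" "\<xi> < t" "T t c - T s c = (t - s) * param_deriv T \<xi> c"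
    proof -
      have "((\<lambda>a. T a c) has_real_derivative param_deriv T r c) (at r)" if "s \<le> r" "r \<le> t" for r
        using T_param[OF _ k cb[of r]] st(4) that by auto
      then show thesis using MVT2[OF st(1), of "\<lambda>a. T a c" "\<lambda>r. param_deriv T r c"] that by blast
    qed
    have "s \<in> {s..t}" "t \<in> {s..t}" using st(1) by auto
    then have "s \<in> {0<..<1}" "t \<in> {0<..<1}" using st(4) by blast+
    then have s01: "s \<in> {0..1}" "t \<in> {0..1}" by auto
    have cu: "c \<in> {0..1}" by (rule off(2)[OF s01(1) k cb le0]) (use st(1) in simp)
    have "\<bar>T t c - T s c\<bar> \<le> 1" using T_unit[OF s01(1) cu] T_unit[OF s01(2) cu] by auto
    then have "\<eta> * \<bar>param_deriv T \<xi> c\<bar> \<le> 1" using \<xi>(3) st(2) \<eta>(1) by (simp add: abs_mult)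
    then have 1: "\<bar>param_deriv T \<xi> c\<bar> \<le> 1 / \<eta>" using \<eta>(1) by (simp add: field_simps)
    have pw: "H * r powr \<alpha> \<le> H" if "0 \<le> r" "r \<le> 1" for r
      using mult_left_mono[OF powr_le1[of \<alpha> r] H(1)] that \<alpha> by simp
    have 2: "\<bar>param_deriv T \<xi> c - param_deriv T a c\<bar> \<le> H"
    proof (cases "a = s")
      case True
      have "\<bar>param_deriv T s c - param_deriv T \<xi> c\<bar> \<le> H * \<bar>s - \<xi>\<bar> powr \<alpha>"
        by (rule P_a[OF _ _ k]) (use \<xi> st(4) cb in auto)
      also have "\<dots> \<le> H" using \<xi>(1,2) st(2) \<eta>(2) by (intro pw) auto
      finally show ?thesis using True by (simp add: abs_minus_commute)
    next
      case False
      then have at: "a = t" using st(3) by simp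
      have "\<bar>param_deriv T \<xi> c - param_deriv T t c\<bar> \<le> H * \<bar>\<xi> - t\<bar> powr \<alpha>"
        by (rule P_a[OF _ _ k]) (use \<xi> st(4) cb in auto)
      also have "\<dots> \<le> H" using \<xi>(1,2) st(2) \<eta>(2) by (intro pw) auto
      finally show ?thesis using at by simp
    qed
    have ca: "c \<in> branch b k a" using cb[of a] st(1,3) by auto
    have "\<bar>param_deriv T a c - param_deriv T a y\<bar> \<le> H * \<bar>c - y\<bar> powr \<alpha>" by (rule P_x[OF a01 k ca y])
    also have "\<dots> \<le> H" by (rule pw) (use cu off(2)[OF a01 k y le0] in auto)
    finally show ?thesis using 1 2 unfolding M_def by linarith
  qed
  have x0d: "(x0 has_real_derivative deriv x0 a) (at a)" "deriv x0 a = g a" if a: "a \<in> {0<..<1}" for a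
  proof -
    have "at a within {0..1} = at a" using a by (intro at_within_interior) (simp add: interior_atLeastAtMost_real)
    then have "(x0 has_real_derivative g a) (at a)" using g(1)[of a] a by auto
    then show "deriv x0 a = g a" "(x0 has_real_derivative deriv x0 a) (at a)" using DERIV_imp_deriv by metis+
  qed
  have "param_family \<alpha> p0 b T x0 lam Lam H L M gap"
  proof
    show "0 < \<alpha>" "\<alpha> \<le> 1" "0 < gap" "0 \<le> L" "0 \<le> H" "1 < lam" by fact+
    show "0 \<le> M" using H(1) \<eta>(1) by (simp add: M_def)
    show "T a y \<in> {0..1}" if "a \<in> {0..1}" "y \<in> {0..1}" for a y by (rule T_unit[OF that])
    show "T a \<in> borel_measurable (restrict_space borel {0..1})" if "a \<in> {0..1}" for a by (rule T_meas[OF that])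
    show "b 0 a = 0 \<and> b p0 a = 1" if "a \<in> {0..1}" for a by (rule ends[OF that])
    show "b (k - 1) a + gap \<le> b k a" if "a \<in> {0..1}" "k \<in> {1..p0}" for a k by (rule gap[OF that])
    show "\<bar>b k a - b k a'\<bar> \<le> L * \<bar>a - a'\<bar>" if "k \<le> p0" "a \<in> {0..1}" "a' \<in> {0..1}" for k a a' by (rule b_lip[OF that])
    show "(T a has_real_derivative deriv (T a) y) (at y)" if "a \<in> {0..1}" "k \<in> {1..p0}" "y \<in> branch b k a" for a k y by (rule T_der[OF that])
    show "\<bar>deriv (T a) y - deriv (T a) z\<bar> \<le> H * \<bar>y - z\<bar> powr \<alpha>"
      if "a \<in> {0..1}" "k \<in> {1..p0}" "y \<in> branch b k a" "z \<in> branch b k a" for a k y z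
      by (rule holder_with_mono[OF C1[OF that(1,2)] H(2) that(3,4)])
    show "lam \<le> \<bar>deriv (T a) y\<bar> \<and> \<bar>deriv (T a) y\<bar> \<le> Lam" if "a \<in> {0..1}" "k \<in> {1..p0}" "y \<in> branch b k a" for a k y by (rule bnd[OF that])
    show "((\<lambda>s. T s y) has_real_derivative param_deriv T a y) (at a)" if "a \<in> {0<..<1}" "k \<in> {1..p0}" "y \<in> branch b k a" for a k y by (rule T_param[OF that])
    show "\<bar>deriv (T s) y - deriv (T t) y\<bar> \<le> H * \<bar>s - t\<bar> powr \<alpha>"
      if "s \<le> t" "{s..t} \<subseteq> {0<..<1}" "k \<in> {1..p0}" "\<And>a. a \<in> {s..t} \<Longrightarrow> y \<in> branch b k a" for s t k y by (rule T'_a[OF that])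
    show "\<bar>param_deriv T a y - param_deriv T a z\<bar> \<le> H * \<bar>y - z\<bar> powr \<alpha>"
      if "a \<in> {0..1}" "k \<in> {1..p0}" "y \<in> branch b k a" "z \<in> branch b k a" for a k y z by (rule P_x[OF that])
    show "\<bar>param_deriv T s y - param_deriv T t y\<bar> \<le> H * \<bar>s - t\<bar> powr \<alpha>"
      if "s \<le> t" "{s..t} \<subseteq> {0<..<1}" "k \<in> {1..p0}" "\<And>a. a \<in> {s..t} \<Longrightarrow> y \<in> branch b k a" for s t k y by (rule P_a[OF that])
    show "\<bar>param_deriv T a y\<bar> \<le> M" if "a \<in> {0<..<1}" "k \<in> {1..p0}" "y \<in> branch b k a" for a k y by (rule P_b[OF that])
    show "x0 a \<in> {0..1}" if "a \<in> {0..1}" for a using x0(1) that by blast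
    show "(x0 has_real_derivative deriv x0 a) (at a)" if "a \<in> {0<..<1}" for a by (rule x0d(1)[OF that])
    show "\<bar>deriv x0 s - deriv x0 t\<bar> \<le> H * \<bar>s - t\<bar> powr \<alpha>" if "s \<in> {0<..<1}" "t \<in> {0<..<1}" for s t
      unfolding x0d(2)[OF that(1)] x0d(2)[OF that(2)] by (rule holder_with_mono[OF g(2) H(5)]) (use that in auto)
  qed
  then show thesis by (rule that)
qed

text \<open>The limit \<open>m\<close> of the space derivative of the \<open>N\<close>-th iterate is at least \<open>lam ^ N\<close>, and condition (I) makes the parameter derivative comparable with it.\<close>

lemma (in param_family) derivative_unbounded_under_condition_I:
  assumes I: "condition_I p0 b T x0"
    and x0_in: "\<And>a. a \<in> {0<..<1} \<Longrightarrow> x0 a \<in> {0<..<1}"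
  obtains N d where "N \<ge> 1" "R \<le> \<bar>d\<bar>" "(x N has_real_derivative d) (at_right 0)"
proof -
  interpret pm: piecewise_expanding_map "T 0" p0 "\<lambda>k. b k 0" lam by (rule piecewise_expanding) simp
  obtain C where C: "C \<ge> 1" and dm: "\<And>j. j \<ge> 1 \<Longrightarrow> \<exists>d m. (x j has_real_derivative d) (at_right 0) \<and>
        (\<forall>\<^sub>F a in at_right 0. (T 0 ^^ j) differentiable (at (x0 a))) \<and>
        ((\<lambda>a. deriv (T 0 ^^ j) (x0 a)) \<longlongrightarrow> m) (at_right 0) \<and> 1 / C \<le> \<bar>d / m\<bar> \<and> \<bar>d / m\<bar> \<le> C"
    using I unfolding condition_I_def by blast
  obtain n where n: "\<bar>R\<bar> * C < lam ^ n" using real_arch_pow[OF lam] by blast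
  define N where "N = max n 1"
  have "lam ^ n \<le> lam ^ N" using lam by (intro power_increasing) (auto simp: N_def)
  then have N: "\<bar>R\<bar> * C \<le> lam ^ N" "N \<ge> 1" using n by (auto simp: N_def)
  obtain d m where d: "(x N has_real_derivative d) (at_right 0)"
    and diff: "\<forall>\<^sub>F a in at_right 0. (T 0 ^^ N) differentiable (at (x0 a))"
    and m: "((\<lambda>a. deriv (T 0 ^^ N) (x0 a)) \<longlongrightarrow> m) (at_right 0)" and C1: "1 / C \<le> \<bar>d / m\<bar>"
    using dm[OF N(2)] by blast
  have "\<forall>\<^sub>F a in at_right 0. a \<in> {0<..<1::real}" by (rule eventually_at_right_real) simp
  with diff have "\<forall>\<^sub>F a in at_right 0. lam ^ N \<le> \<bar>deriv (T 0 ^^ N) (x0 a)\<bar>"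
    by eventually_elim (rule pm.derivative_of_iterate_lower[OF x0_in])
  then have lm: "lam ^ N \<le> \<bar>m\<bar>" by (intro tendsto_lowerbound[OF tendsto_rabs[OF m]]) auto
  have m0: "0 < \<bar>m\<bar>" using lm lam zero_less_power[of lam N] by linarith
  have "\<bar>m\<bar> / C \<le> \<bar>d\<bar>" using C1 C m0 by (simp add: abs_divide field_simps)
  moreover have "\<bar>R\<bar> \<le> \<bar>m\<bar> / C" using N(1) lm C by (simp add: pos_le_divide_eq)
  ultimately have "R \<le> \<bar>d\<bar>" by linarith
  then show thesis using that d N(2) by blast
qed

theorem theorem3p5:
  fixes \<alpha> A \<epsilon> C :: real
    and p0 :: nat
    and b :: "nat \<Rightarrow> real \<Rightarrow> real"
    and T :: "real \<Rightarrow> real \<Rightarrow> real"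
    and \<mu> :: "real \<Rightarrow> real measure"
    and h :: "real \<Rightarrow> real \<Rightarrow> real"
    and K :: "real \<Rightarrow> real set"
    and x0 :: "real \<Rightarrow> real"
  assumes "0 < \<alpha>" and "\<alpha> \<le> 1" and "0 < A"
    and "expanding_family \<alpha> p0 b T"
    and "acip_family T \<mu> h"
    and K: "\<And>a. K a = measure_support (\<mu> a)"
    and "property_i p0 b"
    and "property_ii \<alpha> p0 b T"
    and "property_iii \<alpha> p0 b K"
    and "x0 ` {0..1} \<subseteq> {0..1}"
    and "C1_holder_on \<alpha> {0..1} x0"
    and "\<And>a. a \<in> {0<..<1} \<Longrightarrow> x0 a \<in> K a - part_pts p0 b a"
    and "condition_I p0 b T x0"
    and "condition_II A \<alpha> p0 b T K"
    and "condition_III p0 b T K x0"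
    and "0 < \<epsilon>" and "\<epsilon> \<le> 1" and "0 < C"
    and "\<And>a. a \<in> {0..\<epsilon>} \<Longrightarrow>
           essinf (restrict_space lborel (K a)) (\<lambda>x. ereal (h a x)) \<ge> ereal (1 / C)"
  shows "\<exists>\<epsilon>'. 0 < \<epsilon>' \<and> \<epsilon>' \<le> \<epsilon> \<and>
           (AE a in lborel. a \<in> {0..\<epsilon>'} \<longrightarrow> typical_point (T a) (\<mu> a) (x0 a))"
proof -
  obtain lam Lam H L M gap where pf: "param_family \<alpha> p0 b T x0 lam Lam H L M gap"
    using obtain_param_family[OF assms(1,2,4,5,7,8,10,11)] by blast
  interpret param_family \<alpha> p0 b T x0 lam Lam H L M gap by (rule pf)
  have acip: "acip (T a) (\<mu> a)" "\<And>\<nu>. acip (T a) \<nu> \<Longrightarrow> \<nu> = \<mu> a" if "a \<in> {0..1}" for a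
    using assms(5) that unfolding acip_family_def by blast+
  have space_\<mu>: "space (\<mu> a) = {0..1}" if "a \<in> {0..1}" for a
    using acip(1)[OF that] sets_eq_imp_space_eq[of "\<mu> a" unit_leb] by (simp add: acip_def space_restrict_space)
  have ends: "0 \<in> part_pts p0 b a" "1 \<in> part_pts p0 b a" if "a \<in> {0..1}" for a
    using b_ends[OF that] by (force simp: part_pts_def)+
  have x0_in: "x0 a \<in> {0<..<1}" if a: "a \<in> {0<..<1}" for a
  proof -
    have a01: "a \<in> {0..1}" using a by auto
    have "x0 a \<in> {0..1}" by (rule x0_unit[OF a01])
    moreover have "x0 a \<noteq> 0" "x0 a \<noteq> 1" using assms(12)[OF a] ends[OF a01] by auto
    ultimately show ?thesis by auto
  qed
  have T_cont: "isCont (T a) z" if a: "a \<in> {0..1}" and z: "z \<in> {0..1}" "z \<notin> part_pts p0 b a" for a z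
  proof -
    obtain k where "k \<in> {1..p0}" "z \<in> branch b k a" by (rule in_some_branch[OF a z])
    then show ?thesis using T_der[OF a] DERIV_isCont by blast
  qed
  have K_orb: "x j a \<in> K a" if "a \<in> G 1 j" for a j
    using that
  proof (induction j)
    case 0 then show ?case using assms(12)[of a] by (simp add: G_0 x_0)
  next
    case (Suc j)
    then have aj: "a \<in> G 1 j" "x j a \<notin> part_pts p0 b a" by (auto simp: G_Suc)
    have a01: "a \<in> {0..1}" using G_D[OF aj(1)] by auto
    have xj: "x j a \<in> {0..1}" "T a (x j a) \<in> {0..1}" using x_unit[OF a01] T_unit[OF a01] by blast+
    have "T a (x j a) \<in> measure_support (\<mu> a)"
      by (rule measure_support_invariant[OF acip(1)[OF a01] _ T_cont[OF a01 xj(1) aj(2)] xj(2)])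
         (use Suc.IH[OF aj(1)] in \<open>simp add: K\<close>)
    then show ?case by (simp add: K x_Suc)
  qed
  \<comment> \<open>The derivative that the orbit map has to reach before its growth takes over.\<close>
  define \<kappa> where "\<kappa> = 1 + L + 2 * M / (lam - 1)"
  have \<kappa>: "1 \<le> \<kappa>" "L < \<kappa>" "2 * M \<le> (lam - 1) * \<kappa>"
  proof -
    have q: "0 \<le> 2 * M / (lam - 1)" using M lam by simp
    then show "1 \<le> \<kappa>" "L < \<kappa>" using L by (auto simp: \<kappa>_def)
    have "2 * M = (lam - 1) * (2 * M / (lam - 1))" using lam by simp
    also have "\<dots> \<le> (lam - 1) * \<kappa>" using L lam by (intro mult_left_mono) (auto simp: \<kappa>_def)
    finally show "2 * M \<le> (lam - 1) * \<kappa>" .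
  qed
  obtain N d where N: "N \<ge> 1" and d: "\<kappa> + 1 \<le> \<bar>d\<bar>" "(x N has_real_derivative d) (at_right 0)"
    by (rule derivative_unbounded_under_condition_I[OF assms(13) x0_in])
  have "\<forall>j\<ge>1. \<exists>V. openin (top_of_set {0..1}) V \<and> 0 \<in> V \<and> (\<forall>a\<in>V - {0}. \<forall>i<j. x i a \<notin> part_pts p0 b a)"
    using assms(13) unfolding condition_I_def by (rule conjunct2)
  then have "\<exists>V. openin (top_of_set {0..1}) V \<and> 0 \<in> V \<and> (\<forall>a\<in>V - {0}. \<forall>i<N. x i a \<notin> part_pts p0 b a)"
    using N by simp
  then obtain V where V: "openin (top_of_set {0..1}) V" "0 \<in> V" "\<And>a i. a \<in> V - {0} \<Longrightarrow> i < N \<Longrightarrow> x i a \<notin> part_pts p0 b a"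
    by (elim exE conjE) blast
  obtain r1 where r1: "r1 > 0" "ball 0 r1 \<inter> {0..1} \<subseteq> V" using V(1,2) by (meson openin_contains_ball)
  obtain e2 C2 \<rho> where e2: "0 < e2" "e2 \<le> 1" "1 \<le> C2" "0 < \<rho>" "\<rho> < 1"
    and LY: "\<And>\<phi> a n. \<phi> \<in> V_space A \<alpha> \<Longrightarrow> a \<in> {0..e2} \<Longrightarrow> n \<ge> 1 \<Longrightarrow>
           alpha_norm A \<alpha> ((transfer_op (T a) (part_pts p0 b a) ^^ n) \<phi>)
             \<le> ennreal (C2 * \<rho> ^ n) * alpha_norm A \<alpha> \<phi> + ennreal C2 * L1_norm \<phi>"
    using assms(14) unfolding condition_II_def by blast
  obtain e3 where e3: "0 < e3" "e3 \<le> 1" and III: "\<And>\<delta>. \<delta> > 0 \<Longrightarrow> \<exists>C. \<forall>n\<ge>1.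
        (\<Sum>\<^sub>\<infinity>\<omega>\<in>param_partition (orb T x0) K (part_pts p0 b) n {0..e3}.
            inverse (SUP a\<in>\<omega>. ennreal \<bar>deriv (orb T x0 n) a\<bar>)) \<le> ennreal (C * exp (real n powr \<delta>))"
    using assms(15) unfolding condition_III_def by blast
  obtain C3 where C3: "\<And>n. n \<ge> 1 \<Longrightarrow> (\<Sum>\<^sub>\<infinity>\<omega>\<in>param_partition (orb T x0) K (part_pts p0 b) n {0..e3}.
            inverse (SUP a\<in>\<omega>. ennreal \<bar>deriv (orb T x0 n) a\<bar>)) \<le> ennreal (C3 * exp (real n powr (1/4)))"
    using III[of "1/4"] by auto
  define e0 where "e0 = min r1 1"
  have e0: "0 < e0" "e0 \<le> 1" using r1 by (auto simp: e0_def)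
  have off0: "x i a \<notin> part_pts p0 b a" if "a \<in> {0<..<e0}" "i < N" for a i
  proof -
    have "a \<in> ball 0 r1 \<inter> {0..1}" using that by (auto simp: e0_def dist_real_def)
    then have "a \<in> V" using r1(2) by blast
    then show ?thesis using V(3)[of a i] that by auto
  qed
  have lim: "(x' N \<longlongrightarrow> d) (at_right 0)" by (rule x'_tendsto_right_derivative[OF e0 off0 d(2)])
  have "\<forall>\<^sub>F a in at_right 0. \<kappa> < \<bar>x' N a\<bar>" "\<forall>\<^sub>F a in at_right 0. \<bar>x' N a\<bar> < \<bar>d\<bar> + 1"
    using order_tendstoD[OF tendsto_rabs[OF lim]] d(1) by auto
  then have "\<forall>\<^sub>F a in at_right 0. \<kappa> \<le> \<bar>x' N a\<bar> \<and> \<bar>x' N a\<bar> \<le> \<bar>d\<bar> + 1" by eventually_elim auto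
  then obtain r2 where r2: "r2 > 0" "\<And>a. 0 < a \<Longrightarrow> a < r2 \<Longrightarrow> \<kappa> \<le> \<bar>x' N a\<bar> \<and> \<bar>x' N a\<bar> \<le> \<bar>d\<bar> + 1"
    unfolding eventually_at_right_field by blast
  \<comment> \<open>Parameters below \<open>r3\<close> move the partition points by less than a quarter of \<open>gap\<close>.\<close>
  define r3 where "r3 = gap / (4 * (L + 1))"
  have r3: "0 < r3" using gap(1) L by (simp add: r3_def)
  define e1 where "e1 = min (min e0 (min e2 e3)) (min (min r2 r3) \<epsilon>)"
  have e1: "0 < e1" "e1 \<le> e0" "e1 \<le> e2" "e1 \<le> e3" "e1 \<le> r2" "e1 \<le> r3" "e1 \<le> \<epsilon>"
    using e0 e2 e3 r2 r3 assms(16) by (auto simp: e1_def)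
  have e1L: "4 * L * e1 < gap"
  proof -
    have "4 * L * e1 < 4 * (L + 1) * e1" using e1(1) by simp
    also have "\<dots> \<le> 4 * (L + 1) * r3" using e1(6) L by (intro mult_left_mono) auto
    also have "\<dots> = gap" using L by (simp add: r3_def)
    finally show ?thesis .
  qed
  \<comment> \<open>The number of pieces in \<open>AE_le_if_alpha_norm_le\<close>: their length must not exceed \<open>A\<close>.\<close>
  define m where "m = nat \<lceil>1 / A\<rceil> + 1"
  have m: "m \<ge> 1" "1 / real m \<le> A"
  proof -
    show "m \<ge> 1" by (simp add: m_def)
    have "1 / A \<le> real m" using assms(3) by (simp add: m_def) linarith
    then show "1 / real m \<le> A" using assms(3) \<open>m \<ge> 1\<close> by (simp add: field_simps)
  qed
  define Kc where "Kc = 2 * real m * C2 * (4 * A powr (1 - \<alpha>) + 1) + 1"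
  have pre: "{y\<in>W. (T a ^^ n) y \<in> E} \<in> sets borel \<and>
       measure lborel {y\<in>W. (T a ^^ n) y \<in> E} \<le> Kc * (\<rho> ^ n + measure lborel W) * measure lborel E"
    if a: "a \<in> {0<..<e1}" and W: "is_interval W" "W \<in> sets borel" "W \<subseteq> {0..1}" and E: "E \<in> sets borel" "E \<subseteq> {0..1}" for a n W E
  proof -
    have a01: "a \<in> {0..1}" "a \<in> {0..e2}" using a e1 e2 by auto
    interpret pm: piecewise_expanding_map "T a" p0 "\<lambda>k. b k a" lam by (rule piecewise_expanding[OF a01(1)])
    have C20: "0 \<le> C2" using e2 by simp
    have LY': "alpha_norm A \<alpha> ((pm.L ^^ n) \<phi>) \<le> ennreal (C2 * \<rho> ^ n) * alpha_norm A \<alpha> \<phi> + ennreal C2 * L1_norm \<phi>"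
      if "\<phi> \<in> V_space A \<alpha>" "n \<ge> 1" for \<phi> n
      using LY[OF that(1) a01(2) that(2)] unfolding part_pts_def .
    show ?thesis
      using pm.preimage_measure_bound[OF assms(3,1,2) m C20 e2(4) LY' W E] unfolding Kc_def by blast
  qed
  have "expanding_near_0_partition \<alpha> p0 b T x0 lam Lam H L M gap N e1 \<kappa> (\<bar>d\<bar> + 1) Kc \<rho> K e3 (max C3 0)"
  proof
    show "0 < e1" "e1 \<le> 1" "4 * L * e1 < gap" using e1 e0 e1L by auto
    show "x i a \<notin> part_pts p0 b a" if "a \<in> {0<..<e1}" "i < N" for a i
      by (rule off0) (use that e1 in auto)
    show "1 \<le> \<kappa>" "L < \<kappa>" "2 * M \<le> (lam - 1) * \<kappa>" by (fact \<kappa>)+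
    show "\<kappa> \<le> \<bar>x' N a\<bar> \<and> \<bar>x' N a\<bar> \<le> \<bar>d\<bar> + 1" if "a \<in> {0<..<e1}" for a
      by (rule r2(2)) (use that e1 in auto)
    show "0 \<le> Kc" using e2 by (simp add: Kc_def)
    show "0 < \<rho>" "\<rho> < 1" by (fact e2)+
    show "{y\<in>W. (T a ^^ n) y \<in> E} \<in> sets borel \<and>
       measure lborel {y\<in>W. (T a ^^ n) y \<in> E} \<le> Kc * (\<rho> ^ n + measure lborel W) * measure lborel E"
      if "a \<in> {0<..<e1}" "is_interval W" "W \<in> sets borel" "W \<subseteq> {0..1}" "E \<in> sets borel" "E \<subseteq> {0..1}" for a n W E
      by (rule pre[OF that])
    show "e1 \<le> e3" "e3 \<le> 1" by (fact e1 e3)+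
    show "0 \<le> max C3 0" by simp
    show "x j a \<in> K a" if "a \<in> G 1 j" for a j by (rule K_orb[OF that])
    show "(\<Sum>\<^sub>\<infinity>\<omega>\<in>param_partition x K (part_pts p0 b) n {0..e3}. inverse (SUP a\<in>\<omega>. ennreal \<bar>x' n a\<bar>))
        \<le> ennreal (max C3 0 * exp (real n powr (1/4)))" if "n \<ge> 1" for n
      by (rule order_trans[OF C3[OF that]]) (auto intro!: ennreal_leI mult_right_mono)
  qed
  then interpret part: expanding_near_0_partition \<alpha> p0 b T x0 lam Lam H L M gap N e1 \<kappa> "\<bar>d\<bar> + 1" Kc \<rho> K e3 "max C3 0" .
  have C0: "0 \<le> part.C\<^sub>0" using part.Kc by (simp add: part.C\<^sub>0_def)
  \<comment> \<open>The end point 0 of the closed interval is a null set.\<close>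
  have "AE a in lborel. a \<notin> {0::real}" by (intro AE_not_in countable_imp_null_set_lborel) simp
  with part.rational_plateau_frequencies
  have "AE a in lborel. a \<in> {0..e1/2} \<longrightarrow> typical_point (T a) (\<mu> a) (x0 a)"
  proof eventually_elim
    case (elim a)
    show ?case
    proof
      assume a: "a \<in> {0..e1/2}"
      then have ain: "a \<in> {0<..<e1}" using elim(2) e1(1) by (auto simp: order.strict_iff_order)
      have a01: "a \<in> {0..1}" using ain e1 e0 by auto
      show "typical_point (T a) (\<mu> a) (x0 a)"
      proof (rule typical_point_if_frequency_bound[of "part_pts p0 b a"])
        show "finite (part_pts p0 b a)" by (simp add: part_pts_def)
        show "0 \<in> part_pts p0 b a" "1 \<in> part_pts p0 b a" by (rule ends[OF a01])+
        show "isCont (T a) z" if "z \<in> {0..1} - part_pts p0 b a" for z using T_cont[OF a01] that by blast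
        show "T a z \<in> {0..1}" if "z \<in> {0..1}" for z by (rule T_unit[OF a01 that])
        show "acip (T a) (\<mu> a)" by (rule acip(1)[OF a01])
        show "\<nu> = \<mu> a" if "acip (T a) \<nu>" for \<nu> by (rule acip(2)[OF a01 that])
        show "x0 a \<in> {0..1}" by (rule x0_unit[OF a01])
        show "0 \<le> part.C\<^sub>0" by (rule C0)
        fix u v d e :: real
        assume "u \<in> \<rat>" "v \<in> \<rat>" "d \<in> \<rat>" "u < v" "0 < d" "0 < e"
        then show "\<forall>\<^sub>F n in sequentially. (\<Sum>i=1..n. plateau u v d ((T a ^^ i) (x0 a))) \<le> (part.C\<^sub>0 * (v - u + 2 * d) + e) * real n"
          using elim(1) ain unfolding orb_def by blast
      qed
    qed
  qed
  then show ?thesis using e1(1,7) by (intro exI[of _ "e1/2"]) auto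
qed

end
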